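(* Let $A \supseteq B$ be a Frobenius extension or a QF extension of unital associative rings ($1_A = 1_B$), let $E = \mathrm{End}(A_B)$, and let $n \geq 1$ be an integer. Then $A \supseteq B$ has H-depth $2n-1$ if and only if the endomorphism ring extension $E \supseteq A$ (via $\lambda: A \hookrightarrow E$, $\lambda_a(x) = ax$) has depth $2n-1$.
   Context: For (bi)modules $M, N$, $M$ and $N$ are H-equivalent ($M \sim N$) if $N$ is isomorphic to a direct summand of $M^q$ and $M$ is isomorphic to a direct summand of $N^s$ for some positive integers $q,s$. $A \supseteq B$ is a Frobenius extension if $A_B$ is finitely generated projective and ${}_BA_A \cong \mathrm{Hom}(A_B, B_B)$ as $B$-$A$-bimodules; it is a QF extension if both $A_B$ and ${}_BA$ are finitely generated projective, and ${}_AA_B \sim {}_A\mathrm{Hom}({}_BA, {}_BB)_B$ and ${}_BA_A \sim {}_B\mathrm{Hom}(A_B, B_B)_A$ as bimodules, where $(afb)(x) = f(xa)b$ on $\mathrm{Hom}({}_BA,{}_BB)$ and $(bfa)(x) = bf(ax)$ on $\mathrm{Hom}(A_B,B_B)$. For a ring extension $R \supseteq S$: $C_0(R,S) = S$ (as $S$-$S$-bimodule), and for $m \geq 1$, $C_m(R,S) = R \otimes_S \cdots \otimes_S R$ ($m$ factors $R$), an $R$-$R$-bimodule via multiplication on the outer factors, and by restriction an $S$-$S$-bimodule. $R \supseteq S$ has depth $2m+1$ ($m \geq 0$) if $C_{m+1}(R,S) \sim C_m(R,S)$ as $S$-$S$-bimodules. It has H-depth $2m-1$ ($m \geq 1$)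 if $C_{m+1}(R,S)$ is isomorphic as $R$-$R$-bimodule to a direct summand of $C_m(R,S)^q$ for some positive integer $q$. *)

theory Defs
  imports "HOL-Algebra.Algebra" "HOL-Library.FuncSet" "HOL-Library.Poly_Mapping"
begin

section \<open>Bimodules\<close>

text \<open>
  The locale \<open>module\<close> of HOL-Algebra requires a commutative ring of scalars, so only its
  record type is reused here, extended by a right action.  As for that record, the fields
  \<open>mult\<close> and \<open>one\<close> of a bimodule are junk.
\<close>

record ('r, 's, 'm) bimodule = "('r, 'm) module" +
  rsmult :: "['m, 's] \<Rightarrow> 'm" (infixl \<open>\<odot>\<^sub>r\<index>\<close> 70)

definition regular_bimodule :: "('a, 'x) ring_scheme \<Rightarrow> ('a, 'a, 'a) bimodule" where
  "regular_bimodule R =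
     \<lparr>carrier = carrier R, monoid.mult = monoid.mult R, monoid.one = monoid.one R, ring.zero = ring.zero R, ring.add = ring.add R,
      smult = monoid.mult R, rsmult = monoid.mult R\<rparr>"

definition restrict_scalars ::
    "('p \<Rightarrow> 'r) \<Rightarrow> ('q \<Rightarrow> 's) \<Rightarrow> ('r, 's, 'm) bimodule \<Rightarrow> ('p, 'q, 'm) bimodule" where
  "restrict_scalars f g M =
     \<lparr>carrier = carrier M, monoid.mult = monoid.mult M, monoid.one = monoid.one M, ring.zero = ring.zero M, ring.add = ring.add M,
      smult = (\<lambda>p x. f p \<odot>\<^bsub>M\<^esub> x), rsmult = (\<lambda>x q. x \<odot>\<^sub>r\<^bsub>M\<^esub> g q)\<rparr>"

text \<open>Left modules and right modules are treated as bimodules with the integers on the other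
  side.\<close>

definition as_left_module :: "('r, 's, 'm) bimodule \<Rightarrow> ('r, int, 'm) bimodule" where
  "as_left_module M =
     \<lparr>carrier = carrier M, monoid.mult = monoid.mult M, monoid.one = monoid.one M, ring.zero = ring.zero M, ring.add = ring.add M,
      smult = smult M, rsmult = (\<lambda>x k. [k] \<cdot>\<^bsub>M\<^esub> x)\<rparr>"

definition as_right_module :: "('r, 's, 'm) bimodule \<Rightarrow> (int, 's, 'm) bimodule" where
  "as_right_module M =
     \<lparr>carrier = carrier M, monoid.mult = monoid.mult M, monoid.one = monoid.one M, ring.zero = ring.zero M, ring.add = ring.add M,
      smult = (\<lambda>k x. [k] \<cdot>\<^bsub>M\<^esub> x), rsmult = rsmult M\<rparr>"

text \<open>Homomorphisms are extensional functions, so that they form sets on which Hom-bimodules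
  and endomorphism rings can be based.\<close>

definition additive_hom ::
    "('a, 'x) ring_scheme \<Rightarrow> ('b, 'y) ring_scheme \<Rightarrow> ('a \<Rightarrow> 'b) set" where
  "additive_hom M N =
     {f \<in> carrier M \<rightarrow>\<^sub>E carrier N.
        \<forall>x\<in>carrier M. \<forall>y\<in>carrier M. f (x \<oplus>\<^bsub>M\<^esub> y) = f x \<oplus>\<^bsub>N\<^esub> f y}"

definition left_hom ::
    "('r, 'x) ring_scheme \<Rightarrow> ('r, 's, 'm) bimodule \<Rightarrow> ('r, 't, 'n) bimodule \<Rightarrow> ('m \<Rightarrow> 'n) set" where
  "left_hom R M N =
     {f \<in> additive_hom M N. \<forall>r\<in>carrier R. \<forall>x\<in>carrier M. f (r \<odot>\<^bsub>M\<^esub> x) = r \<odot>\<^bsub>N\<^esub> f x}"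

definition right_hom ::
    "('s, 'x) ring_scheme \<Rightarrow> ('r, 's, 'm) bimodule \<Rightarrow> ('t, 's, 'n) bimodule \<Rightarrow> ('m \<Rightarrow> 'n) set" where
  "right_hom S M N =
     {f \<in> additive_hom M N. \<forall>x\<in>carrier M. \<forall>s\<in>carrier S. f (x \<odot>\<^sub>r\<^bsub>M\<^esub> s) = f x \<odot>\<^sub>r\<^bsub>N\<^esub> s}"

definition bimodule_iso ::
    "('r, 'x) ring_scheme \<Rightarrow> ('s, 'y) ring_scheme \<Rightarrow>
     ('r, 's, 'm) bimodule \<Rightarrow> ('r, 's, 'n) bimodule \<Rightarrow> bool" where
  "bimodule_iso R S M N \<longleftrightarrow>
     (\<exists>f \<in> left_hom R M N \<inter> right_hom S M N. bij_betw f (carrier M) (carrier N))"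

definition sub_bimodule ::
    "('r, 'x) ring_scheme \<Rightarrow> ('s, 'y) ring_scheme \<Rightarrow> 'm set \<Rightarrow> ('r, 's, 'm) bimodule \<Rightarrow> bool" where
  "sub_bimodule R S K M \<longleftrightarrow>
     additive_subgroup K M \<and>
     (\<forall>r\<in>carrier R. \<forall>x\<in>K. r \<odot>\<^bsub>M\<^esub> x \<in> K) \<and>
     (\<forall>x\<in>K. \<forall>s\<in>carrier S. x \<odot>\<^sub>r\<^bsub>M\<^esub> s \<in> K)"

definition direct_summand ::
    "('r, 'x) ring_scheme \<Rightarrow> ('s, 'y) ring_scheme \<Rightarrow> 'm set \<Rightarrow> ('r, 's, 'm) bimodule \<Rightarrow> bool" where
  "direct_summand R S K M \<longleftrightarrow>
     sub_bimodule R S K M \<and>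
     (\<exists>L. sub_bimodule R S L M \<and> K \<inter> L = {\<zero>\<^bsub>M\<^esub>} \<and> K <+>\<^bsub>M\<^esub> L = carrier M)"

definition iso_to_direct_summand ::
    "('r, 'x) ring_scheme \<Rightarrow> ('s, 'y) ring_scheme \<Rightarrow>
     ('r, 's, 'n) bimodule \<Rightarrow> ('r, 's, 'm) bimodule \<Rightarrow> bool" where
  "iso_to_direct_summand R S N M \<longleftrightarrow>
     (\<exists>K. direct_summand R S K M \<and> bimodule_iso R S N (M\<lparr>carrier := K\<rparr>))"

definition bimodule_power ::
    "('r, 's, 'm) bimodule \<Rightarrow> nat \<Rightarrow> ('r, 's, nat \<Rightarrow> 'm) bimodule" where
  "bimodule_power M q =
     \<lparr>carrier = {..<q} \<rightarrow>\<^sub>E carrier M, monoid.mult = undefined, monoid.one = undefined,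
      ring.zero = (\<lambda>i\<in>{..<q}. \<zero>\<^bsub>M\<^esub>), ring.add = (\<lambda>x y. \<lambda>i\<in>{..<q}. x i \<oplus>\<^bsub>M\<^esub> y i),
      smult = (\<lambda>r x. \<lambda>i\<in>{..<q}. r \<odot>\<^bsub>M\<^esub> x i), rsmult = (\<lambda>x s. \<lambda>i\<in>{..<q}. x i \<odot>\<^sub>r\<^bsub>M\<^esub> s)\<rparr>"

definition H_equivalent ::
    "('r, 'x) ring_scheme \<Rightarrow> ('s, 'y) ring_scheme \<Rightarrow>
     ('r, 's, 'm) bimodule \<Rightarrow> ('r, 's, 'n) bimodule \<Rightarrow> bool" where
  "H_equivalent R S M N \<longleftrightarrow>
     (\<exists>q>0. iso_to_direct_summand R S N (bimodule_power M q)) \<and>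
     (\<exists>s>0. iso_to_direct_summand R S M (bimodule_power N s))"


section \<open>Frobenius and QF extensions\<close>

text \<open>Finitely generated projective: isomorphic to a direct summand of a free module of
  finite rank.\<close>

definition fg_projective_left ::
    "('r, 'x) ring_scheme \<Rightarrow> ('r, 's, 'm) bimodule \<Rightarrow> bool" where
  "fg_projective_left R M \<longleftrightarrow>
     (\<exists>k. iso_to_direct_summand R \<Z> (as_left_module M)
            (bimodule_power (as_left_module (regular_bimodule R)) k))"

definition fg_projective_right ::
    "('s, 'x) ring_scheme \<Rightarrow> ('r, 's, 'm) bimodule \<Rightarrow> bool" where
  "fg_projective_right S M \<longleftrightarrow>
     (\<exists>k. iso_to_direct_summand \<Z> S (as_right_module M)
            (bimodule_power (as_right_module (regular_bimodule S)) k))"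

text \<open>For \<open>M\<close> an \<open>R\<close>-\<open>S\<close>-bimodule and \<open>N\<close> an \<open>R\<close>-\<open>T\<close>-bimodule, the left \<open>R\<close>-linear maps
  form an \<open>S\<close>-\<open>T\<close>-bimodule.\<close>

definition Hom_left ::
    "('r, 'x) ring_scheme \<Rightarrow> ('r, 's, 'm) bimodule \<Rightarrow> ('r, 't, 'n) bimodule \<Rightarrow>
     ('s, 't, 'm \<Rightarrow> 'n) bimodule" where
  "Hom_left R M N =
     \<lparr>carrier = left_hom R M N, monoid.mult = undefined, monoid.one = undefined,
      ring.zero = (\<lambda>x\<in>carrier M. \<zero>\<^bsub>N\<^esub>), ring.add = (\<lambda>f g. \<lambda>x\<in>carrier M. f x \<oplus>\<^bsub>N\<^esub> g x),
      smult = (\<lambda>s f. \<lambda>x\<in>carrier M. f (x \<odot>\<^sub>r\<^bsub>M\<^esub> s)),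
      rsmult = (\<lambda>f t. \<lambda>x\<in>carrier M. f x \<odot>\<^sub>r\<^bsub>N\<^esub> t)\<rparr>"

text \<open>For \<open>M\<close> an \<open>R\<close>-\<open>S\<close>-bimodule and \<open>N\<close> a \<open>T\<close>-\<open>S\<close>-bimodule, the right \<open>S\<close>-linear maps
  form a \<open>T\<close>-\<open>R\<close>-bimodule.\<close>

definition Hom_right ::
    "('s, 'x) ring_scheme \<Rightarrow> ('r, 's, 'm) bimodule \<Rightarrow> ('t, 's, 'n) bimodule \<Rightarrow>
     ('t, 'r, 'm \<Rightarrow> 'n) bimodule" where
  "Hom_right S M N =
     \<lparr>carrier = right_hom S M N, monoid.mult = undefined, monoid.one = undefined,
      ring.zero = (\<lambda>x\<in>carrier M. \<zero>\<^bsub>N\<^esub>), ring.add = (\<lambda>f g. \<lambda>x\<in>carrier M. f x \<oplus>\<^bsub>N\<^esub> g x),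
      smult = (\<lambda>t f. \<lambda>x\<in>carrier M. t \<odot>\<^bsub>N\<^esub> f x),
      rsmult = (\<lambda>f r. \<lambda>x\<in>carrier M. f (r \<odot>\<^bsub>M\<^esub> x))\<rparr>"

text \<open>The subring is given by its underlying set.  Because its elements are elements of the
  overring, \<open>regular_bimodule A\<close> serves unchanged as an \<open>A\<close>-\<open>B\<close>-, \<open>B\<close>-\<open>A\<close>- and
  \<open>B\<close>-\<open>B\<close>-bimodule: which scalars count is decided by the ring arguments of
  \<open>bimodule_iso\<close>, \<open>H_equivalent\<close> etc.\<close>

definition Frobenius_extension :: "('a, 'x) ring_scheme \<Rightarrow> 'a set \<Rightarrow> bool" where
  "Frobenius_extension A B \<longleftrightarrow>
     (let B' = A\<lparr>carrier := B\<rparr> in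
       fg_projective_right B' (regular_bimodule A) \<and>
       bimodule_iso B' A (regular_bimodule A)
         (Hom_right B' (regular_bimodule A) (regular_bimodule B')))"

definition QF_extension :: "('a, 'x) ring_scheme \<Rightarrow> 'a set \<Rightarrow> bool" where
  "QF_extension A B \<longleftrightarrow>
     (let B' = A\<lparr>carrier := B\<rparr> in
       fg_projective_right B' (regular_bimodule A) \<and>
       fg_projective_left B' (regular_bimodule A) \<and>
       H_equivalent A B' (regular_bimodule A)
         (Hom_left B' (regular_bimodule A) (regular_bimodule B')) \<and>
       H_equivalent B' A (regular_bimodule A)
         (Hom_right B' (regular_bimodule A) (regular_bimodule B')))"

definition End_right ::
    "('s, 'x) ring_scheme \<Rightarrow> ('r, 's, 'm) bimodule \<Rightarrow> ('m \<Rightarrow> 'm) ring" where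
  "End_right S M =
     \<lparr>carrier = right_hom S M M, monoid.mult = compose (carrier M), monoid.one = (\<lambda>x\<in>carrier M. x),
      ring.zero = (\<lambda>x\<in>carrier M. \<zero>\<^bsub>M\<^esub>), ring.add = (\<lambda>f g. \<lambda>x\<in>carrier M. f x \<oplus>\<^bsub>M\<^esub> g x)\<rparr>"

definition left_multiplication :: "('a, 'x) ring_scheme \<Rightarrow> 'a \<Rightarrow> 'a \<Rightarrow> 'a" where
  "left_multiplication A a = (\<lambda>x\<in>carrier A. a \<otimes>\<^bsub>A\<^esub> x)"


section \<open>Tensor powers of a ring over another ring\<close>

text \<open>
  In this section \<open>h\<close> is the embedding of \<open>S\<close> into \<open>R\<close> (the identity for a subring).
  All tensor powers must live in one type, so \<open>R \<otimes>\<^sub>S \<dots> \<otimes>\<^sub>S R\<close> (\<open>m \<ge> 1\<close> factors) is built in one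
  step: the free abelian group on \<open>m\<close>-tuples modulo additivity in each entry and
  \<open>S\<close>-balancedness at each tensor sign.  For \<open>m = 1\<close> this is \<open>R\<close> up to isomorphism.
\<close>

definition tuples :: "('a, 'x) ring_scheme \<Rightarrow> nat \<Rightarrow> 'a list set" where
  "tuples R m = {xs. length xs = m \<and> set xs \<subseteq> carrier R}"

definition tensor_relations ::
    "('a, 'x) ring_scheme \<Rightarrow> ('s, 'y) ring_scheme \<Rightarrow> ('s \<Rightarrow> 'a) \<Rightarrow> nat \<Rightarrow> ('a list \<Rightarrow>\<^sub>0 int) set" where
  "tensor_relations R S h m =
     {frag_of (us @ (x \<oplus>\<^bsub>R\<^esub> y) # vs) - frag_of (us @ x # vs) - frag_of (us @ y # vs) | us x y vs.
        us @ x # vs \<in> tuples R m \<and> us @ y # vs \<in> tuples R m} \<union>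
     {frag_of (us @ (x \<otimes>\<^bsub>R\<^esub> h s) # y # vs) - frag_of (us @ x # (h s \<otimes>\<^bsub>R\<^esub> y) # vs) | us x s y vs.
        us @ x # y # vs \<in> tuples R m \<and> s \<in> carrier S}"

definition tensor_kernel ::
    "('a, 'x) ring_scheme \<Rightarrow> ('s, 'y) ring_scheme \<Rightarrow> ('s \<Rightarrow> 'a) \<Rightarrow> nat \<Rightarrow> ('a list \<Rightarrow>\<^sub>0 int) set" where
  "tensor_kernel R S h m =
     generate (free_Abelian_group (tuples R m)) (tensor_relations R S h m)"

text \<open>The elements are cosets \<open>C\<close> of the kernel; an additive map \<open>\<phi>\<close> preserving the kernel
  sends \<open>C\<close> to the coset \<open>kernel + \<phi> ` C\<close>.\<close>

definition tensor_power ::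
    "('a, 'x) ring_scheme \<Rightarrow> ('s, 'y) ring_scheme \<Rightarrow> ('s \<Rightarrow> 'a) \<Rightarrow> nat \<Rightarrow>
     ('a, 'a, ('a list \<Rightarrow>\<^sub>0 int) set) bimodule" where
  "tensor_power R S h m =
     (let F = free_Abelian_group (tuples R m); K = tensor_kernel R S h m in
       \<lparr>carrier = carrier (F Mod K), monoid.mult = undefined, monoid.one = undefined,
        ring.zero = monoid.one (F Mod K), ring.add = monoid.mult (F Mod K),
        smult = (\<lambda>r C. K <#>\<^bsub>F\<^esub> (frag_extend (\<lambda>xs. frag_of ((r \<otimes>\<^bsub>R\<^esub> hd xs) # tl xs)) ` C)),
        rsmult = (\<lambda>C r. K <#>\<^bsub>F\<^esub> (frag_extend (\<lambda>xs. frag_of (butlast xs @ [last xs \<otimes>\<^bsub>R\<^esub> r])) ` C))\<rparr>)"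


section \<open>Depth and H-depth\<close>

text \<open>Only odd depths are defined; both predicates are false for even \<open>d\<close>.  In depth \<open>1\<close> the
  zeroth tensor power, which is \<open>S\<close> itself, occurs.\<close>

definition has_depth ::
    "('a, 'x) ring_scheme \<Rightarrow> ('s, 'y) ring_scheme \<Rightarrow> ('s \<Rightarrow> 'a) \<Rightarrow> nat \<Rightarrow> bool" where
  "has_depth R S h d \<longleftrightarrow>
     (\<exists>m. d = 2 * m + 1 \<and>
       (if m = 0
        then H_equivalent S S (restrict_scalars h h (tensor_power R S h 1)) (regular_bimodule S)
        else H_equivalent S S (restrict_scalars h h (tensor_power R S h (m + 1)))
               (restrict_scalars h h (tensor_power R S h m))))"

definition has_H_depth ::
    "('a, 'x) ring_scheme \<Rightarrow> ('s, 'y) ring_scheme \<Rightarrow> ('s \<Rightarrow> 'a) \<Rightarrow> nat \<Rightarrow> bool" where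
  "has_H_depth R S h d \<longleftrightarrow>
     (\<exists>m\<ge>1. d = 2 * m - 1 \<and>
       (\<exists>q>0. iso_to_direct_summand R R (tensor_power R S h (m + 1))
                (bimodule_power (tensor_power R S h m) q)))"

end

theory Submission
  imports Defs
begin

text \<open>
  Write \<open>E = End(A\<^sub>B)\<close> and \<open>D = Hom(A\<^sub>B, B\<^sub>B)\<close>, write \<open>C\<^sub>m\<close> for the tensor powers of an extension
  (with \<open>C\<^sub>0(E,A) = A\<close>), and write \<open>N | M\<close> if \<open>N\<close> is isomorphic to a direct summand of some power
  \<open>M\<^sup>q\<close> with \<open>q > 0\<close>.  Equivalently, the identity of \<open>N\<close> is a finite sum of maps factoring through
  \<open>M\<close> (\<open>summand_of_power_iff\<close>).  All the work is done with such sums, which turns every claim of the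
  form \<open>N | M\<close> into an identity between explicit maps.

  Since \<open>A\<^sub>B\<close> is finitely generated projective, \<open>E\<close> is \<open>A \<otimes>\<^sub>B D\<close> by means of the dyads
  \<open>a \<mapsto> x \<phi>(a)\<close>.  In the Frobenius case \<open>D\<close> is isomorphic, and in the QF case H-equivalent, to \<open>A\<close> as
  a \<open>B\<close>-\<open>A\<close>-bimodule.  So if \<open>U \<sim> U'\<close> as \<open>A\<close>-\<open>A\<close>-bimodules, then
  \<open>E \<otimes>\<^sub>A U = A \<otimes>\<^sub>B D \<otimes>\<^sub>A U \<sim> A \<otimes>\<^sub>B A \<otimes>\<^sub>A U' = A \<otimes>\<^sub>B U'\<close>; the two halves of this are
  \<open>summand_forward\<close> and \<open>summand_backward\<close>.  Starting from \<open>C\<^sub>0(E,A) = A \<sim> C\<^sub>1(A,B)\<close> and iterating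
  gives \<open>C\<^sub>m(E,A) \<sim> C\<^sub>m\<^sub>+\<^sub>1(A,B)\<close> as \<open>A\<close>-\<open>A\<close>-bimodules for all \<open>m\<close> (\<open>endomorphism_tower\<close>).

  Thus \<open>E \<supseteq> A\<close> has depth \<open>2n-1\<close> if and only if \<open>C\<^sub>n\<^sub>+\<^sub>1(A,B) \<sim> C\<^sub>n(A,B)\<close> as \<open>A\<close>-\<open>A\<close>-bimodules, whereas
  H-depth \<open>2n-1\<close> of \<open>A \<supseteq> B\<close> is the one half \<open>C\<^sub>n\<^sub>+\<^sub>1(A,B) | C\<^sub>n(A,B)\<close> of that.  The other half is
  automatic.  For \<open>n \<ge> 2\<close> the insertion of a factor \<open>1\<close> splits (\<open>T_summand_T_Suc\<close>).  For \<open>n = 1\<close> the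
  claim is that \<open>A \<otimes>\<^sub>B A | A\<close> implies \<open>A | A \<otimes>\<^sub>B A\<close>, which is the theorem that H-separable
  extensions are separable (\<open>H_separable_imp_separable\<close>); it follows from Nakayama's lemma over the
  center of \<open>A\<close>.
\<close>

section \<open>Direct summands of powers\<close>

text \<open>An abelian group with additive operators on both sides.  Nothing relates these to the ring
  structures of \<open>R\<close> and \<open>S\<close>, so bimodules, their powers, and left or right modules with the integers
  on the other side are treated alike.\<close>

locale biaction = abelian_group M
  for R :: "('r, 'x) ring_scheme" and S :: "('s, 'y) ring_scheme"
    and M :: "('r, 's, 'm) bimodule" +
  assumes lact_closed [simp]: "r \<in> carrier R \<Longrightarrow> x \<in> carrier M \<Longrightarrow> r \<odot>\<^bsub>M\<^esub> x \<in> carrier M"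
    and ract_closed [simp]: "x \<in> carrier M \<Longrightarrow> s \<in> carrier S \<Longrightarrow> x \<odot>\<^sub>r\<^bsub>M\<^esub> s \<in> carrier M"
    and lact_add: "r \<in> carrier R \<Longrightarrow> x \<in> carrier M \<Longrightarrow> y \<in> carrier M \<Longrightarrow>
      r \<odot>\<^bsub>M\<^esub> (x \<oplus>\<^bsub>M\<^esub> y) = r \<odot>\<^bsub>M\<^esub> x \<oplus>\<^bsub>M\<^esub> r \<odot>\<^bsub>M\<^esub> y"
    and ract_add: "s \<in> carrier S \<Longrightarrow> x \<in> carrier M \<Longrightarrow> y \<in> carrier M \<Longrightarrow>
      (x \<oplus>\<^bsub>M\<^esub> y) \<odot>\<^sub>r\<^bsub>M\<^esub> s = x \<odot>\<^sub>r\<^bsub>M\<^esub> s \<oplus>\<^bsub>M\<^esub> y \<odot>\<^sub>r\<^bsub>M\<^esub> s"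

definition bihom ::
    "('r, 'x) ring_scheme \<Rightarrow> ('s, 'y) ring_scheme \<Rightarrow>
     ('r, 's, 'm) bimodule \<Rightarrow> ('r, 's, 'n) bimodule \<Rightarrow> ('m \<Rightarrow> 'n) set" where
  "bihom R S M N = left_hom R M N \<inter> right_hom S M N"

lemma bihomI:
  assumes "f \<in> carrier M \<rightarrow>\<^sub>E carrier N"
    and "\<And>x y. x \<in> carrier M \<Longrightarrow> y \<in> carrier M \<Longrightarrow> f (x \<oplus>\<^bsub>M\<^esub> y) = f x \<oplus>\<^bsub>N\<^esub> f y"
    and "\<And>r x. r \<in> carrier R \<Longrightarrow> x \<in> carrier M \<Longrightarrow> f (r \<odot>\<^bsub>M\<^esub> x) = r \<odot>\<^bsub>N\<^esub> f x"
    and "\<And>x s. x \<in> carrier M \<Longrightarrow> s \<in> carrier S \<Longrightarrow> f (x \<odot>\<^sub>r\<^bsub>M\<^esub> s) = f x \<odot>\<^sub>r\<^bsub>N\<^esub> s"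
  shows "f \<in> bihom R S M N"
  using assms by (auto simp: bihom_def left_hom_def right_hom_def additive_hom_def)

lemma bihomD:
  assumes "f \<in> bihom R S M N"
  shows "f \<in> carrier M \<rightarrow>\<^sub>E carrier N"
    and "x \<in> carrier M \<Longrightarrow> f x \<in> carrier N"
    and "x \<in> carrier M \<Longrightarrow> y \<in> carrier M \<Longrightarrow> f (x \<oplus>\<^bsub>M\<^esub> y) = f x \<oplus>\<^bsub>N\<^esub> f y"
    and "r \<in> carrier R \<Longrightarrow> x \<in> carrier M \<Longrightarrow> f (r \<odot>\<^bsub>M\<^esub> x) = r \<odot>\<^bsub>N\<^esub> f x"
    and "x \<in> carrier M \<Longrightarrow> s \<in> carrier S \<Longrightarrow> f (x \<odot>\<^sub>r\<^bsub>M\<^esub> s) = f x \<odot>\<^sub>r\<^bsub>N\<^esub> s"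
  using assms by (auto simp: bihom_def left_hom_def right_hom_def additive_hom_def)

lemma additive_zero:
  assumes "abelian_group M" "abelian_group N"
    and "\<And>x. x \<in> carrier M \<Longrightarrow> f x \<in> carrier N"
    and "\<And>x y. x \<in> carrier M \<Longrightarrow> y \<in> carrier M \<Longrightarrow> f (x \<oplus>\<^bsub>M\<^esub> y) = f x \<oplus>\<^bsub>N\<^esub> f y"
  shows "f \<zero>\<^bsub>M\<^esub> = \<zero>\<^bsub>N\<^esub>"
proof -
  interpret M: abelian_group M by fact
  interpret N: abelian_group N by fact
  have "f \<zero>\<^bsub>M\<^esub> \<oplus>\<^bsub>N\<^esub> f \<zero>\<^bsub>M\<^esub> = f \<zero>\<^bsub>M\<^esub>"
    using assms(4)[of "\<zero>\<^bsub>M\<^esub>" "\<zero>\<^bsub>M\<^esub>"] by simp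
  then show ?thesis using assms(3)[of "\<zero>\<^bsub>M\<^esub>"] N.add.r_cancel_one'[of "f \<zero>\<^bsub>M\<^esub>" "f \<zero>\<^bsub>M\<^esub>"] by simp
qed

lemma additive_neg:
  assumes "abelian_group M" "abelian_group N"
    and "\<And>x. x \<in> carrier M \<Longrightarrow> f x \<in> carrier N"
    and "\<And>x y. x \<in> carrier M \<Longrightarrow> y \<in> carrier M \<Longrightarrow> f (x \<oplus>\<^bsub>M\<^esub> y) = f x \<oplus>\<^bsub>N\<^esub> f y"
    and "x \<in> carrier M"
  shows "f (\<ominus>\<^bsub>M\<^esub> x) = \<ominus>\<^bsub>N\<^esub> f x"
proof -
  interpret M: abelian_group M by fact
  interpret N: abelian_group N by fact
  have "f (\<ominus>\<^bsub>M\<^esub> x) \<oplus>\<^bsub>N\<^esub> f x = \<zero>\<^bsub>N\<^esub>"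
    using assms(4)[of "\<ominus>\<^bsub>M\<^esub> x" x] additive_zero[of M N f] assms by (simp add: M.l_neg)
  then show ?thesis using assms(3,5) N.minus_equality by simp
qed

lemma (in biaction) lact_zero [simp]: "r \<in> carrier R \<Longrightarrow> r \<odot>\<^bsub>M\<^esub> \<zero>\<^bsub>M\<^esub> = \<zero>\<^bsub>M\<^esub>"
  by (rule additive_zero[OF abelian_group_axioms abelian_group_axioms]) (auto simp: lact_add)

lemma (in biaction) ract_zero [simp]: "s \<in> carrier S \<Longrightarrow> \<zero>\<^bsub>M\<^esub> \<odot>\<^sub>r\<^bsub>M\<^esub> s = \<zero>\<^bsub>M\<^esub>"
  by (rule additive_zero[OF abelian_group_axioms abelian_group_axioms, where f = "\<lambda>x. x \<odot>\<^sub>r\<^bsub>M\<^esub> s"])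
    (auto simp: ract_add)

lemma bihom_zero:
  assumes "f \<in> bihom R S M N" "abelian_group M" "abelian_group N"
  shows "f \<zero>\<^bsub>M\<^esub> = \<zero>\<^bsub>N\<^esub>"
  using additive_zero[OF assms(2,3), of f] bihomD[OF assms(1)] by blast

lemma bihom_compose:
  assumes "f \<in> bihom R S M N" "g \<in> bihom R S N P" "biaction R S M"
  shows "compose (carrier M) g f \<in> bihom R S M P"
proof -
  interpret biaction R S M by fact
  show ?thesis
    by (rule bihomI) (use bihomD[OF assms(1)] bihomD[OF assms(2)] in \<open>auto simp: compose_def\<close>)
qed

lemma zero_bihom:
  assumes "biaction R S M" "biaction R S N"
  shows "(\<lambda>x\<in>carrier M. \<zero>\<^bsub>N\<^esub>) \<in> bihom R S M N"
proof -
  interpret M: biaction R S M by fact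
  interpret N: biaction R S N by fact
  show ?thesis by (rule bihomI) auto
qed

text \<open>A section \<open>F\<close> of a bimodule map \<open>G\<close> splits \<open>P\<close> into the image of \<open>F\<close> and the kernel of \<open>G\<close>.\<close>

lemma retract_imp_summand:
  assumes "biaction R S N" "biaction R S P"
    and F: "F \<in> bihom R S N P" and G: "G \<in> bihom R S P N"
    and GF: "\<And>x. x \<in> carrier N \<Longrightarrow> G (F x) = x"
  shows "iso_to_direct_summand R S N P"
proof -
  interpret N: biaction R S N by fact
  interpret P: biaction R S P by fact
  note F' = bihomD[OF F] and G' = bihomD[OF G]
  define K where "K = F ` carrier N"
  define L where "L = {y \<in> carrier P. G y = \<zero>\<^bsub>N\<^esub>}"
  have Fneg: "F (\<ominus>\<^bsub>N\<^esub> x) = \<ominus>\<^bsub>P\<^esub> F x" if "x \<in> carrier N" for x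
    using additive_neg[of N P F x] F' N.abelian_group_axioms P.abelian_group_axioms that by blast
  have Gneg: "G (\<ominus>\<^bsub>P\<^esub> x) = \<ominus>\<^bsub>N\<^esub> G x" if "x \<in> carrier P" for x
    using additive_neg[of P N G x] G' N.abelian_group_axioms P.abelian_group_axioms that by blast
  have G0: "G \<zero>\<^bsub>P\<^esub> = \<zero>\<^bsub>N\<^esub>"
    by (rule bihom_zero[OF G P.abelian_group_axioms N.abelian_group_axioms])
  have F0: "F \<zero>\<^bsub>N\<^esub> = \<zero>\<^bsub>P\<^esub>"
    by (rule bihom_zero[OF F N.abelian_group_axioms P.abelian_group_axioms])
  have "subgroup K (add_monoid P)"
  proof (rule P.add.subgroupI)
    show "K \<subseteq> carrier P" using F'(2) by (auto simp: K_def)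
    show "K \<noteq> {}" using N.zero_closed unfolding K_def by blast
    show "\<ominus>\<^bsub>P\<^esub> a \<in> K" if a: "a \<in> K" for a
    proof -
      obtain x where x: "x \<in> carrier N" "a = F x" using a by (auto simp: K_def)
      then have "\<ominus>\<^bsub>P\<^esub> a = F (\<ominus>\<^bsub>N\<^esub> x)" using Fneg by simp
      then show ?thesis using x(1) by (auto simp: K_def)
    qed
    show "a \<oplus>\<^bsub>P\<^esub> b \<in> K" if ab: "a \<in> K" "b \<in> K" for a b
    proof -
      obtain x y where xy: "x \<in> carrier N" "y \<in> carrier N" "a = F x" "b = F y"
        using ab by (auto simp: K_def)
      then have "a \<oplus>\<^bsub>P\<^esub> b = F (x \<oplus>\<^bsub>N\<^esub> y)" using F' by simp
      then show ?thesis using xy by (auto simp: K_def)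
    qed
  qed
  then have "sub_bimodule R S K P"
    unfolding sub_bimodule_def
    using F' by (auto simp: K_def intro!: additive_subgroup.intro)
      (metis imageI N.lact_closed, metis imageI N.ract_closed)
  moreover have "subgroup L (add_monoid P)"
    by (rule P.add.subgroupI) (auto simp: L_def G' G0 Gneg)
  then have "sub_bimodule R S L P"
    unfolding sub_bimodule_def using G'
    by (auto simp: L_def intro!: additive_subgroup.intro)
  moreover have "K \<inter> L = {\<zero>\<^bsub>P\<^esub>}"
  proof
    show "K \<inter> L \<subseteq> {\<zero>\<^bsub>P\<^esub>}" using GF F0 by (auto simp: K_def L_def)
    show "{\<zero>\<^bsub>P\<^esub>} \<subseteq> K \<inter> L" using F0 G0 unfolding K_def L_def
      by (auto intro!: rev_image_eqI[of "\<zero>\<^bsub>N\<^esub>"])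
  qed
  moreover have "K <+>\<^bsub>P\<^esub> L = carrier P"
  proof
    show "K <+>\<^bsub>P\<^esub> L \<subseteq> carrier P" using F'(2) by (auto simp: set_add_def' K_def L_def)
    show "carrier P \<subseteq> K <+>\<^bsub>P\<^esub> L"
    proof
      fix y assume y: "y \<in> carrier P"
      define k where "k = F (G y)"
      have k: "k \<in> carrier P" "k \<in> K" using y F' G' by (auto simp: k_def K_def)
      have "G (y \<ominus>\<^bsub>P\<^esub> k) = \<zero>\<^bsub>N\<^esub>"
        using y k G' GF[of "G y"] by (simp add: a_minus_def Gneg k_def N.r_neg)
      then have "y \<ominus>\<^bsub>P\<^esub> k \<in> L" using y k by (simp add: L_def)
      moreover have "y = k \<oplus>\<^bsub>P\<^esub> (y \<ominus>\<^bsub>P\<^esub> k)"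
        using y k(1) P.a_lcomm[of k y "\<ominus>\<^bsub>P\<^esub> k"] by (simp add: a_minus_def P.r_neg)
      ultimately show "y \<in> K <+>\<^bsub>P\<^esub> L" using k(2) unfolding set_add_def' by blast
    qed
  qed
  ultimately have "direct_summand R S K P" unfolding direct_summand_def by blast
  moreover have "bimodule_iso R S N (P\<lparr>carrier := K\<rparr>)"
  proof -
    have "F \<in> bihom R S N (P\<lparr>carrier := K\<rparr>)"
      by (rule bihomI) (use F' in \<open>auto simp: K_def\<close>)
    moreover have "bij_betw F (carrier N) K"
      unfolding K_def by (rule inj_on_imp_bij_betw) (metis GF inj_onI)
    ultimately show ?thesis unfolding bimodule_iso_def bihom_def by auto
  qed
  ultimately show ?thesis unfolding iso_to_direct_summand_def by blast
qed

text \<open>The retraction sends \<open>y\<close> to the element of \<open>N\<close> that corresponds to its component in the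
  summand \<open>K\<close>.\<close>

lemma summand_imp_retract:
  assumes "biaction R S N" "biaction R S P" "iso_to_direct_summand R S N P"
  obtains F G where "F \<in> bihom R S N P" "G \<in> bihom R S P N"
    "\<And>x. x \<in> carrier N \<Longrightarrow> G (F x) = x"
proof -
  interpret N: biaction R S N by fact
  interpret P: biaction R S P by fact
  obtain K where K: "direct_summand R S K P" and iso: "bimodule_iso R S N (P\<lparr>carrier := K\<rparr>)"
    using assms(3) unfolding iso_to_direct_summand_def by blast
  obtain L where subK: "sub_bimodule R S K P" and subL: "sub_bimodule R S L P"
    and KL: "K \<inter> L = {\<zero>\<^bsub>P\<^esub>}" "K <+>\<^bsub>P\<^esub> L = carrier P"
    using K unfolding direct_summand_def by blast
  obtain F where F0: "F \<in> bihom R S N (P\<lparr>carrier := K\<rparr>)" and bij: "bij_betw F (carrier N) K"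
    using iso unfolding bimodule_iso_def bihom_def by auto
  interpret K: additive_subgroup K P using subK by (simp add: sub_bimodule_def)
  interpret L: additive_subgroup L P using subL by (simp add: sub_bimodule_def)
  have KP: "K \<subseteq> carrier P" and LP: "L \<subseteq> carrier P" by (rule K.a_subset, rule L.a_subset)
  have F: "F \<in> bihom R S N P"
    by (rule bihomI) (use bihomD[OF F0] KP in \<open>auto simp: PiE_iff\<close>)
  note F' = bihomD[OF F]
  have FK: "F x \<in> K" if "x \<in> carrier N" for x using bij that by (auto simp: bij_betw_def)
  define G where "G = (\<lambda>y\<in>carrier P. THE x. x \<in> carrier N \<and> (\<exists>l\<in>L. y = F x \<oplus>\<^bsub>P\<^esub> l))"
  have uniq: "x = x'" if x: "x \<in> carrier N" "x' \<in> carrier N" "l \<in> L" "l' \<in> L"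
    and eq: "F x \<oplus>\<^bsub>P\<^esub> l = F x' \<oplus>\<^bsub>P\<^esub> l'" for x x' l l'
  proof -
    have c: "F x \<in> carrier P" "F x' \<in> carrier P" "l \<in> carrier P" "l' \<in> carrier P"
      using x F' LP by auto
    have "\<ominus>\<^bsub>P\<^esub> F x' \<oplus>\<^bsub>P\<^esub> F x = \<ominus>\<^bsub>P\<^esub> F x' \<oplus>\<^bsub>P\<^esub> ((F x \<oplus>\<^bsub>P\<^esub> l) \<oplus>\<^bsub>P\<^esub> \<ominus>\<^bsub>P\<^esub> l)"
      using c by (simp add: P.a_assoc P.r_neg)
    also have "\<dots> = l' \<oplus>\<^bsub>P\<^esub> \<ominus>\<^bsub>P\<^esub> l" unfolding eq using c by (simp add: P.a_assoc P.r_neg1)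
    finally have e: "\<ominus>\<^bsub>P\<^esub> F x' \<oplus>\<^bsub>P\<^esub> F x = l' \<oplus>\<^bsub>P\<^esub> \<ominus>\<^bsub>P\<^esub> l" .
    have "\<ominus>\<^bsub>P\<^esub> F x' \<oplus>\<^bsub>P\<^esub> F x \<in> K" using FK x K.a_inv_closed by (simp add: P.abelian_group_axioms)
    moreover have "l' \<oplus>\<^bsub>P\<^esub> \<ominus>\<^bsub>P\<^esub> l \<in> L" using x L.a_inv_closed by (simp add: P.abelian_group_axioms)
    ultimately have "\<ominus>\<^bsub>P\<^esub> F x' \<oplus>\<^bsub>P\<^esub> F x = \<zero>\<^bsub>P\<^esub>" using e KL by auto
    then have "F x = F x'" using c
      by (metis P.add.inv_closed P.add.inv_equality P.minus_minus)
    then show ?thesis using bij x by (auto simp: bij_betw_def inj_on_def)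
  qed
  have Geq: "G (F x \<oplus>\<^bsub>P\<^esub> l) = x" if "x \<in> carrier N" "l \<in> L" for x l
  proof -
    have "F x \<oplus>\<^bsub>P\<^esub> l \<in> carrier P" using that F' LP by auto
    then show ?thesis unfolding G_def using that by (auto intro!: the_equality dest: uniq)
  qed
  have dec: "\<exists>x l. x \<in> carrier N \<and> l \<in> L \<and> y = F x \<oplus>\<^bsub>P\<^esub> l" if y: "y \<in> carrier P" for y
  proof -
    obtain k l where kl: "k \<in> K" "l \<in> L" "y = k \<oplus>\<^bsub>P\<^esub> l"
      using y unfolding KL(2)[symmetric] set_add_def' by blast
    then obtain x where "x \<in> carrier N" "k = F x" using bij by (auto simp: bij_betw_def)
    then show ?thesis using kl by blast
  qed
  have G: "G \<in> bihom R S P N"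
  proof (rule bihomI)
    show "G \<in> carrier P \<rightarrow>\<^sub>E carrier N"
    proof (rule PiE_I)
      show "G y \<in> carrier N" if y: "y \<in> carrier P" for y using dec[OF y] Geq by auto
    qed (simp add: G_def)
  next
    fix y y' assume y: "y \<in> carrier P" "y' \<in> carrier P"
    obtain x l where d: "x \<in> carrier N" "l \<in> L" "y = F x \<oplus>\<^bsub>P\<^esub> l"
      using dec[OF y(1)] by blast
    obtain x' l' where d': "x' \<in> carrier N" "l' \<in> L" "y' = F x' \<oplus>\<^bsub>P\<^esub> l'"
      using dec[OF y(2)] by blast
    have "l \<in> carrier P" "l' \<in> carrier P" using d d' LP by auto
    then have "y \<oplus>\<^bsub>P\<^esub> y' = F (x \<oplus>\<^bsub>N\<^esub> x') \<oplus>\<^bsub>P\<^esub> (l \<oplus>\<^bsub>P\<^esub> l')"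
      using d d' F'(2,3) by (simp add: P.a_ac)
    then show "G (y \<oplus>\<^bsub>P\<^esub> y') = G y \<oplus>\<^bsub>N\<^esub> G y'"
      using Geq[of "x \<oplus>\<^bsub>N\<^esub> x'" "l \<oplus>\<^bsub>P\<^esub> l'"] d d' Geq by simp
  next
    fix r y assume r: "r \<in> carrier R" and y: "y \<in> carrier P"
    obtain x l where d: "x \<in> carrier N" "l \<in> L" "y = F x \<oplus>\<^bsub>P\<^esub> l"
      using dec[OF y] by blast
    then have l: "l \<in> carrier P" using LP by auto
    have "r \<odot>\<^bsub>P\<^esub> y = F (r \<odot>\<^bsub>N\<^esub> x) \<oplus>\<^bsub>P\<^esub> r \<odot>\<^bsub>P\<^esub> l"
      using d(1,3) l F' r by (simp add: P.lact_add subset_iff)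
    then show "G (r \<odot>\<^bsub>P\<^esub> y) = r \<odot>\<^bsub>N\<^esub> G y"
      using Geq[of "r \<odot>\<^bsub>N\<^esub> x" "r \<odot>\<^bsub>P\<^esub> l"] d Geq r subL by (simp add: sub_bimodule_def)
  next
    fix y s assume r: "s \<in> carrier S" and y: "y \<in> carrier P"
    obtain x l where d: "x \<in> carrier N" "l \<in> L" "y = F x \<oplus>\<^bsub>P\<^esub> l"
      using dec[OF y] by blast
    then have l: "l \<in> carrier P" using LP by auto
    have "y \<odot>\<^sub>r\<^bsub>P\<^esub> s = F (x \<odot>\<^sub>r\<^bsub>N\<^esub> s) \<oplus>\<^bsub>P\<^esub> l \<odot>\<^sub>r\<^bsub>P\<^esub> s"
      using d(1,3) l F' r by (simp add: P.ract_add subset_iff)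
    then show "G (y \<odot>\<^sub>r\<^bsub>P\<^esub> s) = G y \<odot>\<^sub>r\<^bsub>N\<^esub> s"
      using Geq[of "x \<odot>\<^sub>r\<^bsub>N\<^esub> s" "l \<odot>\<^sub>r\<^bsub>P\<^esub> s"] d Geq r subL by (simp add: sub_bimodule_def)
  qed
  have "G (F x) = x" if "x \<in> carrier N" for x
    using Geq[OF that, of "\<zero>\<^bsub>P\<^esub>"] F' that L.zero_closed by simp
  with F G show ?thesis by (rule that)
qed

lemma biaction_power:
  assumes "biaction R S M"
  shows "biaction R S (bimodule_power M q)"
proof -
  interpret biaction R S M by fact
  have ag: "abelian_group (bimodule_power M q)"
  proof (rule abelian_groupI)
    fix x assume x: "x \<in> carrier (bimodule_power M q)"
    show "\<exists>y\<in>carrier (bimodule_power M q). y \<oplus>\<^bsub>bimodule_power M q\<^esub> x = \<zero>\<^bsub>bimodule_power M q\<^esub>"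
      by (rule bexI[of _ "\<lambda>i\<in>{..<q}. \<ominus>\<^bsub>M\<^esub> x i"])
        (use x in \<open>auto simp: bimodule_power_def l_neg PiE_iff fun_eq_iff\<close>)
  qed (auto simp: bimodule_power_def PiE_iff fun_eq_iff a_ac extensional_def)
  show ?thesis
    by (rule biaction.intro[OF ag], unfold_locales)
      (auto simp: bimodule_power_def PiE_iff fun_eq_iff lact_add ract_add)
qed

text \<open>The maps \<open>N \<rightarrow> N\<close> of the form \<open>\<Sum>\<^sub>i g\<^sub>i \<circ> f\<^sub>i\<close> with bimodule maps \<open>f\<^sub>i : N \<rightarrow> M\<close> and
  \<open>g\<^sub>i : M \<rightarrow> N\<close>.  The inductive form turns manipulations of such sums into rule inductions.\<close>

inductive_set factor_sums ::
    "('r, 'x) ring_scheme \<Rightarrow> ('s, 'y) ring_scheme \<Rightarrow>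
     ('r, 's, 'n) bimodule \<Rightarrow> ('r, 's, 'm) bimodule \<Rightarrow> ('n \<Rightarrow> 'n) set"
  for R S N M where
  zero: "(\<lambda>x\<in>carrier N. \<zero>\<^bsub>N\<^esub>) \<in> factor_sums R S N M"
| step: "h \<in> factor_sums R S N M \<Longrightarrow> f \<in> bihom R S N M \<Longrightarrow> g \<in> bihom R S M N \<Longrightarrow>
    (\<lambda>x\<in>carrier N. h x \<oplus>\<^bsub>N\<^esub> g (f x)) \<in> factor_sums R S N M"

definition summand_of_power ::
    "('r, 'x) ring_scheme \<Rightarrow> ('s, 'y) ring_scheme \<Rightarrow>
     ('r, 's, 'n) bimodule \<Rightarrow> ('r, 's, 'm) bimodule \<Rightarrow> bool" where
  "summand_of_power R S N M \<longleftrightarrow> (\<lambda>x\<in>carrier N. x) \<in> factor_sums R S N M"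

lemma factor_sums_extend_power:
  assumes "biaction R S N" "biaction R S M"
    and F: "F \<in> bihom R S N (bimodule_power M q)" and G: "G \<in> bihom R S (bimodule_power M q) N"
    and f: "f \<in> bihom R S N M" and g: "g \<in> bihom R S M N"
  obtains F' G' where "F' \<in> bihom R S N (bimodule_power M (Suc q))"
    "G' \<in> bihom R S (bimodule_power M (Suc q)) N"
    "\<And>x. x \<in> carrier N \<Longrightarrow> G' (F' x) = G (F x) \<oplus>\<^bsub>N\<^esub> g (f x)"
proof -
  interpret N: biaction R S N by fact
  interpret M: biaction R S M by fact
  interpret P: biaction R S "bimodule_power M q" by (rule biaction_power) fact
  interpret P': biaction R S "bimodule_power M (Suc q)" by (rule biaction_power) fact
  let ?P = "bimodule_power M q" and ?P' = "bimodule_power M (Suc q)"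
  define F' where "F' = (\<lambda>x\<in>carrier N. (F x)(q := f x))"
  define G' where "G' = (\<lambda>y\<in>carrier ?P'. G (restrict y {..<q}) \<oplus>\<^bsub>N\<^esub> g (y q))"
  have Fc: "F x \<in> {..<q} \<rightarrow>\<^sub>E carrier M" if "x \<in> carrier N" for x
    using bihomD(2)[OF F that] by (simp add: bimodule_power_def)
  have F'c: "F' x \<in> carrier ?P'" if "x \<in> carrier N" for x
    using Fc[OF that] bihomD(2)[OF f that] that
    by (auto simp: F'_def bimodule_power_def PiE_iff extensional_def)
  have rc: "restrict y {..<q} \<in> carrier ?P" and qc: "y q \<in> carrier M" if "y \<in> carrier ?P'" for y
    using that by (simp_all add: bimodule_power_def PiE_iff)
  have radd: "restrict (y \<oplus>\<^bsub>?P'\<^esub> z) {..<q} = restrict y {..<q} \<oplus>\<^bsub>?P\<^esub> restrict z {..<q}"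
    and rl: "restrict (r \<odot>\<^bsub>?P'\<^esub> y) {..<q} = r \<odot>\<^bsub>?P\<^esub> restrict y {..<q}"
    and rr: "restrict (y \<odot>\<^sub>r\<^bsub>?P'\<^esub> s) {..<q} = restrict y {..<q} \<odot>\<^sub>r\<^bsub>?P\<^esub> s"
    and qadd: "(y \<oplus>\<^bsub>?P'\<^esub> z) q = y q \<oplus>\<^bsub>M\<^esub> z q" "(r \<odot>\<^bsub>?P'\<^esub> y) q = r \<odot>\<^bsub>M\<^esub> y q"
      "(y \<odot>\<^sub>r\<^bsub>?P'\<^esub> s) q = y q \<odot>\<^sub>r\<^bsub>M\<^esub> s" for y z r s
    by (simp_all add: bimodule_power_def) (rule ext, simp)+
  note Gd = bihomD[OF G] and gd = bihomD[OF g] and Fd = bihomD[OF F] and fd = bihomD[OF f]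
  have F': "F' \<in> bihom R S N ?P'"
  proof (rule bihomI)
    show "F' \<in> carrier N \<rightarrow>\<^sub>E carrier ?P'" using F'c by (auto simp: F'_def)
  next
    fix x y assume "x \<in> carrier N" "y \<in> carrier N"
    then show "F' (x \<oplus>\<^bsub>N\<^esub> y) = F' x \<oplus>\<^bsub>?P'\<^esub> F' y"
      using Fd(3) fd(3) by (auto simp: F'_def bimodule_power_def fun_eq_iff)
  next
    fix r x assume "r \<in> carrier R" "x \<in> carrier N"
    then show "F' (r \<odot>\<^bsub>N\<^esub> x) = r \<odot>\<^bsub>?P'\<^esub> F' x"
      using Fd(4) fd(4) by (auto simp: F'_def bimodule_power_def fun_eq_iff)
  next
    fix x s assume "x \<in> carrier N" "s \<in> carrier S"
    then show "F' (x \<odot>\<^sub>r\<^bsub>N\<^esub> s) = F' x \<odot>\<^sub>r\<^bsub>?P'\<^esub> s"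
      using Fd(5) fd(5) by (auto simp: F'_def bimodule_power_def fun_eq_iff)
  qed
  have G': "G' \<in> bihom R S ?P' N"
  proof (rule bihomI)
    show "G' \<in> carrier ?P' \<rightarrow>\<^sub>E carrier N" using rc qc Gd(2) gd(2) by (auto simp: G'_def)
  next
    fix x y assume "x \<in> carrier ?P'" "y \<in> carrier ?P'"
    then show "G' (x \<oplus>\<^bsub>?P'\<^esub> y) = G' x \<oplus>\<^bsub>N\<^esub> G' y"
      by (simp add: G'_def radd qadd Gd gd rc qc N.a_ac)
  next
    fix r x assume "r \<in> carrier R" "x \<in> carrier ?P'"
    then show "G' (r \<odot>\<^bsub>?P'\<^esub> x) = r \<odot>\<^bsub>N\<^esub> G' x"
      by (simp add: G'_def rl qadd Gd gd rc qc N.lact_add)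
  next
    fix x s assume "x \<in> carrier ?P'" "s \<in> carrier S"
    then show "G' (x \<odot>\<^sub>r\<^bsub>?P'\<^esub> s) = G' x \<odot>\<^sub>r\<^bsub>N\<^esub> s"
      by (simp add: G'_def rr qadd Gd gd rc qc N.ract_add)
  qed
  have "G' (F' x) = G (F x) \<oplus>\<^bsub>N\<^esub> g (f x)" if "x \<in> carrier N" for x
  proof -
    have "restrict (F' x) {..<q} = F x" using Fc[OF that] that
      by (auto simp: F'_def fun_eq_iff PiE_iff extensional_def)
    then show ?thesis using that F'c by (simp add: G'_def) (simp add: F'_def)
  qed
  with F' G' show ?thesis by (rule that)
qed

text \<open>The base case takes \<open>q = 1\<close> and zero maps, because powers with \<open>q = 0\<close> are excluded.\<close>

lemma factor_sums_through_power:
  assumes "biaction R S N" "biaction R S M" "h \<in> factor_sums R S N M"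
  shows "\<exists>q>0. \<exists>F\<in>bihom R S N (bimodule_power M q). \<exists>G\<in>bihom R S (bimodule_power M q) N.
    \<forall>x\<in>carrier N. h x = G (F x)"
  using assms(3)
proof induction
  case zero
  interpret N: biaction R S N by fact
  have b: "biaction R S (bimodule_power M 1)" by (rule biaction_power) fact
  interpret P: biaction R S "bimodule_power M 1" by fact
  let ?F = "\<lambda>x\<in>carrier N. \<zero>\<^bsub>bimodule_power M 1\<^esub>" and ?G = "\<lambda>x\<in>carrier (bimodule_power M 1). \<zero>\<^bsub>N\<^esub>"
  show ?case
    by (intro exI[of _ 1] conjI bexI[of _ ?F] bexI[of _ ?G])
      (auto intro: zero_bihom assms b simp del: One_nat_def)
next
  case (step h f g)
  obtain q F G where q: "F \<in> bihom R S N (bimodule_power M q)"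
    "G \<in> bihom R S (bimodule_power M q) N" "\<forall>x\<in>carrier N. h x = G (F x)"
    using step.IH by blast
  show ?case
  proof (rule factor_sums_extend_power[OF assms(1,2) q(1,2) step.hyps(2,3)])
    fix F' G'
    assume F'G': "F' \<in> bihom R S N (bimodule_power M (Suc q))"
      "G' \<in> bihom R S (bimodule_power M (Suc q)) N"
      "\<And>x. x \<in> carrier N \<Longrightarrow> G' (F' x) = G (F x) \<oplus>\<^bsub>N\<^esub> g (f x)"
    then have "\<forall>x\<in>carrier N. (\<lambda>x\<in>carrier N. h x \<oplus>\<^bsub>N\<^esub> g (f x)) x = G' (F' x)"
      using q(3) by simp
    with F'G'(1,2) show ?thesis by blast
  qed
qed

text \<open>The identity of \<open>M\<^sup>q\<close> is the sum of the \<open>q\<close> projections followed by the inclusions.  The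
  induction adds these one at a time, so that the partial sums are the truncations of a tuple.\<close>

lemma power_retract_factor_sums:
  assumes "biaction R S N" "biaction R S M"
    and F: "F \<in> bihom R S N (bimodule_power M q)" and G: "G \<in> bihom R S (bimodule_power M q) N"
  shows "(\<lambda>x\<in>carrier N. G (F x)) \<in> factor_sums R S N M"
proof -
  interpret N: biaction R S N by fact
  interpret M: biaction R S M by fact
  interpret P: biaction R S "bimodule_power M q" by (rule biaction_power) fact
  let ?P = "bimodule_power M q"
  define trunc where "trunc = (\<lambda>j y. \<lambda>i\<in>{..<q}. if i < j then y i else \<zero>\<^bsub>M\<^esub>)"
  define single where "single = (\<lambda>j m. \<lambda>i\<in>{..<q}. if i = j then m else \<zero>\<^bsub>M\<^esub>)"
  note Gd = bihomD[OF G] and Fd = bihomD[OF F]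
  have Fi: "F x i \<in> carrier M" if "x \<in> carrier N" "i < q" for x i
    using Fd(2)[OF that(1)] that(2) by (auto simp: bimodule_power_def)
  have tc: "trunc j (F x) \<in> carrier ?P" if "x \<in> carrier N" for j x
    using Fi[OF that] by (auto simp: trunc_def bimodule_power_def)
  have sc: "single j m \<in> carrier ?P" if "m \<in> carrier M" for j m
    using that by (auto simp: single_def bimodule_power_def)
  have "j \<le> q \<Longrightarrow> (\<lambda>x\<in>carrier N. G (trunc j (F x))) \<in> factor_sums R S N M" for j
  proof (induction j)
    case 0
    have "trunc 0 (F x) = \<zero>\<^bsub>?P\<^esub>" for x by (auto simp: trunc_def bimodule_power_def)
    then have "(\<lambda>x\<in>carrier N. G (trunc 0 (F x))) = (\<lambda>x\<in>carrier N. \<zero>\<^bsub>N\<^esub>)"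
      using bihom_zero[OF G P.abelian_group_axioms N.abelian_group_axioms] by simp
    then show ?case by (metis factor_sums.zero)
  next
    case (Suc j)
    then have j: "j < q" by simp
    have f: "(\<lambda>x\<in>carrier N. F x j) \<in> bihom R S N M"
      by (rule bihomI) (use j Fd Fi in \<open>auto simp: bimodule_power_def\<close>)
    have g: "(\<lambda>m\<in>carrier M. G (single j m)) \<in> bihom R S M N"
    proof (rule bihomI)
      show "(\<lambda>m\<in>carrier M. G (single j m)) \<in> carrier M \<rightarrow>\<^sub>E carrier N" using Gd(2) sc by auto
    next
      fix x y assume xy: "x \<in> carrier M" "y \<in> carrier M"
      have "single j (x \<oplus>\<^bsub>M\<^esub> y) = single j x \<oplus>\<^bsub>?P\<^esub> single j y"
        by (auto simp: single_def bimodule_power_def fun_eq_iff)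
      then show "(\<lambda>m\<in>carrier M. G (single j m)) (x \<oplus>\<^bsub>M\<^esub> y)
        = (\<lambda>m\<in>carrier M. G (single j m)) x \<oplus>\<^bsub>N\<^esub> (\<lambda>m\<in>carrier M. G (single j m)) y"
        using Gd(3) sc xy by simp
    next
      fix r x assume xy: "r \<in> carrier R" "x \<in> carrier M"
      have "single j (r \<odot>\<^bsub>M\<^esub> x) = r \<odot>\<^bsub>?P\<^esub> single j x"
        using xy by (auto simp: single_def bimodule_power_def fun_eq_iff)
      then show "(\<lambda>m\<in>carrier M. G (single j m)) (r \<odot>\<^bsub>M\<^esub> x)
        = r \<odot>\<^bsub>N\<^esub> (\<lambda>m\<in>carrier M. G (single j m)) x"
        using Gd(4) sc xy by simp
    next
      fix s x assume xy: "x \<in> carrier M" "s \<in> carrier S"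
      have "single j (x \<odot>\<^sub>r\<^bsub>M\<^esub> s) = single j x \<odot>\<^sub>r\<^bsub>?P\<^esub> s"
        using xy by (auto simp: single_def bimodule_power_def fun_eq_iff)
      then show "(\<lambda>m\<in>carrier M. G (single j m)) (x \<odot>\<^sub>r\<^bsub>M\<^esub> s)
        = (\<lambda>m\<in>carrier M. G (single j m)) x \<odot>\<^sub>r\<^bsub>N\<^esub> s"
        using Gd(5) sc xy by simp
    qed
    have "trunc (Suc j) (F x) = trunc j (F x) \<oplus>\<^bsub>?P\<^esub> single j (F x j)" if "x \<in> carrier N" for x
      using Fi[OF that] j by (auto simp: trunc_def single_def bimodule_power_def fun_eq_iff less_Suc_eq)
    then have "G (trunc (Suc j) (F x)) = G (trunc j (F x)) \<oplus>\<^bsub>N\<^esub> G (single j (F x j))"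
      if "x \<in> carrier N" for x
      using Gd(3)[OF tc[OF that, of j] sc[OF Fi[OF that j], of j]] that by simp
    then have "(\<lambda>x\<in>carrier N. G (trunc (Suc j) (F x))) =
      (\<lambda>x\<in>carrier N. (\<lambda>x\<in>carrier N. G (trunc j (F x))) x \<oplus>\<^bsub>N\<^esub>
         (\<lambda>m\<in>carrier M. G (single j m)) ((\<lambda>x\<in>carrier N. F x j) x))"
      using Fi j by (auto simp: fun_eq_iff)
    then show ?case using factor_sums.step[OF Suc.IH[OF less_imp_le[OF j]] f g] by (simp only:)
  qed
  from this[of q] have *: "(\<lambda>x\<in>carrier N. G (trunc q (F x))) \<in> factor_sums R S N M" by simp
  have "trunc q (F x) = F x" if "x \<in> carrier N" for x
    using Fd(2)[OF that] by (auto simp: trunc_def bimodule_power_def fun_eq_iff PiE_iff extensional_def)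
  then have "(\<lambda>x\<in>carrier N. G (trunc q (F x))) = (\<lambda>x\<in>carrier N. G (F x))"
    by (auto intro!: restrict_ext)
  with * show ?thesis by simp
qed

lemma iso_to_direct_summand_imp_summand_of_power:
  assumes "biaction R S N" "biaction R S M" "iso_to_direct_summand R S N (bimodule_power M q)"
  shows "summand_of_power R S N M"
proof -
  obtain F G where *: "F \<in> bihom R S N (bimodule_power M q)" "G \<in> bihom R S (bimodule_power M q) N"
    "\<And>x. x \<in> carrier N \<Longrightarrow> G (F x) = x"
    using summand_imp_retract[OF assms(1) biaction_power[OF assms(2)] assms(3)] by metis
  have "(\<lambda>x\<in>carrier N. G (F x)) = (\<lambda>x\<in>carrier N. x)" using *(3) by auto
  then show ?thesis
    using power_retract_factor_sums[OF assms(1,2) *(1,2)] by (simp add: summand_of_power_def)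
qed

lemma summand_of_power_iff:
  assumes "biaction R S N" "biaction R S M"
  shows "(\<exists>q>0. iso_to_direct_summand R S N (bimodule_power M q)) \<longleftrightarrow> summand_of_power R S N M"
proof
  assume s: "summand_of_power R S N M"
  obtain q F G where q: "q > 0" "F \<in> bihom R S N (bimodule_power M q)"
    "G \<in> bihom R S (bimodule_power M q) N" "\<forall>x\<in>carrier N. (\<lambda>x\<in>carrier N. x) x = G (F x)"
    using factor_sums_through_power[OF assms s[unfolded summand_of_power_def]]
    by (elim exE conjE bexE) (rule that)
  then have "iso_to_direct_summand R S N (bimodule_power M q)"
    using retract_imp_summand[OF assms(1) biaction_power[OF assms(2)] q(2,3)] by simp
  with q(1) show "\<exists>q>0. iso_to_direct_summand R S N (bimodule_power M q)" by blast
qed (use iso_to_direct_summand_imp_summand_of_power[OF assms] in blast)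

lemma H_equivalent_iff:
  assumes "biaction R S N" "biaction R S M"
  shows "H_equivalent R S M N \<longleftrightarrow> summand_of_power R S N M \<and> summand_of_power R S M N"
  unfolding H_equivalent_def using assms by (simp add: summand_of_power_iff)

lemma factor_sums_closed:
  assumes "biaction R S N" "h \<in> factor_sums R S N M" "x \<in> carrier N"
  shows "h x \<in> carrier N"
proof -
  interpret biaction R S N by fact
  show ?thesis using assms(2)
  proof induction
    case (step h f g)
    show ?case using step.IH bihomD(2)[OF step.hyps(3) bihomD(2)[OF step.hyps(2) assms(3)]] assms(3)
      by simp
  qed (simp add: assms(3))
qed

lemma factor_sums_extensional:
  "h \<in> factor_sums R S N M \<Longrightarrow> h \<in> extensional (carrier N)"
  by (cases rule: factor_sums.cases) auto

lemma factor_sums_bihom: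
  assumes "biaction R S N" "biaction R S M" "h \<in> factor_sums R S N M"
  shows "h \<in> bihom R S N N"
proof -
  obtain q F G where q: "F \<in> bihom R S N (bimodule_power M q)"
    "G \<in> bihom R S (bimodule_power M q) N" "\<forall>x\<in>carrier N. h x = G (F x)"
    using factor_sums_through_power[OF assms] by blast
  have "h = compose (carrier N) G F"
    using q(3) factor_sums_extensional[OF assms(3)] by (auto simp: compose_def extensional_def)
  then show ?thesis using bihom_compose[OF q(1,2) assms(1)] by simp
qed

lemma factor_sums_add:
  assumes "biaction R S N" "h \<in> factor_sums R S N M" "k \<in> factor_sums R S N M"
  shows "(\<lambda>x\<in>carrier N. h x \<oplus>\<^bsub>N\<^esub> k x) \<in> factor_sums R S N M"
proof -
  interpret biaction R S N by fact
  note hc = factor_sums_closed[OF assms(1,2)]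
  have hx: "h \<in> extensional (carrier N)" by (rule factor_sums_extensional) fact
  show ?thesis using assms(3)
  proof induction
    case zero
    have "(\<lambda>x\<in>carrier N. h x \<oplus>\<^bsub>N\<^esub> (\<lambda>x\<in>carrier N. \<zero>\<^bsub>N\<^esub>) x) = h"
      using hc hx by (auto simp: fun_eq_iff extensional_def)
    then show ?case using assms(2) by simp
  next
    case (step k f g)
    have "(\<lambda>x\<in>carrier N. h x \<oplus>\<^bsub>N\<^esub> (\<lambda>x\<in>carrier N. k x \<oplus>\<^bsub>N\<^esub> g (f x)) x) =
      (\<lambda>x\<in>carrier N. (\<lambda>x\<in>carrier N. h x \<oplus>\<^bsub>N\<^esub> k x) x \<oplus>\<^bsub>N\<^esub> g (f x))"
      using hc factor_sums_closed[OF assms(1) step.hyps(1)] bihomD(2)[OF step.hyps(2)]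
        bihomD(2)[OF step.hyps(3)] by (auto simp: fun_eq_iff a_assoc)
    then show ?case using factor_sums.step[OF step.IH step.hyps(2,3)] by (simp only:)
  qed
qed

lemma factor_sums_single:
  assumes "biaction R S N" "f \<in> bihom R S N M" "g \<in> bihom R S M N"
  shows "(\<lambda>x\<in>carrier N. g (f x)) \<in> factor_sums R S N M"
proof -
  interpret biaction R S N by fact
  have "(\<lambda>x\<in>carrier N. (\<lambda>x\<in>carrier N. \<zero>\<^bsub>N\<^esub>) x \<oplus>\<^bsub>N\<^esub> g (f x)) = (\<lambda>x\<in>carrier N. g (f x))"
    using bihomD(2)[OF assms(2)] bihomD(2)[OF assms(3)] by (auto simp: fun_eq_iff)
  then show ?thesis using factor_sums.step[OF factor_sums.zero assms(2,3)] by simp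
qed

lemma summand_of_powerI_retract:
  assumes "biaction R S N" "f \<in> bihom R S N M" "g \<in> bihom R S M N"
    and "\<And>x. x \<in> carrier N \<Longrightarrow> g (f x) = x"
  shows "summand_of_power R S N M"
proof -
  have "(\<lambda>x\<in>carrier N. g (f x)) = (\<lambda>x\<in>carrier N. x)" using assms(4) by (auto simp: fun_eq_iff)
  then show ?thesis using factor_sums_single[OF assms(1-3)] by (simp add: summand_of_power_def)
qed

text \<open>Replacing \<open>g \<circ> f\<close> by \<open>g \<circ> id\<^sub>M \<circ> f\<close> and expanding \<open>id\<^sub>M\<close> as a sum through \<open>P\<close>.\<close>

lemma summand_of_power_trans:
  assumes "biaction R S N" "biaction R S M" "biaction R S P"
    and NM: "summand_of_power R S N M" and MP: "summand_of_power R S M P"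
  shows "summand_of_power R S N P"
proof -
  interpret N: biaction R S N by fact
  interpret M: biaction R S M by fact
  have sandwich: "(\<lambda>x\<in>carrier N. g (k (f x))) \<in> factor_sums R S N P"
    if k: "k \<in> factor_sums R S M P" and f: "f \<in> bihom R S N M" and g: "g \<in> bihom R S M N" for k f g
    using k
  proof induction
    case zero
    have "(\<lambda>x\<in>carrier N. g ((\<lambda>x\<in>carrier M. \<zero>\<^bsub>M\<^esub>) (f x))) = (\<lambda>x\<in>carrier N. \<zero>\<^bsub>N\<^esub>)"
      using bihomD(2)[OF f] bihom_zero[OF g M.abelian_group_axioms N.abelian_group_axioms]
      by (auto simp: fun_eq_iff)
    then show ?case by (metis factor_sums.zero)
  next
    case (step k u v)
    have "(\<lambda>x\<in>carrier N. g ((\<lambda>x\<in>carrier M. k x \<oplus>\<^bsub>M\<^esub> v (u x)) (f x))) =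
      (\<lambda>x\<in>carrier N. (\<lambda>x\<in>carrier N. g (k (f x))) x \<oplus>\<^bsub>N\<^esub>
        compose (carrier P) g v (compose (carrier N) u f x))"
      using bihomD(2)[OF f] bihomD[OF g] factor_sums_closed[OF assms(2) step.hyps(1)]
        bihomD(2)[OF step.hyps(2)] bihomD(2)[OF step.hyps(3)]
      by (auto simp: fun_eq_iff compose_def)
    then show ?case
      using factor_sums.step[OF step.IH bihom_compose[OF f step.hyps(2) assms(1)]
          bihom_compose[OF step.hyps(3) g assms(3)]] by (simp only:)
  qed
  have "h \<in> factor_sums R S N P" if "h \<in> factor_sums R S N M" for h
    using that
  proof induction
    case zero
    show ?case by (rule factor_sums.zero)
  next
    case (step h f g)
    have s: "(\<lambda>x\<in>carrier N. g ((\<lambda>x\<in>carrier M. x) (f x))) \<in> factor_sums R S N P"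
      using sandwich[OF MP[unfolded summand_of_power_def] step.hyps(2,3)] .
    have e: "(\<lambda>x\<in>carrier N. h x \<oplus>\<^bsub>N\<^esub> (\<lambda>x\<in>carrier N. g ((\<lambda>x\<in>carrier M. x) (f x))) x) =
      (\<lambda>x\<in>carrier N. h x \<oplus>\<^bsub>N\<^esub> g (f x))"
      using bihomD(2)[OF step.hyps(2)] by (auto simp: fun_eq_iff)
    show ?case using factor_sums_add[OF assms(1) step.IH s] unfolding e .
  qed
  with NM show ?thesis by (simp add: summand_of_power_def)
qed


section \<open>Bimodules and tensor powers\<close>

locale ring_bimodule = R: ring R + S: ring S + biaction R S M
  for R :: "('r, 'x) ring_scheme" and S :: "('s, 'y) ring_scheme"
    and M :: "('r, 's, 'm) bimodule" +
  assumes add_lact: "r \<in> carrier R \<Longrightarrow> r' \<in> carrier R \<Longrightarrow> x \<in> carrier M \<Longrightarrow>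
      (r \<oplus>\<^bsub>R\<^esub> r') \<odot>\<^bsub>M\<^esub> x = r \<odot>\<^bsub>M\<^esub> x \<oplus>\<^bsub>M\<^esub> r' \<odot>\<^bsub>M\<^esub> x"
    and add_ract: "s \<in> carrier S \<Longrightarrow> s' \<in> carrier S \<Longrightarrow> x \<in> carrier M \<Longrightarrow>
      x \<odot>\<^sub>r\<^bsub>M\<^esub> (s \<oplus>\<^bsub>S\<^esub> s') = x \<odot>\<^sub>r\<^bsub>M\<^esub> s \<oplus>\<^bsub>M\<^esub> x \<odot>\<^sub>r\<^bsub>M\<^esub> s'"
    and mult_lact: "r \<in> carrier R \<Longrightarrow> r' \<in> carrier R \<Longrightarrow> x \<in> carrier M \<Longrightarrow>
      (r \<otimes>\<^bsub>R\<^esub> r') \<odot>\<^bsub>M\<^esub> x = r \<odot>\<^bsub>M\<^esub> (r' \<odot>\<^bsub>M\<^esub> x)"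
    and mult_ract: "s \<in> carrier S \<Longrightarrow> s' \<in> carrier S \<Longrightarrow> x \<in> carrier M \<Longrightarrow>
      x \<odot>\<^sub>r\<^bsub>M\<^esub> (s \<otimes>\<^bsub>S\<^esub> s') = (x \<odot>\<^sub>r\<^bsub>M\<^esub> s) \<odot>\<^sub>r\<^bsub>M\<^esub> s'"
    and one_lact: "x \<in> carrier M \<Longrightarrow> \<one>\<^bsub>R\<^esub> \<odot>\<^bsub>M\<^esub> x = x"
    and one_ract: "x \<in> carrier M \<Longrightarrow> x \<odot>\<^sub>r\<^bsub>M\<^esub> \<one>\<^bsub>S\<^esub> = x"
    and lact_ract: "r \<in> carrier R \<Longrightarrow> s \<in> carrier S \<Longrightarrow> x \<in> carrier M \<Longrightarrow>
      (r \<odot>\<^bsub>M\<^esub> x) \<odot>\<^sub>r\<^bsub>M\<^esub> s = r \<odot>\<^bsub>M\<^esub> (x \<odot>\<^sub>r\<^bsub>M\<^esub> s)"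

lemma (in ring) regular_ring_bimodule:
  assumes "subring B R" "subring C R"
  shows "ring_bimodule (R\<lparr>carrier := B\<rparr>) (R\<lparr>carrier := C\<rparr>) (regular_bimodule R)"
proof -
  interpret B: ring "R\<lparr>carrier := B\<rparr>" by (rule subring_is_ring) fact
  interpret C: ring "R\<lparr>carrier := C\<rparr>" by (rule subring_is_ring) fact
  have BC: "B \<subseteq> carrier R" "C \<subseteq> carrier R" using assms by (auto dest: subringE(1))
  have "abelian_group (regular_bimodule R)"
  proof (rule abelian_groupI)
    fix x assume x: "x \<in> carrier (regular_bimodule R)"
    show "\<exists>y\<in>carrier (regular_bimodule R). y \<oplus>\<^bsub>regular_bimodule R\<^esub> x = \<zero>\<^bsub>regular_bimodule R\<^esub>"
      by (rule bexI[of _ "\<ominus>\<^bsub>R\<^esub> x"]) (use x in \<open>auto simp: regular_bimodule_def l_neg\<close>)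
  qed (auto simp: regular_bimodule_def a_ac)
  then interpret M: abelian_group "regular_bimodule R" .
  show ?thesis
    by unfold_locales (use BC in \<open>auto simp: regular_bimodule_def l_distr r_distr m_assoc subset_iff\<close>)
qed

lemma restrict_scalars_bimodule:
  assumes "ring_bimodule R S M" "ring P" "ring Q" "f \<in> ring_hom P R" "g \<in> ring_hom Q S"
  shows "ring_bimodule P Q (restrict_scalars f g M)"
proof -
  interpret ring_bimodule R S M by fact
  interpret P: ring P by fact
  interpret Q: ring Q by fact
  have ag: "abelian_group (restrict_scalars f g M)"
  proof (rule abelian_groupI)
    fix x assume x: "x \<in> carrier (restrict_scalars f g M)"
    show "\<exists>y\<in>carrier (restrict_scalars f g M). y \<oplus>\<^bsub>restrict_scalars f g M\<^esub> x = \<zero>\<^bsub>restrict_scalars f g M\<^esub>"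
      by (rule bexI[of _ "\<ominus>\<^bsub>M\<^esub> x"]) (use x in \<open>auto simp: restrict_scalars_def l_neg\<close>)
  qed (auto simp: restrict_scalars_def a_ac)
  then interpret N: abelian_group "restrict_scalars f g M" .
  note f = ring_hom_closed[OF assms(4)] ring_hom_add[OF assms(4)] ring_hom_mult[OF assms(4)]
    ring_hom_one[OF assms(4)]
  note g = ring_hom_closed[OF assms(5)] ring_hom_add[OF assms(5)] ring_hom_mult[OF assms(5)]
    ring_hom_one[OF assms(5)]
  show ?thesis
    by unfold_locales (simp_all add: restrict_scalars_def f g lact_add ract_add add_lact add_ract
        mult_lact mult_ract one_lact one_ract lact_ract)
qed

lemma restrict_scalars_id [simp]: "restrict_scalars id id M = M"
  by (simp add: restrict_scalars_def)

lemma restrict_scalars_sel [simp]: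
  "carrier (restrict_scalars f g M) = carrier M"
  "\<zero>\<^bsub>restrict_scalars f g M\<^esub> = \<zero>\<^bsub>M\<^esub>"
  "x \<oplus>\<^bsub>restrict_scalars f g M\<^esub> y = x \<oplus>\<^bsub>M\<^esub> y"
  "p \<odot>\<^bsub>restrict_scalars f g M\<^esub> x = f p \<odot>\<^bsub>M\<^esub> x"
  "x \<odot>\<^sub>r\<^bsub>restrict_scalars f g M\<^esub> q = x \<odot>\<^sub>r\<^bsub>M\<^esub> g q"
  by (simp_all add: restrict_scalars_def)

lemma keys_diffI:
  "Poly_Mapping.keys a \<subseteq> Y \<Longrightarrow> Poly_Mapping.keys b \<subseteq> Y \<Longrightarrow> Poly_Mapping.keys (a - b) \<subseteq> Y"
  using keys_diff[of a b] by blast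

locale ring_extension = R: ring R + S: ring S
  for R :: "('a, 'x) ring_scheme" (structure) and S :: "('s, 'y) ring_scheme" and h :: "'s \<Rightarrow> 'a" +
  assumes h_hom: "h \<in> ring_hom S R"
begin

lemma h_closed [simp]: "s \<in> carrier S \<Longrightarrow> h s \<in> carrier R"
  using h_hom by (rule ring_hom_closed)

abbreviation F where "F m \<equiv> free_Abelian_group (tuples R m)"
abbreviation K where "K m \<equiv> tensor_kernel R S h m"
abbreviation T where "T m \<equiv> tensor_power R S h m"

lemma tuples_Cons [simp]: "x # xs \<in> tuples R (Suc m) \<longleftrightarrow> x \<in> carrier R \<and> xs \<in> tuples R m"
  by (auto simp: tuples_def)

lemma tuples_middle:
  "us @ x # vs \<in> tuples R m \<longleftrightarrow>
    length us + Suc (length vs) = m \<and> set us \<subseteq> carrier R \<and> x \<in> carrier R \<and> set vs \<subseteq> carrier R"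
  by (auto simp: tuples_def)

lemma relations_subset: "tensor_relations R S h m \<subseteq> carrier (F m)"
proof
  fix c assume "c \<in> tensor_relations R S h m"
  then show "c \<in> carrier (F m)"
    unfolding tensor_relations_def
    by (elim UnE CollectE exE conjE; simp only: carrier_free_Abelian_group_iff;
        intro keys_diffI; simp add: keys_frag_of tuples_middle)
qed

lemma kernel_subgroup: "subgroup (K m) (F m)"
  unfolding tensor_kernel_def
  by (rule group.generate_is_subgroup[OF group_free_Abelian_group relations_subset])

lemma kernel_normal: "K m \<lhd> F m"
  using kernel_subgroup abelian_free_Abelian_group comm_group.normal_iff_subgroup by blast

lemma kernel_in_carrier: "k \<in> K m \<Longrightarrow> k \<in> carrier (F m)"
  using kernel_subgroup subgroup.mem_carrier by metis

lemma kernel_zero: "0 \<in> K m"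
  using subgroup.one_closed[OF kernel_subgroup] by simp

lemma kernel_add: "a \<in> K m \<Longrightarrow> b \<in> K m \<Longrightarrow> a + b \<in> K m"
  using subgroup.m_closed[OF kernel_subgroup, of a m b] by simp

lemma kernel_minus: "a \<in> K m \<Longrightarrow> - a \<in> K m"
  using subgroup.m_inv_closed[OF kernel_subgroup, of a m] kernel_in_carrier[of a m] by simp

definition cls :: "nat \<Rightarrow> ('a list \<Rightarrow>\<^sub>0 int) \<Rightarrow> ('a list \<Rightarrow>\<^sub>0 int) set" where
  "cls m c = K m #>\<^bsub>F m\<^esub> c"

lemma cls_eq: "cls m c = {k + c | k. k \<in> K m}"
  by (auto simp: cls_def r_coset_def)

lemma cls_eqI: "a - b \<in> K m \<Longrightarrow> cls m a = cls m b"
proof -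
  assume ab: "a - b \<in> K m"
  have "\<exists>k'. k + a = k' + b \<and> k' \<in> K m" if "k \<in> K m" for k
    by (rule exI[of _ "k + (a - b)"]) (use that ab kernel_add in auto)
  moreover have "\<exists>k'. k + b = k' + a \<and> k' \<in> K m" if "k \<in> K m" for k
    by (rule exI[of _ "k + - (a - b)"]) (use that kernel_add kernel_minus[OF ab] in auto)
  ultimately show "cls m a = cls m b" unfolding cls_eq by blast
qed

lemma T_sel:
  "carrier (T m) = cls m ` carrier (F m)"
  "\<zero>\<^bsub>T m\<^esub> = K m"
  "ring.add (T m) = set_mult (F m)"
  by (auto simp: tensor_power_def Let_def carrier_FactGroup cls_def)

lemma cls_zero: "cls m 0 = \<zero>\<^bsub>T m\<^esub>"
  by (simp add: T_sel cls_eq)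

lemma cls_add:
  assumes "a \<in> carrier (F m)" "b \<in> carrier (F m)"
  shows "cls m a \<oplus>\<^bsub>T m\<^esub> cls m b = cls m (a + b)"
  using normal.rcos_sum[OF kernel_normal assms] by (simp add: T_sel cls_def)

lemma T_abelian_group: "abelian_group (T m)"
proof -
  interpret Q: comm_group "F m Mod K m"
    by (rule comm_group.abelian_FactGroup[OF abelian_free_Abelian_group kernel_subgroup])
  have sel: "carrier (T m) = carrier (F m Mod K m)" "\<zero>\<^bsub>T m\<^esub> = \<one>\<^bsub>F m Mod K m\<^esub>"
    "ring.add (T m) = monoid.mult (F m Mod K m)"
    by (simp_all add: tensor_power_def Let_def)
  show ?thesis
    by (rule abelian_groupI) (auto simp: sel Q.m_ac simp del: one_FactGroup mult_FactGroup)
qed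

definition elt :: "'a list \<Rightarrow> ('a list \<Rightarrow>\<^sub>0 int) set" where
  "elt xs = cls (length xs) (frag_of xs)"

lemma elt_cls: "xs \<in> tuples R m \<Longrightarrow> elt xs = cls m (frag_of xs)"
  by (auto simp: elt_def tuples_def)

lemma elt_closed: "xs \<in> tuples R m \<Longrightarrow> elt xs \<in> carrier (T m)"
  by (auto simp: elt_cls T_sel simp del: carrier_free_Abelian_group_iff)

lemma elt_add:
  assumes "us @ x # vs \<in> tuples R m" "us @ y # vs \<in> tuples R m"
  shows "elt (us @ (x \<oplus> y) # vs) = elt (us @ x # vs) \<oplus>\<^bsub>T m\<^esub> elt (us @ y # vs)"
proof -
  have t: "us @ (x \<oplus> y) # vs \<in> tuples R m" using assms by (auto simp: tuples_middle)
  have "frag_of (us @ (x \<oplus> y) # vs) - frag_of (us @ x # vs) - frag_of (us @ y # vs)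
    \<in> tensor_relations R S h m"
    using assms unfolding tensor_relations_def by blast
  then have "frag_of (us @ (x \<oplus> y) # vs) - (frag_of (us @ x # vs) + frag_of (us @ y # vs)) \<in> K m"
    unfolding tensor_kernel_def by (auto intro: generate.incl simp: algebra_simps)
  from cls_eqI[OF this] show ?thesis
    using t assms by (simp add: elt_cls cls_add keys_frag_of)
qed

lemma elt_balanced:
  assumes "us @ x # y # vs \<in> tuples R m" "s \<in> carrier S"
  shows "elt (us @ (x \<otimes> h s) # y # vs) = elt (us @ x # (h s \<otimes> y) # vs)"
proof -
  have t: "us @ (x \<otimes> h s) # y # vs \<in> tuples R m" "us @ x # (h s \<otimes> y) # vs \<in> tuples R m"
    using assms by (auto simp: tuples_middle)
  have "frag_of (us @ (x \<otimes> h s) # y # vs) - frag_of (us @ x # (h s \<otimes> y) # vs)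
    \<in> tensor_relations R S h m"
    using assms unfolding tensor_relations_def by blast
  then have "frag_of (us @ (x \<otimes> h s) # y # vs) - frag_of (us @ x # (h s \<otimes> y) # vs) \<in> K m"
    unfolding tensor_kernel_def by (rule generate.incl)
  from cls_eqI[OF this] show ?thesis using t by (simp add: elt_cls)
qed

lemma elt_add_first:
  assumes "x \<in> carrier R" "y \<in> carrier R" "xs \<in> tuples R m"
  shows "elt ((x \<oplus> y) # xs) = elt (x # xs) \<oplus>\<^bsub>T (Suc m)\<^esub> elt (y # xs)"
  using elt_add[of "[]" x xs "Suc m" y] assms by simp

lemma elt_zero_first:
  assumes "xs \<in> tuples R m" shows "elt (\<zero> # xs) = \<zero>\<^bsub>T (Suc m)\<^esub>"
  by (rule additive_zero[OF R.abelian_group_axioms T_abelian_group, of "\<lambda>x. elt (x # xs)"])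
    (use assms in \<open>auto simp: elt_add_first intro: elt_closed\<close>)

lemma elt_neg_first:
  assumes "x \<in> carrier R" "xs \<in> tuples R m"
  shows "elt (\<ominus> x # xs) = \<ominus>\<^bsub>T (Suc m)\<^esub> elt (x # xs)"
  by (rule additive_neg[OF R.abelian_group_axioms T_abelian_group, of "\<lambda>x. elt (x # xs)"])
    (use assms in \<open>auto simp: elt_add_first intro: elt_closed\<close>)

lemma cls_neg:
  assumes "a \<in> carrier (F m)" shows "cls m (- a) = \<ominus>\<^bsub>T m\<^esub> cls m a"
proof -
  interpret abelian_group "T m" by (rule T_abelian_group)
  have "cls m (- a) \<oplus>\<^bsub>T m\<^esub> cls m a = \<zero>\<^bsub>T m\<^esub>"
    using assms by (simp add: cls_add cls_zero)
  moreover have "cls m (- a) \<in> carrier (T m)" "cls m a \<in> carrier (T m)"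
    using assms by (auto simp: T_sel)
  ultimately show ?thesis using minus_equality by metis
qed

text \<open>Closure under addition suffices, because a minus sign can be absorbed into the first entry
  of an elementary tensor.  This is where at least one factor must be present.\<close>

lemma tensor_induct [consumes 1, case_names elt add]:
  assumes C: "C \<in> carrier (T (Suc m))"
    and elt: "\<And>xs. xs \<in> tuples R (Suc m) \<Longrightarrow> P (elt xs)"
    and add: "\<And>C D. C \<in> carrier (T (Suc m)) \<Longrightarrow> D \<in> carrier (T (Suc m)) \<Longrightarrow> P C \<Longrightarrow> P D \<Longrightarrow>
      P (C \<oplus>\<^bsub>T (Suc m)\<^esub> D)"
  shows "P C"
proof -
  let ?m = "Suc m"
  have neg: "P (cls ?m (- frag_of xs))" if xs: "xs \<in> tuples R ?m" for xs
  proof -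
    obtain x ys where x: "xs = x # ys" using xs by (cases xs) (auto simp: tuples_def)
    have "cls ?m (- frag_of xs) = \<ominus>\<^bsub>T ?m\<^esub> elt xs"
      using xs by (simp add: cls_neg keys_frag_of elt_cls)
    also have "\<dots> = elt ((\<ominus> x) # ys)" using x xs elt_neg_first[of x ys m] by simp
    finally have "cls ?m (- frag_of xs) = elt ((\<ominus> x) # ys)" .
    then show ?thesis using elt[of "(\<ominus> x) # ys"] xs x by simp
  qed
  obtain c where c: "Poly_Mapping.keys c \<subseteq> tuples R ?m" "C = cls ?m c"
    using C by (auto simp: T_sel)
  have "P (cls ?m c) \<and> P (cls ?m (- c))"
  proof (rule free_Abelian_group_induct[OF c(1)])
    have "P (elt (\<zero> # replicate m \<zero>))" by (rule elt) (auto simp: tuples_def)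
    moreover have "replicate m \<zero> \<in> tuples R m" by (auto simp: tuples_def)
    ultimately have "P \<zero>\<^bsub>T ?m\<^esub>" using elt_zero_first by metis
    then show "P (cls ?m 0) \<and> P (cls ?m (- 0))" by (simp add: cls_zero)
  next
    fix a b assume ab: "Poly_Mapping.keys a \<subseteq> tuples R ?m" "Poly_Mapping.keys b \<subseteq> tuples R ?m"
      "P (cls ?m a) \<and> P (cls ?m (- a))" "P (cls ?m b) \<and> P (cls ?m (- b))"
    have cl: "cls ?m u \<in> carrier (T ?m)" if "Poly_Mapping.keys u \<subseteq> tuples R ?m" for u
      using that by (auto simp: T_sel)
    have "cls ?m (a - b) = cls ?m a \<oplus>\<^bsub>T ?m\<^esub> cls ?m (- b)"
      "cls ?m (- (a - b)) = cls ?m (- a) \<oplus>\<^bsub>T ?m\<^esub> cls ?m b"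
      using ab by (simp_all add: cls_add)
    then show "P (cls ?m (a - b)) \<and> P (cls ?m (- (a - b)))"
      using ab add cl by (metis keys_minus)
  next
    fix xs assume "xs \<in> tuples R ?m"
    then show "P (cls ?m (frag_of xs)) \<and> P (cls ?m (- frag_of xs))"
      using elt neg by (auto simp: elt_cls)
  qed
  then show ?thesis using c(2) by simp
qed

lemma tensor_lift:
  assumes G: "abelian_group G"
    and closed: "\<And>xs. xs \<in> tuples R m \<Longrightarrow> \<phi> xs \<in> carrier G"
    and add: "\<And>us x y vs. us @ x # vs \<in> tuples R m \<Longrightarrow> us @ y # vs \<in> tuples R m \<Longrightarrow>
      \<phi> (us @ (x \<oplus> y) # vs) = \<phi> (us @ x # vs) \<oplus>\<^bsub>G\<^esub> \<phi> (us @ y # vs)"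
    and bal: "\<And>us x s y vs. us @ x # y # vs \<in> tuples R m \<Longrightarrow> s \<in> carrier S \<Longrightarrow>
      \<phi> (us @ (x \<otimes> h s) # y # vs) = \<phi> (us @ x # (h s \<otimes> y) # vs)"
  obtains f where "\<And>C. C \<in> carrier (T m) \<Longrightarrow> f C \<in> carrier G"
    "\<And>C D. C \<in> carrier (T m) \<Longrightarrow> D \<in> carrier (T m) \<Longrightarrow> f (C \<oplus>\<^bsub>T m\<^esub> D) = f C \<oplus>\<^bsub>G\<^esub> f D"
    "\<And>xs. xs \<in> tuples R m \<Longrightarrow> f (elt xs) = \<phi> xs"
proof -
  interpret G: abelian_group G by fact
  obtain p where p: "p \<in> hom (F m) (add_monoid G)" "\<And>xs. xs \<in> tuples R m \<Longrightarrow> p (frag_of xs) = \<phi> xs"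
    using G.a_comm_group comm_group.free_Abelian_group_universal[of "add_monoid G" \<phi> "tuples R m"] closed
    by (metis image_subsetI partial_object.select_convs(1))
  interpret p: group_hom "F m" "add_monoid G" p
    using p(1) by (simp add: group_hom_def group_hom_axioms_def G.a_group)
  have pc: "p c \<in> carrier G" if "Poly_Mapping.keys c \<subseteq> tuples R m" for c
    using p.hom_closed[of c] that by simp
  have padd: "p (c + d) = p c \<oplus>\<^bsub>G\<^esub> p d" if "Poly_Mapping.keys c \<subseteq> tuples R m"
    "Poly_Mapping.keys d \<subseteq> tuples R m" for c d
    using p.hom_mult[of c d] that by simp
  have pdiff: "p (c - d) = p c \<ominus>\<^bsub>G\<^esub> p d" if "Poly_Mapping.keys c \<subseteq> tuples R m"
    "Poly_Mapping.keys d \<subseteq> tuples R m" for c d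
  proof -
    have "p (- d) = \<ominus>\<^bsub>G\<^esub> p d" using p.hom_inv[of d] that by (simp add: a_inv_def)
    then show ?thesis using padd[of c "- d"] that by (simp add: a_minus_def)
  qed
  have "p c = \<zero>\<^bsub>G\<^esub>" if "c \<in> tensor_relations R S h m" for c
    using that unfolding tensor_relations_def
  proof (elim UnE CollectE exE conjE)
    fix us x y vs
    assume *: "us @ x # vs \<in> tuples R m" "us @ y # vs \<in> tuples R m"
      and c: "c = frag_of (us @ (x \<oplus> y) # vs) - frag_of (us @ x # vs) - frag_of (us @ y # vs)"
    have t: "us @ (x \<oplus> y) # vs \<in> tuples R m" using * by (auto simp: tuples_middle)
    have "p c = (\<phi> (us @ (x \<oplus> y) # vs) \<ominus>\<^bsub>G\<^esub> \<phi> (us @ x # vs)) \<ominus>\<^bsub>G\<^esub> \<phi> (us @ y # vs)"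
      unfolding c using * t p(2) by (simp add: pdiff keys_frag_of keys_diffI)
    moreover have "((a \<oplus>\<^bsub>G\<^esub> b) \<ominus>\<^bsub>G\<^esub> a) \<ominus>\<^bsub>G\<^esub> b = \<zero>\<^bsub>G\<^esub>"
      if "a \<in> carrier G" "b \<in> carrier G" for a b
      using that by (simp add: a_minus_def G.a_assoc flip: G.minus_add)
        (simp add: G.r_neg flip: G.a_assoc)
    ultimately show ?thesis using add[OF *] closed[OF *(1)] closed[OF *(2)] by simp
  next
    fix us x s y vs
    assume *: "us @ x # y # vs \<in> tuples R m" "s \<in> carrier S"
      and c: "c = frag_of (us @ (x \<otimes> h s) # y # vs) - frag_of (us @ x # (h s \<otimes> y) # vs)"
    have t: "us @ (x \<otimes> h s) # y # vs \<in> tuples R m" "us @ x # (h s \<otimes> y) # vs \<in> tuples R m"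
      using * by (auto simp: tuples_middle)
    then show ?thesis unfolding c using bal[OF *] closed p(2)
      by (simp add: pdiff keys_frag_of a_minus_def G.r_neg)
  qed
  then have "tensor_relations R S h m \<subseteq> kernel (F m) (add_monoid G) p"
    using relations_subset unfolding kernel_def
    by (simp only: subset_iff mem_Collect_eq) simp
  then have "K m \<subseteq> kernel (F m) (add_monoid G) p"
    unfolding tensor_kernel_def
    using group.generate_subgroup_incl[OF group_free_Abelian_group _ p.subgroup_kernel] by blast
  then have pK: "p k = \<zero>\<^bsub>G\<^esub>" if "k \<in> K m" for k using that by (auto simp: kernel_def)
  have same: "p c = p d" if cd: "c \<in> carrier (F m)" "d \<in> carrier (F m)"
    "K m #>\<^bsub>F m\<^esub> c = K m #>\<^bsub>F m\<^esub> d" for c d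
  proof -
    have "c \<in> cls m d" using cd(3) kernel_zero unfolding cls_def[symmetric] cls_eq by force
    then obtain k where k: "k \<in> K m" "c = k + d" by (auto simp: cls_eq)
    then show ?thesis using padd[of k d] pK pc cd kernel_in_carrier[of k m] by simp
  qed
  obtain g where g: "g \<in> hom (F m Mod K m) (add_monoid G)"
    "\<And>c. c \<in> carrier (F m) \<Longrightarrow> g (K m #>\<^bsub>F m\<^esub> c) = p c"
    using FactGroup_universal[OF p(1) kernel_normal same] by metis
  have gc: "g (cls m c) = p c" if "Poly_Mapping.keys c \<subseteq> tuples R m" for c
    using g(2)[of c] that by (simp add: cls_def)
  show ?thesis
  proof (rule that[of g])
    show "g C \<in> carrier G" if "C \<in> carrier (T m)" for C
      using that gc pc by (auto simp: T_sel)
    show "g (C \<oplus>\<^bsub>T m\<^esub> D) = g C \<oplus>\<^bsub>G\<^esub> g D" if CD: "C \<in> carrier (T m)" "D \<in> carrier (T m)" for C D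
    proof -
      obtain c d where cd: "Poly_Mapping.keys c \<subseteq> tuples R m" "C = cls m c"
        "Poly_Mapping.keys d \<subseteq> tuples R m" "D = cls m d" using CD by (auto simp: T_sel)
      then have "Poly_Mapping.keys (c + d) \<subseteq> tuples R m" using keys_add[of c d] by blast
      then show ?thesis using cd by (simp add: cls_add gc padd)
    qed
    show "g (elt xs) = \<phi> xs" if "xs \<in> tuples R m" for xs
      using that gc p(2) by (simp add: elt_cls keys_frag_of)
  qed
qed

text \<open>A map of tuples that respects the relations induces a map of the quotient.  The left side is
  the form in which the actions on a tensor power are defined.\<close>

lemma coset_action:
  assumes tup: "\<And>xs. xs \<in> tuples R m \<Longrightarrow> \<tau> xs \<in> tuples R m"
    and rel: "\<And>c. c \<in> tensor_relations R S h m \<Longrightarrow> frag_extend (\<lambda>xs. frag_of (\<tau> xs)) c \<in> tensor_relations R S h m"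
    and c: "c \<in> carrier (F m)"
  shows "K m <#>\<^bsub>F m\<^esub> (frag_extend (\<lambda>xs. frag_of (\<tau> xs)) ` cls m c) = cls m (frag_extend (\<lambda>xs. frag_of (\<tau> xs)) c)"
proof -
  let ?p = "frag_extend (\<lambda>xs. frag_of (\<tau> xs))"
  have pK: "?p k \<in> K m" if "k \<in> K m" for k
    using that unfolding tensor_kernel_def
  proof induction
    case one
    then show ?case using generate.one[of "F m"] by simp
  next
    case (incl c)
    then show ?case by (intro generate.incl rel)
  next
    case (inv c)
    then have "c \<in> carrier (F m)" using relations_subset by blast
    then show ?case using kernel_minus[of "?p c" m] generate.incl[OF rel[OF inv], of "F m"]
      by (simp add: frag_extend_minus tensor_kernel_def)
  next
    case (eng a b)
    then show ?case using generate.eng[OF eng.IH] by (simp add: frag_extend_add)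
  qed
  have "K m <#>\<^bsub>F m\<^esub> (?p ` cls m c) = {k + ?p (k' + c) | k k'. k \<in> K m \<and> k' \<in> K m}"
    by (auto simp: set_mult_def cls_eq)
  also have "\<dots> = {k + ?p c | k. k \<in> K m}"
  proof (intro equalityI subsetI)
    fix z assume "z \<in> {k + ?p (k' + c) | k k'. k \<in> K m \<and> k' \<in> K m}"
    then obtain k k' where z: "z = k + ?p (k' + c)" "k \<in> K m" "k' \<in> K m" by blast
    then have "z = (k + ?p k') + ?p c" by (simp add: frag_extend_add)
    then show "z \<in> {k + ?p c | k. k \<in> K m}" using kernel_add[OF z(2) pK[OF z(3)]] by blast
  next
    fix z assume "z \<in> {k + ?p c | k. k \<in> K m}"
    then obtain k where z: "z = k + ?p c" "k \<in> K m" by blast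
    then have "z = k + ?p (0 + c)" by simp
    then show "z \<in> {k + ?p (k' + c) | k k'. k \<in> K m \<and> k' \<in> K m}"
      using z(2) kernel_zero by blast
  qed
  finally show ?thesis by (simp add: cls_eq)
qed


lemma relationsI:
  "us @ x # vs \<in> tuples R m \<Longrightarrow> us @ y # vs \<in> tuples R m \<Longrightarrow>
    frag_of (us @ (x \<oplus> y) # vs) - frag_of (us @ x # vs) - frag_of (us @ y # vs)
      \<in> tensor_relations R S h m"
  "us @ x # y # vs \<in> tuples R m \<Longrightarrow> s \<in> carrier S \<Longrightarrow>
    frag_of (us @ (x \<otimes> h s) # y # vs) - frag_of (us @ x # (h s \<otimes> y) # vs)
      \<in> tensor_relations R S h m"
  unfolding tensor_relations_def by blast+

lemma relations_cases [consumes 1, case_names additive balanced]: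
  assumes "c \<in> tensor_relations R S h m"
  obtains us x y vs where "us @ x # vs \<in> tuples R m" "us @ y # vs \<in> tuples R m"
      "c = frag_of (us @ (x \<oplus> y) # vs) - frag_of (us @ x # vs) - frag_of (us @ y # vs)"
  | us x s y vs where "us @ x # y # vs \<in> tuples R m" "s \<in> carrier S"
      "c = frag_of (us @ (x \<otimes> h s) # y # vs) - frag_of (us @ x # (h s \<otimes> y) # vs)"
  using assms unfolding tensor_relations_def by blast

lemma left_map_relations:
  assumes r: "r \<in> carrier R" and c: "c \<in> tensor_relations R S h m"
  shows "frag_extend (\<lambda>xs. frag_of ((r \<otimes> hd xs) # tl xs)) c \<in> tensor_relations R S h m"
  using c
proof (cases rule: relations_cases)
  case (additive us x y vs)
  show ?thesis
  proof (cases us)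
    case Nil
    then show ?thesis using r additive(1,2) relationsI(1)[of "[]" "r \<otimes> x" vs m "r \<otimes> y"]
      by (auto simp: additive(3) frag_extend_diff R.r_distr tuples_def)
  next
    case (Cons u us')
    then show ?thesis using r additive(1,2) relationsI(1)[of "(r \<otimes> u) # us'" x vs m y]
      by (auto simp: additive(3) frag_extend_diff tuples_def)
  qed
next
  case (balanced us x s y vs)
  show ?thesis
  proof (cases us)
    case Nil
    then show ?thesis using r balanced(1,2) relationsI(2)[of "[]" "r \<otimes> x" y vs m s]
      by (auto simp: balanced(3) frag_extend_diff R.m_assoc tuples_def)
  next
    case (Cons u us')
    then show ?thesis using r balanced(1,2) relationsI(2)[of "(r \<otimes> u) # us'" x y vs m s]
      by (auto simp: balanced(3) frag_extend_diff tuples_def)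
  qed
qed

lemma right_map_relations:
  assumes r: "r \<in> carrier R" and c: "c \<in> tensor_relations R S h m"
  shows "frag_extend (\<lambda>xs. frag_of (butlast xs @ [last xs \<otimes> r])) c \<in> tensor_relations R S h m"
  using c
proof (cases rule: relations_cases)
  case (additive us x y vs)
  show ?thesis
  proof (cases vs rule: rev_cases)
    case Nil
    then show ?thesis using r additive(1,2) relationsI(1)[of us "x \<otimes> r" "[]" m "y \<otimes> r"]
      by (auto simp: additive(3) frag_extend_diff R.l_distr tuples_def)
  next
    case (snoc vs' v)
    then show ?thesis using r additive(1,2) relationsI(1)[of us x "vs' @ [v \<otimes> r]" m y]
      by (auto simp: additive(3) frag_extend_diff tuples_def butlast_append)
  qed
next
  case (balanced us x s y vs)
  show ?thesis
  proof (cases vs rule: rev_cases)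
    case Nil
    then show ?thesis using r balanced(1,2) relationsI(2)[of us x "y \<otimes> r" "[]" m s]
      by (auto simp: balanced(3) frag_extend_diff R.m_assoc tuples_def butlast_append)
  next
    case (snoc vs' v)
    then show ?thesis using r balanced(1,2) relationsI(2)[of us x y "vs' @ [v \<otimes> r]" m s]
      by (auto simp: balanced(3) frag_extend_diff tuples_def butlast_append)
  qed
qed

lemma tuple_map_closed:
  assumes "r \<in> carrier R" "xs \<in> tuples R (Suc m)"
  shows "(r \<otimes> hd xs) # tl xs \<in> tuples R (Suc m)"
    and "butlast xs @ [last xs \<otimes> r] \<in> tuples R (Suc m)"
proof -
  show "(r \<otimes> hd xs) # tl xs \<in> tuples R (Suc m)"
    using assms by (cases xs) (auto simp: tuples_def)
  show "butlast xs @ [last xs \<otimes> r] \<in> tuples R (Suc m)"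
    using assms by (cases xs rule: rev_cases) (auto simp: tuples_def)
qed

lemma lact_cls:
  assumes "r \<in> carrier R" "c \<in> carrier (F (Suc m))"
  shows "r \<odot>\<^bsub>T (Suc m)\<^esub> cls (Suc m) c =
    cls (Suc m) (frag_extend (\<lambda>xs. frag_of ((r \<otimes> hd xs) # tl xs)) c)"
  using coset_action[OF tuple_map_closed(1)[OF assms(1)] left_map_relations[OF assms(1)] assms(2)]
  by (simp add: tensor_power_def Let_def)

lemma ract_cls:
  assumes "r \<in> carrier R" "c \<in> carrier (F (Suc m))"
  shows "cls (Suc m) c \<odot>\<^sub>r\<^bsub>T (Suc m)\<^esub> r =
    cls (Suc m) (frag_extend (\<lambda>xs. frag_of (butlast xs @ [last xs \<otimes> r])) c)"
  using coset_action[OF tuple_map_closed(2)[OF assms(1)] right_map_relations[OF assms(1)] assms(2)]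
  by (simp add: tensor_power_def Let_def)

lemma frag_extend_closed:
  assumes "\<And>xs. xs \<in> tuples R m \<Longrightarrow> \<tau> xs \<in> tuples R m" "c \<in> carrier (F m)"
  shows "frag_extend (\<lambda>xs. frag_of (\<tau> xs)) c \<in> carrier (F m)"
  using assms keys_frag_extend[of "\<lambda>xs. frag_of (\<tau> xs)" c] by (fastforce simp: keys_frag_of)

lemma lact_elt:
  assumes "r \<in> carrier R" "x \<in> carrier R" "xs \<in> tuples R m"
  shows "r \<odot>\<^bsub>T (Suc m)\<^esub> elt (x # xs) = elt ((r \<otimes> x) # xs)"
proof -
  have "x # xs \<in> tuples R (Suc m)" "(r \<otimes> x) # xs \<in> tuples R (Suc m)" using assms by simp_all
  then show ?thesis using lact_cls[of r "frag_of (x # xs)" m] assms(1)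
    by (simp add: elt_cls[of _ "Suc m"] keys_frag_of)
qed

lemma ract_elt:
  assumes "r \<in> carrier R" "x \<in> carrier R" "xs \<in> tuples R m"
  shows "elt (xs @ [x]) \<odot>\<^sub>r\<^bsub>T (Suc m)\<^esub> r = elt (xs @ [x \<otimes> r])"
proof -
  have "xs @ [x] \<in> tuples R (Suc m)" "xs @ [x \<otimes> r] \<in> tuples R (Suc m)"
    using assms by (auto simp: tuples_def)
  then show ?thesis using ract_cls[of r "frag_of (xs @ [x])" m] assms(1)
    by (simp add: elt_cls[of _ "Suc m"] keys_frag_of)
qed

lemma T_biaction: "biaction R R (T (Suc m))"
proof -
  have cd: "\<exists>c. c \<in> carrier (F (Suc m)) \<and> C = cls (Suc m) c" if "C \<in> carrier (T (Suc m))" for C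
    using that unfolding T_sel by blast
  have cl: "cls (Suc m) c \<in> carrier (T (Suc m))" if "c \<in> carrier (F (Suc m))" for c
    using that by (auto simp: T_sel)
  have L: "frag_extend (\<lambda>xs. frag_of ((r \<otimes> hd xs) # tl xs)) c \<in> carrier (F (Suc m))"
    if "r \<in> carrier R" "c \<in> carrier (F (Suc m))" for r c
    by (rule frag_extend_closed) (use that tuple_map_closed in auto)
  have R: "frag_extend (\<lambda>xs. frag_of (butlast xs @ [last xs \<otimes> r])) c \<in> carrier (F (Suc m))"
    if "r \<in> carrier R" "c \<in> carrier (F (Suc m))" for r c
    by (rule frag_extend_closed) (use that tuple_map_closed in auto)
  have FA: "c + d \<in> carrier (F m)" if "c \<in> carrier (F m)" "d \<in> carrier (F m)" for c d m
    using that keys_add[of c d] by auto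
  show ?thesis
  proof (rule biaction.intro[OF T_abelian_group], unfold_locales)
    fix r C D assume r: "r \<in> carrier R" and C: "C \<in> carrier (T (Suc m))"
    obtain c where c: "c \<in> carrier (F (Suc m))" "C = cls (Suc m) c" using cd[OF C] by blast
    show "r \<odot>\<^bsub>T (Suc m)\<^esub> C \<in> carrier (T (Suc m))"
      unfolding c(2) lact_cls[OF r c(1)] by (rule cl[OF L[OF r c(1)]])
    show "C \<odot>\<^sub>r\<^bsub>T (Suc m)\<^esub> r \<in> carrier (T (Suc m))"
      unfolding c(2) ract_cls[OF r c(1)] by (rule cl[OF R[OF r c(1)]])
    assume D: "D \<in> carrier (T (Suc m))"
    obtain d where d: "d \<in> carrier (F (Suc m))" "D = cls (Suc m) d" using cd[OF D] by blast
    show "r \<odot>\<^bsub>T (Suc m)\<^esub> (C \<oplus>\<^bsub>T (Suc m)\<^esub> D) =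
      r \<odot>\<^bsub>T (Suc m)\<^esub> C \<oplus>\<^bsub>T (Suc m)\<^esub> r \<odot>\<^bsub>T (Suc m)\<^esub> D"
      unfolding c(2) d(2) cls_add[OF c(1) d(1)] lact_cls[OF r c(1)] lact_cls[OF r d(1)]
        lact_cls[OF r FA[OF c(1) d(1)]] cls_add[OF L[OF r c(1)] L[OF r d(1)]]
      by (simp add: frag_extend_add)
    show "(C \<oplus>\<^bsub>T (Suc m)\<^esub> D) \<odot>\<^sub>r\<^bsub>T (Suc m)\<^esub> r =
      C \<odot>\<^sub>r\<^bsub>T (Suc m)\<^esub> r \<oplus>\<^bsub>T (Suc m)\<^esub> D \<odot>\<^sub>r\<^bsub>T (Suc m)\<^esub> r"
      unfolding c(2) d(2) cls_add[OF c(1) d(1)] ract_cls[OF r c(1)] ract_cls[OF r d(1)]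
        ract_cls[OF r FA[OF c(1) d(1)]] cls_add[OF R[OF r c(1)] R[OF r d(1)]]
      by (simp add: frag_extend_add)
  qed
qed

end


context ring_extension
begin

lemma T_ring_bimodule: "ring_bimodule R R (T (Suc m))"
proof -
  let ?T = "T (Suc m)"
  interpret biaction R R ?T by (rule T_biaction)
  have tup: "\<exists>x ys. xs = x # ys \<and> x \<in> carrier R \<and> ys \<in> tuples R m"
    "\<exists>x ys. xs = ys @ [x] \<and> x \<in> carrier R \<and> ys \<in> tuples R m" if "xs \<in> tuples R (Suc m)" for xs
    using that by (cases xs, auto simp: tuples_def) (cases xs rule: rev_cases, auto simp: tuples_def)
  have left: "P (elt xs)" if "xs \<in> tuples R (Suc m)"
    "\<And>x ys. x \<in> carrier R \<Longrightarrow> ys \<in> tuples R m \<Longrightarrow> P (elt (x # ys))" for xs P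
    using tup(1)[OF that(1)] that(2) by blast
  have right: "P (elt xs)" if "xs \<in> tuples R (Suc m)"
    "\<And>x ys. x \<in> carrier R \<Longrightarrow> ys \<in> tuples R m \<Longrightarrow> P (elt (ys @ [x]))" for xs P
    using tup(2)[OF that(1)] that(2) by blast
  have cons: "x # ys \<in> tuples R (Suc m)" "ys @ [x] \<in> tuples R (Suc m)"
    if "x \<in> carrier R" "ys \<in> tuples R m" for x ys using that by (auto simp: tuples_def)
  show ?thesis
  proof unfold_locales
    fix r r' C assume r: "r \<in> carrier R" "r' \<in> carrier R" and C: "C \<in> carrier (?T)"
    show "(r \<oplus> r') \<odot>\<^bsub>?T\<^esub> C = r \<odot>\<^bsub>?T\<^esub> C \<oplus>\<^bsub>?T\<^esub> r' \<odot>\<^bsub>?T\<^esub> C"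
      using C
    proof (induction C rule: tensor_induct)
      case (elt xs)
      then show ?case
        by (rule left) (use r in \<open>simp add: lact_elt R.l_distr elt_add_first\<close>)
    next
      case (add C D)
      then show ?case using r by (simp add: lact_add a_ac)
    qed
    show "(r \<otimes> r') \<odot>\<^bsub>?T\<^esub> C = r \<odot>\<^bsub>?T\<^esub> (r' \<odot>\<^bsub>?T\<^esub> C)"
      using C
    proof (induction C rule: tensor_induct)
      case (elt xs)
      then show ?case by (rule left) (use r in \<open>simp add: lact_elt R.m_assoc\<close>)
    next
      case (add C D)
      then show ?case using r by (simp add: lact_add)
    qed
    show "C \<odot>\<^sub>r\<^bsub>?T\<^esub> (r \<oplus> r') = C \<odot>\<^sub>r\<^bsub>?T\<^esub> r \<oplus>\<^bsub>?T\<^esub> C \<odot>\<^sub>r\<^bsub>?T\<^esub> r'"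
      using C
    proof (induction C rule: tensor_induct)
      case (elt xs)
      then show ?case
      proof (rule right)
        fix x ys assume xy: "x \<in> carrier R" "ys \<in> tuples R m"
        have "ys @ [x \<otimes> r] \<in> tuples R (Suc m)" "ys @ [x \<otimes> r'] \<in> tuples R (Suc m)"
          using xy r cons by auto
        from elt_add[OF this]
        show "elt (ys @ [x]) \<odot>\<^sub>r\<^bsub>?T\<^esub> (r \<oplus> r') =
          elt (ys @ [x]) \<odot>\<^sub>r\<^bsub>?T\<^esub> r \<oplus>\<^bsub>?T\<^esub> elt (ys @ [x]) \<odot>\<^sub>r\<^bsub>?T\<^esub> r'"
          using xy r by (simp add: ract_elt R.r_distr)
      qed
    next
      case (add C D)
      then show ?case using r by (simp add: ract_add a_ac)
    qed
    show "C \<odot>\<^sub>r\<^bsub>?T\<^esub> (r \<otimes> r') = (C \<odot>\<^sub>r\<^bsub>?T\<^esub> r) \<odot>\<^sub>r\<^bsub>?T\<^esub> r'"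
      using C
    proof (induction C rule: tensor_induct)
      case (elt xs)
      then show ?case by (rule right) (use r in \<open>simp add: ract_elt R.m_assoc\<close>)
    next
      case (add C D)
      then show ?case using r by (simp add: ract_add)
    qed
    show "(r \<odot>\<^bsub>?T\<^esub> C) \<odot>\<^sub>r\<^bsub>?T\<^esub> r' = r \<odot>\<^bsub>?T\<^esub> (C \<odot>\<^sub>r\<^bsub>?T\<^esub> r')"
      using C
    proof (induction C rule: tensor_induct)
      case (elt xs)
      show ?case
      proof (cases m)
        case 0
        then obtain x where x: "xs = [x]" "x \<in> carrier R"
          using elt by (auto simp: tuples_def length_Suc_conv)
        have nil: "[] \<in> tuples R m" using 0 by (simp add: tuples_def)
        show ?thesis
          using x r lact_elt[OF _ _ nil] ract_elt[OF _ _ nil] by (simp add: R.m_assoc)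
      next
        case (Suc k)
        then obtain x ys where x: "xs = x # ys" "x \<in> carrier R" "ys \<in> tuples R (Suc k)"
          using tup(1)[OF elt] by blast
        then obtain y zs where y: "ys = zs @ [y]" "y \<in> carrier R" "zs \<in> tuples R k"
          by (cases ys rule: rev_cases) (auto simp: tuples_def)
        have z: "x' # zs \<in> tuples R m" if "x' \<in> carrier R" for x'
          using that y(3) Suc by simp
        have w: "zs @ [y'] \<in> tuples R m" if "y' \<in> carrier R" for y'
          using that y(3) Suc by (auto simp: tuples_def)
        show ?thesis
          using x y r z w ract_elt[OF _ _ z] lact_elt[OF _ _ w] by simp
      qed
    next
      case (add C D)
      then show ?case using r by (simp add: lact_add ract_add)
    qed
  next
    fix C assume C: "C \<in> carrier (?T)"
    show "\<one> \<odot>\<^bsub>?T\<^esub> C = C"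
      using C
    proof (induction C rule: tensor_induct)
      case (elt xs)
      then show ?case by (rule left) (simp add: lact_elt)
    qed (simp add: lact_add)
    show "C \<odot>\<^sub>r\<^bsub>?T\<^esub> \<one> = C"
      using C
    proof (induction C rule: tensor_induct)
      case (elt xs)
      then show ?case by (rule right) (simp add: ract_elt)
    qed (simp add: ract_add)
  qed
qed

text \<open>The map \<open>C \<mapsto> x \<otimes> C\<close>, which exhibits the tensor power with \<open>m + 1\<close> factors as \<open>R\<close> tensored
  with the one with \<open>m\<close> factors.\<close>

definition tcons :: "nat \<Rightarrow> 'a \<Rightarrow> ('a list \<Rightarrow>\<^sub>0 int) set \<Rightarrow> ('a list \<Rightarrow>\<^sub>0 int) set" where
  "tcons m x = (SOME f. (\<forall>C\<in>carrier (T m). f C \<in> carrier (T (Suc m))) \<and>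
     (\<forall>C\<in>carrier (T m). \<forall>D\<in>carrier (T m). f (C \<oplus>\<^bsub>T m\<^esub> D) = f C \<oplus>\<^bsub>T (Suc m)\<^esub> f D) \<and>
     (\<forall>xs\<in>tuples R m. f (elt xs) = elt (x # xs)))"

lemma tcons:
  assumes x: "x \<in> carrier R"
  shows "C \<in> carrier (T m) \<Longrightarrow> tcons m x C \<in> carrier (T (Suc m))"
    and "C \<in> carrier (T m) \<Longrightarrow> D \<in> carrier (T m) \<Longrightarrow>
      tcons m x (C \<oplus>\<^bsub>T m\<^esub> D) = tcons m x C \<oplus>\<^bsub>T (Suc m)\<^esub> tcons m x D"
    and "xs \<in> tuples R m \<Longrightarrow> tcons m x (elt xs) = elt (x # xs)"
proof -
  let ?Q = "\<lambda>f. (\<forall>C\<in>carrier (T m). f C \<in> carrier (T (Suc m))) \<and>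
     (\<forall>C\<in>carrier (T m). \<forall>D\<in>carrier (T m). f (C \<oplus>\<^bsub>T m\<^esub> D) = f C \<oplus>\<^bsub>T (Suc m)\<^esub> f D) \<and>
     (\<forall>xs\<in>tuples R m. f (elt xs) = elt (x # xs))"
  obtain f where "\<And>C. C \<in> carrier (T m) \<Longrightarrow> f C \<in> carrier (T (Suc m))"
    "\<And>C D. C \<in> carrier (T m) \<Longrightarrow> D \<in> carrier (T m) \<Longrightarrow> f (C \<oplus>\<^bsub>T m\<^esub> D) = f C \<oplus>\<^bsub>T (Suc m)\<^esub> f D"
    "\<And>xs. xs \<in> tuples R m \<Longrightarrow> f (elt xs) = elt (x # xs)"
  proof (rule tensor_lift[OF T_abelian_group[of "Suc m"], of m "\<lambda>xs. elt (x # xs)"])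
    show "elt (x # xs) \<in> carrier (T (Suc m))" if "xs \<in> tuples R m" for xs
      using that x by (intro elt_closed) simp
    show "elt (x # us @ (y \<oplus> z) # vs) = elt (x # us @ y # vs) \<oplus>\<^bsub>T (Suc m)\<^esub> elt (x # us @ z # vs)"
      if "us @ y # vs \<in> tuples R m" "us @ z # vs \<in> tuples R m" for us y z vs
      using elt_add[of "x # us" y vs "Suc m" z] that x by simp
    show "elt (x # us @ (y \<otimes> h s) # z # vs) = elt (x # us @ y # (h s \<otimes> z) # vs)"
      if "us @ y # z # vs \<in> tuples R m" "s \<in> carrier S" for us y s z vs
      using elt_balanced[of "x # us" y z vs "Suc m" s] that x by simp
  qed blast
  then have "?Q f" by blast
  then have "?Q (tcons m x)" unfolding tcons_def by (rule someI[of ?Q f])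
  then show "C \<in> carrier (T m) \<Longrightarrow> tcons m x C \<in> carrier (T (Suc m))"
    "C \<in> carrier (T m) \<Longrightarrow> D \<in> carrier (T m) \<Longrightarrow>
      tcons m x (C \<oplus>\<^bsub>T m\<^esub> D) = tcons m x C \<oplus>\<^bsub>T (Suc m)\<^esub> tcons m x D"
    "xs \<in> tuples R m \<Longrightarrow> tcons m x (elt xs) = elt (x # xs)" by blast+
qed

end

section \<open>One tensor factor at a time\<close>

text \<open>\<open>W\<close> is generated by the values of a middle linear map \<open>pr : R \<times> U \<rightarrow> W\<close>, in the way in
  which a tensor product of \<open>R\<close> and \<open>U\<close> is.  The modules \<open>U\<close> and \<open>W\<close> are modules over one ring \<open>A\<close>,
  which acts on \<open>R\<close> through \<open>l\<close>; \<open>Q\<close> is the subset of \<open>A\<close> over which the tensor product is taken.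
  The two cases of interest are \<open>A \<otimes>\<^sub>B U\<close>, where \<open>R = A\<close> and \<open>Q = B\<close>, and \<open>E \<otimes>\<^sub>A U\<close>, where \<open>R = E\<close> and
  \<open>Q = A\<close>; with this encoding they live over the same scalars \<open>A\<close>.\<close>

locale tensor_over = A: ring A + R: ring R + U: ring_bimodule A A U + W: biaction A A W
  for A :: "('a, 'x) ring_scheme" and R :: "('r, 'y) ring_scheme" and l :: "'a \<Rightarrow> 'r" and Q :: "'a set"
    and U :: "('a, 'a, 'u) bimodule" and W :: "('a, 'a, 'w) bimodule" and pr :: "'r \<Rightarrow> 'u \<Rightarrow> 'w" +
  assumes l_hom: "l \<in> ring_hom A R" and Q_sub: "Q \<subseteq> carrier A"
    and pr_closed: "x \<in> carrier R \<Longrightarrow> u \<in> carrier U \<Longrightarrow> pr x u \<in> carrier W"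
    and pr_add_left: "x \<in> carrier R \<Longrightarrow> y \<in> carrier R \<Longrightarrow> u \<in> carrier U \<Longrightarrow>
      pr (x \<oplus>\<^bsub>R\<^esub> y) u = pr x u \<oplus>\<^bsub>W\<^esub> pr y u"
    and pr_add_right: "x \<in> carrier R \<Longrightarrow> u \<in> carrier U \<Longrightarrow> v \<in> carrier U \<Longrightarrow>
      pr x (u \<oplus>\<^bsub>U\<^esub> v) = pr x u \<oplus>\<^bsub>W\<^esub> pr x v"
    and pr_balanced: "x \<in> carrier R \<Longrightarrow> q \<in> Q \<Longrightarrow> u \<in> carrier U \<Longrightarrow>
      pr (x \<otimes>\<^bsub>R\<^esub> l q) u = pr x (q \<odot>\<^bsub>U\<^esub> u)"
    and pr_lact: "a \<in> carrier A \<Longrightarrow> x \<in> carrier R \<Longrightarrow> u \<in> carrier U \<Longrightarrow>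
      a \<odot>\<^bsub>W\<^esub> pr x u = pr (l a \<otimes>\<^bsub>R\<^esub> x) u"
    and pr_ract: "a \<in> carrier A \<Longrightarrow> x \<in> carrier R \<Longrightarrow> u \<in> carrier U \<Longrightarrow>
      pr x u \<odot>\<^sub>r\<^bsub>W\<^esub> a = pr x (u \<odot>\<^sub>r\<^bsub>U\<^esub> a)"
    and pr_induct [consumes 1, case_names pr add]: "w \<in> carrier W \<Longrightarrow>
      (\<And>x u. x \<in> carrier R \<Longrightarrow> u \<in> carrier U \<Longrightarrow> P (pr x u)) \<Longrightarrow>
      (\<And>w w'. w \<in> carrier W \<Longrightarrow> w' \<in> carrier W \<Longrightarrow> P w \<Longrightarrow> P w' \<Longrightarrow> P (w \<oplus>\<^bsub>W\<^esub> w')) \<Longrightarrow> P w"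
begin

lemma l_closed [simp]: "a \<in> carrier A \<Longrightarrow> l a \<in> carrier R"
  using l_hom by (rule ring_hom_closed)

end

definition middle_linear ::
    "('r, 'y) ring_scheme \<Rightarrow> ('a \<Rightarrow> 'r) \<Rightarrow> 'a set \<Rightarrow> ('a, 's, 'u) bimodule \<Rightarrow> ('g, 'z) ring_scheme \<Rightarrow>
     ('r \<Rightarrow> 'u \<Rightarrow> 'g) \<Rightarrow> bool" where
  "middle_linear R l Q U G \<beta> \<longleftrightarrow>
     (\<forall>x\<in>carrier R. \<forall>u\<in>carrier U. \<beta> x u \<in> carrier G) \<and>
     (\<forall>x\<in>carrier R. \<forall>y\<in>carrier R. \<forall>u\<in>carrier U. \<beta> (x \<oplus>\<^bsub>R\<^esub> y) u = \<beta> x u \<oplus>\<^bsub>G\<^esub> \<beta> y u) \<and>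
     (\<forall>x\<in>carrier R. \<forall>u\<in>carrier U. \<forall>v\<in>carrier U. \<beta> x (u \<oplus>\<^bsub>U\<^esub> v) = \<beta> x u \<oplus>\<^bsub>G\<^esub> \<beta> x v) \<and>
     (\<forall>x\<in>carrier R. \<forall>q\<in>Q. \<forall>u\<in>carrier U. \<beta> (x \<otimes>\<^bsub>R\<^esub> l q) u = \<beta> x (q \<odot>\<^bsub>U\<^esub> u))"

text \<open>The universal property of a tensor product quantifies over all abelian groups \<open>G\<close>, hence
  over all types; here it is stated for one \<open>G\<close> at a time.\<close>

definition factors_middle_linear ::
    "('r, 'y) ring_scheme \<Rightarrow> ('a \<Rightarrow> 'r) \<Rightarrow> 'a set \<Rightarrow> ('a, 's, 'u) bimodule \<Rightarrow> ('a, 's, 'w) bimodule \<Rightarrow>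
     ('r \<Rightarrow> 'u \<Rightarrow> 'w) \<Rightarrow> ('g, 'z) ring_scheme \<Rightarrow> bool" where
  "factors_middle_linear R l Q U W pr G \<longleftrightarrow>
     (\<forall>\<beta>. middle_linear R l Q U G \<beta> \<longrightarrow>
       (\<exists>f. (\<forall>w\<in>carrier W. f w \<in> carrier G) \<and>
         (\<forall>w\<in>carrier W. \<forall>w'\<in>carrier W. f (w \<oplus>\<^bsub>W\<^esub> w') = f w \<oplus>\<^bsub>G\<^esub> f w') \<and>
         (\<forall>x\<in>carrier R. \<forall>u\<in>carrier U. f (pr x u) = \<beta> x u)))"

lemma (in tensor_over) tensor_map:
  assumes fac: "factors_middle_linear R l Q U W pr W'" and W': "biaction A A W'"
    and \<beta>: "middle_linear R l Q U W' \<beta>"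
    and lin: "\<And>a x u. a \<in> carrier A \<Longrightarrow> x \<in> carrier R \<Longrightarrow> u \<in> carrier U \<Longrightarrow> \<beta> (l a \<otimes>\<^bsub>R\<^esub> x) u = a \<odot>\<^bsub>W'\<^esub> \<beta> x u"
      "\<And>a x u. a \<in> carrier A \<Longrightarrow> x \<in> carrier R \<Longrightarrow> u \<in> carrier U \<Longrightarrow> \<beta> x (u \<odot>\<^sub>r\<^bsub>U\<^esub> a) = \<beta> x u \<odot>\<^sub>r\<^bsub>W'\<^esub> a"
  obtains f where "f \<in> bihom A A W W'" "\<And>x u. x \<in> carrier R \<Longrightarrow> u \<in> carrier U \<Longrightarrow> f (pr x u) = \<beta> x u"
proof -
  interpret W': biaction A A W' by fact
  obtain f where f: "\<And>w. w \<in> carrier W \<Longrightarrow> f w \<in> carrier W'"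
    "\<And>w w'. w \<in> carrier W \<Longrightarrow> w' \<in> carrier W \<Longrightarrow> f (w \<oplus>\<^bsub>W\<^esub> w') = f w \<oplus>\<^bsub>W'\<^esub> f w'"
    "\<And>x u. x \<in> carrier R \<Longrightarrow> u \<in> carrier U \<Longrightarrow> f (pr x u) = \<beta> x u"
    using fac[unfolded factors_middle_linear_def, THEN spec, THEN mp, OF \<beta>] by (elim exE) blast
  have "restrict f (carrier W) \<in> bihom A A W W'"
  proof (rule bihomI)
    fix a w assume a: "a \<in> carrier A" and w: "w \<in> carrier W"
    have "f (a \<odot>\<^bsub>W\<^esub> w) = a \<odot>\<^bsub>W'\<^esub> f w" using w
    proof (induction rule: pr_induct)
      case (pr x u)
      then show ?case using a by (simp add: pr_lact f(3) lin(1))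
    next
      case (add w w')
      then show ?case using a by (simp add: f W.lact_add W'.lact_add)
    qed
    then show "restrict f (carrier W) (a \<odot>\<^bsub>W\<^esub> w) = a \<odot>\<^bsub>W'\<^esub> restrict f (carrier W) w"
      using a w by simp
  next
    fix a w assume a: "a \<in> carrier A" and w: "w \<in> carrier W"
    have "f (w \<odot>\<^sub>r\<^bsub>W\<^esub> a) = f w \<odot>\<^sub>r\<^bsub>W'\<^esub> a" using w
    proof (induction rule: pr_induct)
      case (pr x u)
      then show ?case using a by (simp add: pr_ract f(3) lin(2))
    next
      case (add w w')
      then show ?case using a by (simp add: f W.ract_add W'.ract_add)
    qed
    then show "restrict f (carrier W) (w \<odot>\<^sub>r\<^bsub>W\<^esub> a) = restrict f (carrier W) w \<odot>\<^sub>r\<^bsub>W'\<^esub> a"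
      using a w by simp
  qed (use f in auto)
  then show ?thesis by (rule that) (use f pr_closed in simp)
qed

text \<open>Balancing over \<open>S\<close> means the same as balancing over \<open>Q\<close>, so the tensor powers of \<open>R\<close> over \<open>S\<close>
  can be handled as modules over \<open>A\<close>.\<close>

locale ring_extension_over = ring_extension R S h + A: ring A
  for R :: "('r, 'y) ring_scheme" and S :: "('s, 'z) ring_scheme" and h
    and A :: "('a, 'x) ring_scheme" +
  fixes l :: "'a \<Rightarrow> 'r" and Q :: "'a set"
  assumes l_hom: "l \<in> ring_hom A R" and Q_sub: "Q \<subseteq> carrier A" and l_Q: "l ` Q = h ` carrier S"
begin

abbreviation RT where "RT m \<equiv> restrict_scalars l l (T (Suc m))"

lemma l_closed [simp]: "a \<in> carrier A \<Longrightarrow> l a \<in> carrier R"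
  using l_hom by (rule ring_hom_closed)

lemma RT_bimodule: "ring_bimodule A A (RT m)"
  by (rule restrict_scalars_bimodule[OF T_ring_bimodule A.ring_axioms A.ring_axioms l_hom l_hom])

lemma tensor_over_step: "tensor_over A R l Q (RT m) (RT (Suc m)) (tcons (Suc m))"
proof -
  interpret U: ring_bimodule R R "T (Suc m)" by (rule T_ring_bimodule)
  interpret W: ring_bimodule R R "T (Suc (Suc m))" by (rule T_ring_bimodule)
  have tup: "\<exists>x ys. xs = x # ys \<and> x \<in> carrier R \<and> ys \<in> tuples R k" if "xs \<in> tuples R (Suc k)" for xs k
    using that by (cases xs) (auto simp: tuples_def)
  show ?thesis
  proof (rule tensor_over.intro[OF A.ring_axioms R.ring_axioms RT_bimodule
        ring_bimodule.axioms(3)[OF RT_bimodule]], unfold_locales, unfold restrict_scalars_sel)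
    show "l \<in> ring_hom A R" "Q \<subseteq> carrier A" by (rule l_hom, rule Q_sub)
    fix x y C D assume x: "x \<in> carrier R" and C: "C \<in> carrier (T (Suc m))"
    show "tcons (Suc m) x C \<in> carrier (T (Suc (Suc m)))" by (rule tcons(1)[OF x C])
    show "tcons (Suc m) x (C \<oplus>\<^bsub>T (Suc m)\<^esub> D) =
      tcons (Suc m) x C \<oplus>\<^bsub>T (Suc (Suc m))\<^esub> tcons (Suc m) x D"
      if "D \<in> carrier (T (Suc m))" by (rule tcons(2)[OF x C that])
    show "tcons (Suc m) (x \<oplus>\<^bsub>R\<^esub> y) C = tcons (Suc m) x C \<oplus>\<^bsub>T (Suc (Suc m))\<^esub> tcons (Suc m) y C"
      if y: "y \<in> carrier R" using C
    proof (induction rule: tensor_induct)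
      case (elt xs)
      then show ?case using x y by (simp add: tcons elt_add_first)
    next
      case (add C D)
      then show ?case using x y tcons(1) by (simp add: tcons(2) W.a_ac)
    qed
    show "tcons (Suc m) (x \<otimes>\<^bsub>R\<^esub> l q) C = tcons (Suc m) x (l q \<odot>\<^bsub>T (Suc m)\<^esub> C)" if q: "q \<in> Q" for q
    proof -
      obtain s where s: "s \<in> carrier S" "l q = h s" using l_Q q by blast
      have lq: "l q \<in> carrier R" using q Q_sub by auto
      show ?thesis using C
      proof (induction rule: tensor_induct)
        case (elt xs)
        then obtain y ys where y: "xs = y # ys" "y \<in> carrier R" "ys \<in> tuples R m" using tup by blast
        then show ?case using x s lq elt_balanced[of "[]" x y ys "Suc (Suc m)" s]
          by (simp add: tcons lact_elt)
      next
        case (add C D)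
        then show ?case using x lq by (simp add: tcons(2) U.lact_add)
      qed
    qed
    show "l a \<odot>\<^bsub>T (Suc (Suc m))\<^esub> tcons (Suc m) x C = tcons (Suc m) (l a \<otimes>\<^bsub>R\<^esub> x) C"
      if a: "a \<in> carrier A" for a using C
    proof (induction rule: tensor_induct)
      case (elt xs)
      then show ?case using x a by (simp add: tcons lact_elt)
    next
      case (add C D)
      then show ?case using x a tcons(1) by (simp add: tcons(2) W.lact_add)
    qed
    show "tcons (Suc m) x C \<odot>\<^sub>r\<^bsub>T (Suc (Suc m))\<^esub> l a = tcons (Suc m) x (C \<odot>\<^sub>r\<^bsub>T (Suc m)\<^esub> l a)"
      if a: "a \<in> carrier A" for a using C
    proof (induction rule: tensor_induct)
      case (elt xs)
      then obtain y ys where y: "xs = ys @ [y]" "y \<in> carrier R" "ys \<in> tuples R m"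
        by (cases xs rule: rev_cases) (auto simp: tuples_def)
      have t: "ys @ [z] \<in> tuples R (Suc m)" if "z \<in> carrier R" for z
        using that y by (auto simp: tuples_def)
      have "x # ys \<in> tuples R (Suc m)" using x y by simp
      from ract_elt[OF _ y(2) this, of "l a"] show ?case using x y a t
        by (simp add: tcons ract_elt)
    next
      case (add C D)
      then show ?case using x a tcons(1) by (simp add: tcons(2) W.ract_add U.ract_add)
    qed
  next
    fix w P assume w: "w \<in> carrier (T (Suc (Suc m)))"
      and pr: "\<And>x u. x \<in> carrier R \<Longrightarrow> u \<in> carrier (T (Suc m)) \<Longrightarrow> P (tcons (Suc m) x u)"
      and add: "\<And>w w'. w \<in> carrier (T (Suc (Suc m))) \<Longrightarrow> w' \<in> carrier (T (Suc (Suc m))) \<Longrightarrow>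
        P w \<Longrightarrow> P w' \<Longrightarrow> P (w \<oplus>\<^bsub>T (Suc (Suc m))\<^esub> w')"
    show "P w" using w
    proof (induction rule: tensor_induct)
      case (elt xs)
      then obtain y ys where y: "xs = y # ys" "y \<in> carrier R" "ys \<in> tuples R (Suc m)" using tup by blast
      then show ?case using pr[OF y(2) elt_closed[OF y(3)]] by (simp add: tcons)
    qed (rule add)
  qed
qed

lemma factors_step:
  assumes G: "abelian_group G"
  shows "factors_middle_linear R l Q (RT m) (RT (Suc m)) (tcons (Suc m)) G"
  unfolding factors_middle_linear_def
proof (intro allI impI)
  fix \<beta> assume \<beta>: "middle_linear R l Q (RT m) G \<beta>"
  interpret G: abelian_group G by fact
  have \<beta>c: "\<beta> x u \<in> carrier G" if "x \<in> carrier R" "u \<in> carrier (T (Suc m))" for x u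
    using \<beta> that by (simp add: middle_linear_def)
  have \<beta>l: "\<beta> (x \<oplus>\<^bsub>R\<^esub> y) u = \<beta> x u \<oplus>\<^bsub>G\<^esub> \<beta> y u"
    if "x \<in> carrier R" "y \<in> carrier R" "u \<in> carrier (T (Suc m))" for x y u
    using \<beta> that by (simp add: middle_linear_def)
  have \<beta>r: "\<beta> x (u \<oplus>\<^bsub>T (Suc m)\<^esub> v) = \<beta> x u \<oplus>\<^bsub>G\<^esub> \<beta> x v"
    if "x \<in> carrier R" "u \<in> carrier (T (Suc m))" "v \<in> carrier (T (Suc m))" for x u v
    using \<beta> that by (simp add: middle_linear_def)
  have \<beta>b: "\<beta> (x \<otimes>\<^bsub>R\<^esub> h s) u = \<beta> x (h s \<odot>\<^bsub>T (Suc m)\<^esub> u)"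
    if x: "x \<in> carrier R" and s: "s \<in> carrier S" and u: "u \<in> carrier (T (Suc m))" for x s u
  proof -
    obtain q where "q \<in> Q" "l q = h s" using l_Q s by (metis imageE imageI)
    then show ?thesis using \<beta> x u unfolding middle_linear_def by (metis restrict_scalars_sel(1,4))
  qed
  define \<phi> where "\<phi> = (\<lambda>xs. \<beta> (hd xs) (elt (tl xs)))"
  obtain f where f: "\<And>C. C \<in> carrier (T (Suc (Suc m))) \<Longrightarrow> f C \<in> carrier G"
    "\<And>C D. C \<in> carrier (T (Suc (Suc m))) \<Longrightarrow> D \<in> carrier (T (Suc (Suc m))) \<Longrightarrow>
      f (C \<oplus>\<^bsub>T (Suc (Suc m))\<^esub> D) = f C \<oplus>\<^bsub>G\<^esub> f D"
    "\<And>xs. xs \<in> tuples R (Suc (Suc m)) \<Longrightarrow> f (elt xs) = \<phi> xs"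
  proof (rule tensor_lift[OF G, of "Suc (Suc m)" \<phi>])
    fix xs assume "xs \<in> tuples R (Suc (Suc m))"
    then obtain x ys where xs: "xs = x # ys" "x \<in> carrier R" "ys \<in> tuples R (Suc m)"
      by (cases xs) (auto simp: tuples_def)
    then show "\<phi> xs \<in> carrier G" using \<beta>c elt_closed by (simp add: \<phi>_def)
  next
    fix us x y vs assume *: "us @ x # vs \<in> tuples R (Suc (Suc m))" "us @ y # vs \<in> tuples R (Suc (Suc m))"
    show "\<phi> (us @ (x \<oplus>\<^bsub>R\<^esub> y) # vs) = \<phi> (us @ x # vs) \<oplus>\<^bsub>G\<^esub> \<phi> (us @ y # vs)"
    proof (cases us)
      case Nil
      then show ?thesis using * \<beta>l elt_closed by (simp add: \<phi>_def)
    next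
      case (Cons u us')
      then show ?thesis using * \<beta>r elt_closed elt_add[of us' x vs "Suc m" y] by (simp add: \<phi>_def)
    qed
  next
    fix us x s y vs assume *: "us @ x # y # vs \<in> tuples R (Suc (Suc m))" "s \<in> carrier S"
    show "\<phi> (us @ (x \<otimes>\<^bsub>R\<^esub> h s) # y # vs) = \<phi> (us @ x # (h s \<otimes>\<^bsub>R\<^esub> y) # vs)"
    proof (cases us)
      case Nil
      then show ?thesis using * \<beta>b elt_closed[of "y # vs" "Suc m"] lact_elt[of "h s" y vs m]
        by (simp add: \<phi>_def)
    next
      case (Cons u us')
      then show ?thesis using * elt_balanced[of us' x y vs "Suc m" s] by (simp add: \<phi>_def)
    qed
  qed blast
  have "f (tcons (Suc m) x u) = \<beta> x u" if x: "x \<in> carrier R" and u: "u \<in> carrier (T (Suc m))" for x u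
    using u
  proof (induction rule: tensor_induct)
    case (elt xs)
    then show ?case using x by (simp add: tcons f(3) \<phi>_def)
  next
    case (add C D)
    then show ?case using x by (simp add: tcons f(2) \<beta>r)
  qed
  then show "\<exists>f. (\<forall>w\<in>carrier (RT (Suc m)). f w \<in> carrier G) \<and>
      (\<forall>w\<in>carrier (RT (Suc m)). \<forall>w'\<in>carrier (RT (Suc m)).
        f (w \<oplus>\<^bsub>RT (Suc m)\<^esub> w') = f w \<oplus>\<^bsub>G\<^esub> f w') \<and>
      (\<forall>x\<in>carrier R. \<forall>u\<in>carrier (RT m). f (tcons (Suc m) x u) = \<beta> x u)"
    unfolding restrict_scalars_sel using f(1,2) by blast
qed

end


lemma regular_sel [simp]:
  "carrier (regular_bimodule P) = carrier P" "ring.add (regular_bimodule P) = ring.add P"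
  "smult (regular_bimodule P) = monoid.mult P" "rsmult (regular_bimodule P) = monoid.mult P"
  "ring.zero (regular_bimodule P) = ring.zero P"
  by (simp_all add: regular_bimodule_def)

context ring_extension
begin

lemma tuples_1: "xs \<in> tuples R (Suc 0) \<longleftrightarrow> (\<exists>x\<in>carrier R. xs = [x])"
  by (auto simp: tuples_def length_Suc_conv)

lemma elt_1_add: "x \<in> carrier R \<Longrightarrow> y \<in> carrier R \<Longrightarrow>
    elt [x \<oplus> y] = elt [x] \<oplus>\<^bsub>T (Suc 0)\<^esub> elt [y]"
  using elt_add_first[of x y "[]" 0] by (simp add: tuples_def)

lemma elt_1_closed: "x \<in> carrier R \<Longrightarrow> elt [x] \<in> carrier (T (Suc 0))"
  by (rule elt_closed) (simp add: tuples_1)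

lemma lact_elt_1: "r \<in> carrier R \<Longrightarrow> x \<in> carrier R \<Longrightarrow>
    r \<odot>\<^bsub>T (Suc 0)\<^esub> elt [x] = elt [r \<otimes> x]"
  using lact_elt[of r x "[]" 0] by (simp add: tuples_def)

lemma ract_elt_1: "r \<in> carrier R \<Longrightarrow> x \<in> carrier R \<Longrightarrow>
    elt [x] \<odot>\<^sub>r\<^bsub>T (Suc 0)\<^esub> r = elt [x \<otimes> r]"
  using ract_elt[of r x "[]" 0] by (simp add: tuples_def)

lemma T_1_lift:
  assumes G: "abelian_group G" and c: "\<And>x. x \<in> carrier R \<Longrightarrow> \<phi> x \<in> carrier G"
    and a: "\<And>x y. x \<in> carrier R \<Longrightarrow> y \<in> carrier R \<Longrightarrow> \<phi> (x \<oplus> y) = \<phi> x \<oplus>\<^bsub>G\<^esub> \<phi> y"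
  obtains f where "\<And>C. C \<in> carrier (T (Suc 0)) \<Longrightarrow> f C \<in> carrier G"
    "\<And>C D. C \<in> carrier (T (Suc 0)) \<Longrightarrow> D \<in> carrier (T (Suc 0)) \<Longrightarrow>
      f (C \<oplus>\<^bsub>T (Suc 0)\<^esub> D) = f C \<oplus>\<^bsub>G\<^esub> f D"
    "\<And>x. x \<in> carrier R \<Longrightarrow> f (elt [x]) = \<phi> x"
proof (rule tensor_lift[OF G, of "Suc 0" "\<lambda>xs. \<phi> (hd xs)"])
  show "\<phi> (hd xs) \<in> carrier G" if "xs \<in> tuples R (Suc 0)" for xs
    using that c by (auto simp: tuples_1)
  show "\<phi> (hd (us @ (x \<oplus> y) # vs)) = \<phi> (hd (us @ x # vs)) \<oplus>\<^bsub>G\<^esub> \<phi> (hd (us @ y # vs))"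
    if "us @ x # vs \<in> tuples R (Suc 0)" "us @ y # vs \<in> tuples R (Suc 0)" for us x y vs
    using that a by (auto simp: tuples_def)
  show "\<phi> (hd (us @ x \<otimes> h s # y # vs)) = \<phi> (hd (us @ x # h s \<otimes> y # vs))"
    if "us @ x # y # vs \<in> tuples R (Suc 0)" for us x s y vs
    using that by (simp add: tuples_def)
  fix f assume f: "\<And>C. C \<in> carrier (T (Suc 0)) \<Longrightarrow> f C \<in> carrier G"
    "\<And>C D. C \<in> carrier (T (Suc 0)) \<Longrightarrow> D \<in> carrier (T (Suc 0)) \<Longrightarrow>
      f (C \<oplus>\<^bsub>T (Suc 0)\<^esub> D) = f C \<oplus>\<^bsub>G\<^esub> f D"
    "\<And>xs. xs \<in> tuples R (Suc 0) \<Longrightarrow> f (elt xs) = \<phi> (hd xs)"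
  show thesis by (rule that[of f]) (use f in \<open>auto simp: tuples_1\<close>)
qed

text \<open>The universal property together with linearity on elementary tensors.\<close>

lemma tensor_bihom:
  assumes M: "biaction R R M"
    and closed: "\<And>xs. xs \<in> tuples R (Suc m) \<Longrightarrow> \<phi> xs \<in> carrier M"
    and add: "\<And>us x y vs. us @ x # vs \<in> tuples R (Suc m) \<Longrightarrow> us @ y # vs \<in> tuples R (Suc m) \<Longrightarrow>
      \<phi> (us @ (x \<oplus> y) # vs) = \<phi> (us @ x # vs) \<oplus>\<^bsub>M\<^esub> \<phi> (us @ y # vs)"
    and bal: "\<And>us x s y vs. us @ x # y # vs \<in> tuples R (Suc m) \<Longrightarrow> s \<in> carrier S \<Longrightarrow>
      \<phi> (us @ (x \<otimes> h s) # y # vs) = \<phi> (us @ x # (h s \<otimes> y) # vs)"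
    and left: "\<And>r x xs. r \<in> carrier R \<Longrightarrow> x \<in> carrier R \<Longrightarrow> xs \<in> tuples R m \<Longrightarrow>
      \<phi> ((r \<otimes> x) # xs) = r \<odot>\<^bsub>M\<^esub> \<phi> (x # xs)"
    and right: "\<And>r x xs. r \<in> carrier R \<Longrightarrow> x \<in> carrier R \<Longrightarrow> xs \<in> tuples R m \<Longrightarrow>
      \<phi> (xs @ [x \<otimes> r]) = \<phi> (xs @ [x]) \<odot>\<^sub>r\<^bsub>M\<^esub> r"
  obtains f where "f \<in> bihom R R (T (Suc m)) M" "\<And>xs. xs \<in> tuples R (Suc m) \<Longrightarrow> f (elt xs) = \<phi> xs"
proof -
  let ?T = "T (Suc m)"
  interpret T: biaction R R ?T by (rule T_biaction)
  interpret M: biaction R R M by fact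
  obtain f where f: "\<And>C. C \<in> carrier ?T \<Longrightarrow> f C \<in> carrier M"
    "\<And>C D. C \<in> carrier ?T \<Longrightarrow> D \<in> carrier ?T \<Longrightarrow> f (C \<oplus>\<^bsub>?T\<^esub> D) = f C \<oplus>\<^bsub>M\<^esub> f D"
    "\<And>xs. xs \<in> tuples R (Suc m) \<Longrightarrow> f (elt xs) = \<phi> xs"
    by (rule tensor_lift[OF M.abelian_group_axioms, of "Suc m" \<phi>]) (use closed add bal in blast)+
  have "restrict f (carrier ?T) \<in> bihom R R ?T M"
  proof (rule bihomI)
    fix r C assume r: "r \<in> carrier R" and C: "C \<in> carrier ?T"
    have "f (r \<odot>\<^bsub>?T\<^esub> C) = r \<odot>\<^bsub>M\<^esub> f C" using C
    proof (induction rule: tensor_induct)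
      case (elt xs)
      then obtain x ys where "xs = x # ys" "x \<in> carrier R" "ys \<in> tuples R m"
        by (cases xs) (auto simp: tuples_def)
      then show ?case using r by (simp add: lact_elt f(3) left)
    next
      case (add C D)
      then show ?case using r f by (simp add: T.lact_add M.lact_add)
    qed
    then show "restrict f (carrier ?T) (r \<odot>\<^bsub>?T\<^esub> C) = r \<odot>\<^bsub>M\<^esub> restrict f (carrier ?T) C"
      using r C by simp
  next
    fix r C assume C: "C \<in> carrier ?T" and r: "r \<in> carrier R"
    have "f (C \<odot>\<^sub>r\<^bsub>?T\<^esub> r) = f C \<odot>\<^sub>r\<^bsub>M\<^esub> r" using C
    proof (induction rule: tensor_induct)
      case (elt xs)
      then obtain x ys where xs: "xs = ys @ [x]" "x \<in> carrier R" "ys \<in> tuples R m"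
        by (cases xs rule: rev_cases) (auto simp: tuples_def)
      then have "ys @ [x \<otimes> r] \<in> tuples R (Suc m)" using r by (auto simp: tuples_def)
      then show ?case using xs r elt by (simp add: ract_elt f(3) right)
    next
      case (add C D)
      then show ?case using r f by (simp add: T.ract_add M.ract_add)
    qed
    then show "restrict f (carrier ?T) (C \<odot>\<^sub>r\<^bsub>?T\<^esub> r) = restrict f (carrier ?T) C \<odot>\<^sub>r\<^bsub>M\<^esub> r"
      using r C by simp
  qed (use f in auto)
  then show ?thesis by (rule that) (simp add: f(3) elt_closed)
qed

lemma regular_bimodule_RR: "ring_bimodule R R (regular_bimodule R)"
  using R.regular_ring_bimodule[OF R.carrier_is_subring R.carrier_is_subring] by simp

lemma T_1_regular:
  "summand_of_power R R (T (Suc 0)) (regular_bimodule R)"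
  "summand_of_power R R (regular_bimodule R) (T (Suc 0))"
proof -
  interpret T: biaction R R "T (Suc 0)" by (rule T_biaction)
  interpret M: ring_bimodule R R "regular_bimodule R" by (rule regular_bimodule_RR)
  obtain j where j: "j \<in> bihom R R (T (Suc 0)) (regular_bimodule R)"
    "\<And>xs. xs \<in> tuples R (Suc 0) \<Longrightarrow> j (elt xs) = hd xs"
  proof (rule tensor_bihom[OF M.biaction_axioms, of 0 hd])
    show "hd xs \<in> carrier (regular_bimodule R)" if "xs \<in> tuples R (Suc 0)" for xs
      using that by (auto simp: tuples_1)
  qed (auto simp: tuples_def)
  have je: "j (elt [x]) = x" if "x \<in> carrier R" for x using that j(2)[of "[x]"] by (simp add: tuples_1)
  have all: "\<exists>x\<in>carrier R. C = elt [x]" if "C \<in> carrier (T (Suc 0))" for C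
    using that
  proof (induction rule: tensor_induct)
    case (elt xs)
    then show ?case by (auto simp: tuples_1)
  next
    case (add C D)
    then show ?case using elt_1_add by (metis R.a_closed)
  qed
  define i where "i = (\<lambda>x\<in>carrier R. elt [x])"
  have i: "i \<in> bihom R R (regular_bimodule R) (T (Suc 0))"
    by (rule bihomI)
      (auto simp: i_def regular_bimodule_def elt_1_add elt_1_closed lact_elt_1 ract_elt_1)
  have "i (j C) = C" if "C \<in> carrier (T (Suc 0))" for C
    using all[OF that] by (auto simp: i_def je)
  then show "summand_of_power R R (T (Suc 0)) (regular_bimodule R)"
    by (rule summand_of_powerI_retract[OF T.biaction_axioms j(1) i])
  have "j (i x) = x" if "x \<in> carrier (regular_bimodule R)" for x
    using that by (simp add: i_def je)
  then show "summand_of_power R R (regular_bimodule R) (T (Suc 0))"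
    by (rule summand_of_powerI_retract[OF M.biaction_axioms i j(1)])
qed

text \<open>The isomorphism \<open>R \<otimes>\<^sub>S S = R\<close>, with \<open>R\<close> in the guise of the tensor power with one factor.\<close>

lemma tensor_over_base:
  "tensor_over S R h (carrier S) (regular_bimodule S) (restrict_scalars h h (T (Suc 0)))
     (\<lambda>x a. elt [x \<otimes> h a])"
proof -
  have SS: "ring_bimodule S S (regular_bimodule S)"
    using S.regular_ring_bimodule[OF S.carrier_is_subring S.carrier_is_subring] by simp
  have TS: "ring_bimodule S S (restrict_scalars h h (T (Suc 0)))"
    by (rule restrict_scalars_bimodule[OF T_ring_bimodule S.ring_axioms S.ring_axioms h_hom h_hom])
  note hh = ring_hom_add[OF h_hom] ring_hom_mult[OF h_hom] ring_hom_one[OF h_hom]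
  show ?thesis
  proof (rule tensor_over.intro[OF S.ring_axioms R.ring_axioms SS ring_bimodule.axioms(3)[OF TS]],
      unfold_locales, unfold restrict_scalars_sel regular_sel)
    fix w P assume w: "w \<in> carrier (T (Suc 0))"
      and pr: "\<And>x u. x \<in> carrier R \<Longrightarrow> u \<in> carrier S \<Longrightarrow> P (elt [x \<otimes> h u])"
      and add: "\<And>w w'. w \<in> carrier (T (Suc 0)) \<Longrightarrow> w' \<in> carrier (T (Suc 0)) \<Longrightarrow>
        P w \<Longrightarrow> P w' \<Longrightarrow> P (w \<oplus>\<^bsub>T (Suc 0)\<^esub> w')"
    show "P w" using w
    proof (induction rule: tensor_induct)
      case (elt xs)
      then show ?case using pr[of _ "\<one>\<^bsub>S\<^esub>"] hh by (auto simp: tuples_1)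
    qed (rule add)
  qed (simp_all add: h_hom hh R.l_distr R.r_distr R.m_assoc elt_1_add elt_1_closed lact_elt_1 ract_elt_1)
qed

lemma factors_base:
  assumes G: "abelian_group G"
  shows "factors_middle_linear R h (carrier S) (regular_bimodule S)
    (restrict_scalars h h (T (Suc 0))) (\<lambda>x a. elt [x \<otimes> h a]) G"
  unfolding factors_middle_linear_def
proof (intro allI impI)
  fix \<beta> assume \<beta>: "middle_linear R h (carrier S) (regular_bimodule S) G \<beta>"
  obtain f where f: "\<And>C. C \<in> carrier (T (Suc 0)) \<Longrightarrow> f C \<in> carrier G"
    "\<And>C D. C \<in> carrier (T (Suc 0)) \<Longrightarrow> D \<in> carrier (T (Suc 0)) \<Longrightarrow>
      f (C \<oplus>\<^bsub>T (Suc 0)\<^esub> D) = f C \<oplus>\<^bsub>G\<^esub> f D"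
    "\<And>x. x \<in> carrier R \<Longrightarrow> f (elt [x]) = \<beta> x \<one>\<^bsub>S\<^esub>"
    by (rule T_1_lift[OF G, of "\<lambda>x. \<beta> x \<one>\<^bsub>S\<^esub>"]) (use \<beta> in \<open>auto simp: middle_linear_def\<close>)
  have "f (elt [x \<otimes> h u]) = \<beta> x u" if "x \<in> carrier R" "u \<in> carrier S" for x u
    using that \<beta> by (simp add: f(3) middle_linear_def)
  then show "\<exists>f. (\<forall>w\<in>carrier (restrict_scalars h h (T (Suc 0))). f w \<in> carrier G) \<and>
      (\<forall>w\<in>carrier (restrict_scalars h h (T (Suc 0))). \<forall>w'\<in>carrier (restrict_scalars h h (T (Suc 0))).
        f (w \<oplus>\<^bsub>restrict_scalars h h (T (Suc 0))\<^esub> w') = f w \<oplus>\<^bsub>G\<^esub> f w') \<and>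
      (\<forall>x\<in>carrier R. \<forall>u\<in>carrier (regular_bimodule S). f (elt [x \<otimes> h u]) = \<beta> x u)"
    unfolding restrict_scalars_sel regular_sel using f(1,2) by blast
qed

lemma merge_map:
  obtains f where "f \<in> bihom R R (T (Suc (Suc k))) (T (Suc k))"
    "\<And>x y zs. x \<in> carrier R \<Longrightarrow> y \<in> carrier R \<Longrightarrow> zs \<in> tuples R k \<Longrightarrow>
      f (elt (x # y # zs)) = elt ((x \<otimes> y) # zs)"
proof -
  define \<phi> where "\<phi> = (\<lambda>xs. elt ((hd xs \<otimes> hd (tl xs)) # tl (tl xs)))"
  have \<phi>: "\<phi> (x # y # zs) = elt ((x \<otimes> y) # zs)" for x y zs by (simp add: \<phi>_def)
  obtain f where f: "f \<in> bihom R R (T (Suc (Suc k))) (T (Suc k))"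
    "\<And>xs. xs \<in> tuples R (Suc (Suc k)) \<Longrightarrow> f (elt xs) = \<phi> xs"
  proof (rule tensor_bihom[OF T_biaction, of "Suc k" \<phi> k])
    fix xs assume "xs \<in> tuples R (Suc (Suc k))"
    then show "\<phi> xs \<in> carrier (T (Suc k))"
      by (cases xs; cases "tl xs") (auto simp: \<phi> tuples_def intro!: elt_closed)
  next
    fix us x y vs assume *: "us @ x # vs \<in> tuples R (Suc (Suc k))" "us @ y # vs \<in> tuples R (Suc (Suc k))"
    show "\<phi> (us @ (x \<oplus> y) # vs) = \<phi> (us @ x # vs) \<oplus>\<^bsub>T (Suc k)\<^esub> \<phi> (us @ y # vs)"
    proof (cases us)
      case Nil
      obtain v vs' where "vs = v # vs'" using * Nil by (cases vs) (auto simp: tuples_def)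
      then show ?thesis using * Nil by (simp add: \<phi> R.l_distr elt_add_first)
    next
      case (Cons u us')
      show ?thesis
      proof (cases us')
        case Nil
        then show ?thesis using * Cons by (simp add: \<phi> R.r_distr elt_add_first)
      next
        case (Cons u' us'')
        then show ?thesis
          using * \<open>us = u # us'\<close> elt_add[of "(u \<otimes> u') # us''" x vs "Suc k" y] by (simp add: \<phi>)
      qed
    qed
  next
    fix us x s y vs assume *: "us @ x # y # vs \<in> tuples R (Suc (Suc k))" "s \<in> carrier S"
    show "\<phi> (us @ (x \<otimes> h s) # y # vs) = \<phi> (us @ x # (h s \<otimes> y) # vs)"
    proof (cases us)
      case Nil
      then show ?thesis using * by (simp add: \<phi> R.m_assoc)
    next
      case (Cons u us')
      show ?thesis
      proof (cases us')
        case Nil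
        then show ?thesis
          using * Cons elt_balanced[of "[]" "u \<otimes> x" y vs "Suc k" s]
          by (auto simp: \<phi> R.m_assoc tuples_def)
      next
        case (Cons u' us'')
        then show ?thesis
          using * \<open>us = u # us'\<close> elt_balanced[of "(u \<otimes> u') # us''" x y vs "Suc k" s]
          by (simp add: \<phi>)
      qed
    qed
  next
    fix r x xs assume r: "r \<in> carrier R" and x: "x \<in> carrier R" and xs: "xs \<in> tuples R (Suc k)"
    obtain y ys where y: "xs = y # ys" "y \<in> carrier R" "ys \<in> tuples R k"
      using xs by (cases xs) (auto simp: tuples_def)
    then show "\<phi> ((r \<otimes> x) # xs) = r \<odot>\<^bsub>T (Suc k)\<^esub> \<phi> (x # xs)"
      using r x by (simp add: \<phi> lact_elt R.m_assoc)
    show "\<phi> (xs @ [x \<otimes> r]) = \<phi> (xs @ [x]) \<odot>\<^sub>r\<^bsub>T (Suc k)\<^esub> r"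
    proof (cases ys)
      case Nil
      then show ?thesis using y r x ract_elt[of r "y \<otimes> x" "[]" k] by (simp add: \<phi> R.m_assoc)
    next
      case (Cons z zs)
      then have "(y \<otimes> z) # zs \<in> tuples R k" using y by (auto simp: tuples_def)
      then show ?thesis using y r x Cons ract_elt[of r x "(y \<otimes> z) # zs" k] by (simp add: \<phi>)
    qed
  qed blast
  show ?thesis by (rule that[OF f(1)]) (simp add: f(2) \<phi>)
qed

lemma insert_one_map:
  obtains f where "f \<in> bihom R R (T (Suc (Suc k))) (T (Suc (Suc (Suc k))))"
    "\<And>x ys. x \<in> carrier R \<Longrightarrow> ys \<in> tuples R (Suc k) \<Longrightarrow> f (elt (x # ys)) = elt (x # \<one> # ys)"
proof -
  define \<phi> where "\<phi> = (\<lambda>xs. elt (hd xs # \<one> # tl xs))"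
  obtain f where f: "f \<in> bihom R R (T (Suc (Suc k))) (T (Suc (Suc (Suc k))))"
    "\<And>xs. xs \<in> tuples R (Suc (Suc k)) \<Longrightarrow> f (elt xs) = \<phi> xs"
  proof (rule tensor_bihom[OF T_biaction, of "Suc k" \<phi> "Suc (Suc k)"])
    fix xs assume "xs \<in> tuples R (Suc (Suc k))"
    then show "\<phi> xs \<in> carrier (T (Suc (Suc (Suc k))))"
      by (cases xs) (auto simp: \<phi>_def tuples_def intro!: elt_closed)
  next
    fix us x y vs assume *: "us @ x # vs \<in> tuples R (Suc (Suc k))" "us @ y # vs \<in> tuples R (Suc (Suc k))"
    show "\<phi> (us @ (x \<oplus> y) # vs) = \<phi> (us @ x # vs) \<oplus>\<^bsub>T (Suc (Suc (Suc k)))\<^esub> \<phi> (us @ y # vs)"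
    proof (cases us)
      case Nil
      then show ?thesis using * by (simp add: \<phi>_def elt_add_first)
    next
      case (Cons u us')
      then show ?thesis
        using * elt_add[of "u # \<one> # us'" x vs "Suc (Suc (Suc k))" y] by (simp add: \<phi>_def)
    qed
  next
    fix us x s y vs assume *: "us @ x # y # vs \<in> tuples R (Suc (Suc k))" "s \<in> carrier S"
    show "\<phi> (us @ (x \<otimes> h s) # y # vs) = \<phi> (us @ x # (h s \<otimes> y) # vs)"
    proof (cases us)
      case Nil
      then show ?thesis
        using * elt_balanced[of "[]" x "\<one>" "y # vs" "Suc (Suc (Suc k))" s]
          elt_balanced[of "[x]" "\<one>" y vs "Suc (Suc (Suc k))" s]
        by (auto simp: \<phi>_def tuples_def)
    next
      case (Cons u us')
      then show ?thesis
        using * elt_balanced[of "u # \<one> # us'" x y vs "Suc (Suc (Suc k))" s] by (simp add: \<phi>_def)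
    qed
  next
    fix r x xs assume r: "r \<in> carrier R" and x: "x \<in> carrier R" and xs: "xs \<in> tuples R (Suc k)"
    then show "\<phi> ((r \<otimes> x) # xs) = r \<odot>\<^bsub>T (Suc (Suc (Suc k)))\<^esub> \<phi> (x # xs)"
      by (simp add: \<phi>_def lact_elt)
    obtain y ys where y: "xs = y # ys" "y \<in> carrier R" "ys \<in> tuples R k"
      using xs by (cases xs) (auto simp: tuples_def)
    then show "\<phi> (xs @ [x \<otimes> r]) = \<phi> (xs @ [x]) \<odot>\<^sub>r\<^bsub>T (Suc (Suc (Suc k)))\<^esub> r"
      using r x ract_elt[of r x "y # \<one> # ys" "Suc (Suc k)"] by (simp add: \<phi>_def)
  qed blast
  show ?thesis by (rule that[OF f(1)]) (simp add: f(2) \<phi>_def)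
qed

text \<open>The insertion of \<open>1\<close> between the first two factors is split by multiplying them together.
  With a single factor the insertion would be \<open>x \<mapsto> x \<otimes> 1\<close>, which is only left linear.\<close>

lemma T_summand_T_Suc: "summand_of_power R R (T (Suc (Suc k))) (T (Suc (Suc (Suc k))))"
proof -
  obtain i where i: "i \<in> bihom R R (T (Suc (Suc k))) (T (Suc (Suc (Suc k))))"
    "\<And>x ys. x \<in> carrier R \<Longrightarrow> ys \<in> tuples R (Suc k) \<Longrightarrow> i (elt (x # ys)) = elt (x # \<one> # ys)"
    using insert_one_map[of k] by metis
  obtain j where j: "j \<in> bihom R R (T (Suc (Suc (Suc k)))) (T (Suc (Suc k)))"
    "\<And>x y zs. x \<in> carrier R \<Longrightarrow> y \<in> carrier R \<Longrightarrow> zs \<in> tuples R (Suc k) \<Longrightarrow>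
      j (elt (x # y # zs)) = elt ((x \<otimes> y) # zs)"
    using merge_map[of "Suc k"] by metis
  note id = bihomD[OF i(1)] and jd = bihomD[OF j(1)]
  have "j (i C) = C" if "C \<in> carrier (T (Suc (Suc k)))" for C
    using that
  proof (induction rule: tensor_induct)
    case (elt xs)
    then obtain x ys where "xs = x # ys" "x \<in> carrier R" "ys \<in> tuples R (Suc k)"
      by (cases xs) (auto simp: tuples_def)
    then show ?case by (simp add: i(2) j(2))
  next
    case (add C D)
    then show ?case using id jd by simp
  qed
  then show ?thesis
    by (rule summand_of_powerI_retract[OF T_biaction i(1) j(1)])
qed

end


section \<open>The endomorphism ring and the dual\<close>

lemma biaction_as_right_module:
  assumes "biaction R S M" shows "biaction \<Z> S (as_right_module M)"
proof -
  interpret biaction R S M by fact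
  have sel: "carrier (as_right_module M) = carrier M" "ring.add (as_right_module M) = ring.add M"
    "\<zero>\<^bsub>as_right_module M\<^esub> = \<zero>\<^bsub>M\<^esub>" "rsmult (as_right_module M) = rsmult M"
    "k \<odot>\<^bsub>as_right_module M\<^esub> x = [k] \<cdot>\<^bsub>M\<^esub> x" for k x
    by (auto simp: as_right_module_def)
  have "abelian_group (as_right_module M)"
  proof (rule abelian_groupI)
    fix x assume "x \<in> carrier (as_right_module M)"
    then show "\<exists>y\<in>carrier (as_right_module M). y \<oplus>\<^bsub>as_right_module M\<^esub> x = \<zero>\<^bsub>as_right_module M\<^esub>"
      by (intro bexI[of _ "\<ominus>\<^bsub>M\<^esub> x"]) (auto simp: sel l_neg)
  qed (auto simp: sel a_ac)
  then show ?thesis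
    by (rule biaction.intro, unfold_locales)
      (simp_all add: sel ract_add add.int_pow_closed add.int_pow_distrib)
qed

locale subring_pair = A: ring A for A :: "('a, 'x) ring_scheme" (structure) +
  fixes B :: "'a set"
  assumes subring: "subring B A"
begin

abbreviation B' where "B' \<equiv> A\<lparr>carrier := B\<rparr>"
abbreviation E where "E \<equiv> End_right B' (regular_bimodule A)"
abbreviation D where "D \<equiv> Hom_right B' (regular_bimodule A) (regular_bimodule B')"

lemma B_sub: "B \<subseteq> carrier A" using subring by (rule subringE(1))

lemma B_closed [simp]: "b \<in> B \<Longrightarrow> b \<in> carrier A" using B_sub by blast

lemma ring_B': "ring B'" by (rule A.subring_is_ring[OF subring])

lemma B_ops [simp]: "b \<in> B \<Longrightarrow> c \<in> B \<Longrightarrow> b \<oplus> c \<in> B" "b \<in> B \<Longrightarrow> c \<in> B \<Longrightarrow> b \<otimes> c \<in> B"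
  "b \<in> B \<Longrightarrow> \<ominus> b \<in> B" "\<zero> \<in> B" "\<one> \<in> B"
  using subringE[OF subring] by auto

lemma AA: "ring_bimodule A A (regular_bimodule A)"
  using A.regular_ring_bimodule[OF A.carrier_is_subring A.carrier_is_subring] by simp

lemma BA: "ring_bimodule B' A (regular_bimodule A)"
  using A.regular_ring_bimodule[OF subring A.carrier_is_subring] by simp

lemma E_carrier: "f \<in> carrier E \<longleftrightarrow> f \<in> carrier A \<rightarrow>\<^sub>E carrier A \<and>
    (\<forall>x\<in>carrier A. \<forall>y\<in>carrier A. f (x \<oplus> y) = f x \<oplus> f y) \<and>
    (\<forall>x\<in>carrier A. \<forall>b\<in>B. f (x \<otimes> b) = f x \<otimes> b)"
  by (auto simp: End_right_def right_hom_def additive_hom_def regular_bimodule_def)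

lemma E_memI:
  assumes "f \<in> extensional (carrier A)" "\<And>x. x \<in> carrier A \<Longrightarrow> f x \<in> carrier A"
    and "\<And>x y. x \<in> carrier A \<Longrightarrow> y \<in> carrier A \<Longrightarrow> f (x \<oplus> y) = f x \<oplus> f y"
    and "\<And>x b. x \<in> carrier A \<Longrightarrow> b \<in> B \<Longrightarrow> f (x \<otimes> b) = f x \<otimes> b"
  shows "f \<in> carrier E"
  using assms by (simp add: E_carrier PiE_iff)

lemma E_sel: "x \<otimes>\<^bsub>E\<^esub> y = compose (carrier A) x y" "\<one>\<^bsub>E\<^esub> = (\<lambda>x\<in>carrier A. x)"
  "\<zero>\<^bsub>E\<^esub> = (\<lambda>x\<in>carrier A. \<zero>)" "x \<oplus>\<^bsub>E\<^esub> y = (\<lambda>a\<in>carrier A. x a \<oplus> y a)"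
  by (auto simp: End_right_def regular_bimodule_def)

lemma E_app [simp]: "e \<in> carrier E \<Longrightarrow> x \<in> carrier A \<Longrightarrow> e x \<in> carrier A"
  "e \<in> carrier E \<Longrightarrow> x \<in> carrier A \<Longrightarrow> y \<in> carrier A \<Longrightarrow> e (x \<oplus> y) = e x \<oplus> e y"
  "e \<in> carrier E \<Longrightarrow> x \<in> carrier A \<Longrightarrow> b \<in> B \<Longrightarrow> e (x \<otimes> b) = e x \<otimes> b"
  by (auto simp: E_carrier)

lemma E_extensional: "f \<in> carrier E \<Longrightarrow> f \<in> extensional (carrier A)"
  by (simp only: E_carrier PiE_iff)

lemma E_ext: "e \<in> carrier E \<Longrightarrow> e' \<in> carrier E \<Longrightarrow> (\<And>x. x \<in> carrier A \<Longrightarrow> e x = e' x) \<Longrightarrow> e = e'"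
  by (rule extensionalityI[OF E_extensional E_extensional])

lemma E_closed:
  "e \<in> carrier E \<Longrightarrow> e' \<in> carrier E \<Longrightarrow> e \<oplus>\<^bsub>E\<^esub> e' \<in> carrier E"
  "e \<in> carrier E \<Longrightarrow> e' \<in> carrier E \<Longrightarrow> e \<otimes>\<^bsub>E\<^esub> e' \<in> carrier E"
  "\<zero>\<^bsub>E\<^esub> \<in> carrier E" "\<one>\<^bsub>E\<^esub> \<in> carrier E"
  unfolding E_sel
  by (rule E_memI; simp add: compose_def A.a_ac A.l_distr)+

lemma ring_E: "ring E"
proof (rule ringI)
  show "abelian_group E"
  proof (rule abelian_groupI)
    fix e assume e: "e \<in> carrier E"
    have "(\<lambda>x\<in>carrier A. \<ominus> e x) \<in> carrier E"
      using e by (intro E_memI) (simp_all add: A.minus_add A.l_minus)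
    moreover have "(\<lambda>x\<in>carrier A. \<ominus> e x) \<oplus>\<^bsub>E\<^esub> e = \<zero>\<^bsub>E\<^esub>"
      using e by (auto simp: E_sel A.l_neg intro!: restrict_ext)
    ultimately show "\<exists>y\<in>carrier E. y \<oplus>\<^bsub>E\<^esub> e = \<zero>\<^bsub>E\<^esub>" by blast
  next
    fix x y z assume "x \<in> carrier E" "y \<in> carrier E" "z \<in> carrier E"
    then show "x \<oplus>\<^bsub>E\<^esub> y \<oplus>\<^bsub>E\<^esub> z = x \<oplus>\<^bsub>E\<^esub> (y \<oplus>\<^bsub>E\<^esub> z)"
      by (intro E_ext E_closed) (auto simp: E_sel A.a_assoc)
  next
    fix x y assume "x \<in> carrier E" "y \<in> carrier E"
    then show "x \<oplus>\<^bsub>E\<^esub> y = y \<oplus>\<^bsub>E\<^esub> x"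
      by (intro E_ext E_closed) (auto simp: E_sel A.a_comm)
  next
    fix x assume "x \<in> carrier E"
    then show "\<zero>\<^bsub>E\<^esub> \<oplus>\<^bsub>E\<^esub> x = x" by (intro E_ext E_closed) (auto simp: E_sel)
  qed (rule E_closed; assumption)+
  show "monoid E"
  proof (rule monoidI)
    fix x y z assume "x \<in> carrier E" "y \<in> carrier E" "z \<in> carrier E"
    then show "x \<otimes>\<^bsub>E\<^esub> y \<otimes>\<^bsub>E\<^esub> z = x \<otimes>\<^bsub>E\<^esub> (y \<otimes>\<^bsub>E\<^esub> z)"
      by (intro E_ext E_closed) (auto simp: E_sel compose_def)
  next
    fix x assume "x \<in> carrier E"
    then show "\<one>\<^bsub>E\<^esub> \<otimes>\<^bsub>E\<^esub> x = x" "x \<otimes>\<^bsub>E\<^esub> \<one>\<^bsub>E\<^esub> = x"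
      by (intro E_ext E_closed; auto simp: E_sel compose_def)+
  qed (auto intro: E_closed)
  fix x y z assume "x \<in> carrier E" "y \<in> carrier E" "z \<in> carrier E"
  then show "(x \<oplus>\<^bsub>E\<^esub> y) \<otimes>\<^bsub>E\<^esub> z = x \<otimes>\<^bsub>E\<^esub> z \<oplus>\<^bsub>E\<^esub> y \<otimes>\<^bsub>E\<^esub> z"
    "z \<otimes>\<^bsub>E\<^esub> (x \<oplus>\<^bsub>E\<^esub> y) = z \<otimes>\<^bsub>E\<^esub> x \<oplus>\<^bsub>E\<^esub> z \<otimes>\<^bsub>E\<^esub> y"
    by (intro E_ext E_closed; auto simp: E_sel compose_def)+
qed

abbreviation lm where "lm \<equiv> left_multiplication A"

lemma lm_app [simp]: "x \<in> carrier A \<Longrightarrow> lm a x = a \<otimes> x"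
  by (simp add: left_multiplication_def)

lemma lm_hom: "lm \<in> ring_hom A E"
proof (rule ring_hom_memI)
  have c: "lm a \<in> carrier E" if "a \<in> carrier A" for a
    using that by (intro E_memI) (simp_all add: A.r_distr A.m_assoc, simp add: left_multiplication_def)
  fix a b assume ab: "a \<in> carrier A" "b \<in> carrier A"
  show "lm a \<in> carrier E" using c ab by simp
  show "lm (a \<otimes> b) = lm a \<otimes>\<^bsub>E\<^esub> lm b" "lm (a \<oplus> b) = lm a \<oplus>\<^bsub>E\<^esub> lm b"
    using ab by (auto simp: E_sel left_multiplication_def compose_def A.m_assoc A.l_distr intro!: restrict_ext)
next
  show "lm \<one> = \<one>\<^bsub>E\<^esub>" by (auto simp: E_sel left_multiplication_def intro!: restrict_ext)
qed

lemma D_carrier: "f \<in> carrier D \<longleftrightarrow> f \<in> carrier A \<rightarrow>\<^sub>E B \<and>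
    (\<forall>x\<in>carrier A. \<forall>y\<in>carrier A. f (x \<oplus> y) = f x \<oplus> f y) \<and>
    (\<forall>x\<in>carrier A. \<forall>b\<in>B. f (x \<otimes> b) = f x \<otimes> b)"
  by (auto simp: Hom_right_def right_hom_def additive_hom_def regular_bimodule_def)

lemma D_memI:
  assumes "f \<in> extensional (carrier A)" "\<And>x. x \<in> carrier A \<Longrightarrow> f x \<in> B"
    and "\<And>x y. x \<in> carrier A \<Longrightarrow> y \<in> carrier A \<Longrightarrow> f (x \<oplus> y) = f x \<oplus> f y"
    and "\<And>x b. x \<in> carrier A \<Longrightarrow> b \<in> B \<Longrightarrow> f (x \<otimes> b) = f x \<otimes> b"
  shows "f \<in> carrier D"
  using assms by (simp add: D_carrier PiE_iff)

lemma D_sel: "\<zero>\<^bsub>D\<^esub> = (\<lambda>x\<in>carrier A. \<zero>)" "f \<oplus>\<^bsub>D\<^esub> g = (\<lambda>x\<in>carrier A. f x \<oplus> g x)"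
  "b \<odot>\<^bsub>D\<^esub> f = (\<lambda>x\<in>carrier A. b \<otimes> f x)" "f \<odot>\<^sub>r\<^bsub>D\<^esub> a = (\<lambda>x\<in>carrier A. f (a \<otimes> x))"
  by (auto simp: Hom_right_def regular_bimodule_def)

lemma D_app [simp]: "f \<in> carrier D \<Longrightarrow> x \<in> carrier A \<Longrightarrow> f x \<in> B"
  "f \<in> carrier D \<Longrightarrow> x \<in> carrier A \<Longrightarrow> y \<in> carrier A \<Longrightarrow> f (x \<oplus> y) = f x \<oplus> f y"
  "f \<in> carrier D \<Longrightarrow> x \<in> carrier A \<Longrightarrow> b \<in> B \<Longrightarrow> f (x \<otimes> b) = f x \<otimes> b"
  by (auto simp: D_carrier)

lemma D_extensional: "f \<in> carrier D \<Longrightarrow> f \<in> extensional (carrier A)"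
  by (simp only: D_carrier PiE_iff)

lemma D_ext: "f \<in> carrier D \<Longrightarrow> g \<in> carrier D \<Longrightarrow> (\<And>x. x \<in> carrier A \<Longrightarrow> f x = g x) \<Longrightarrow> f = g"
  by (rule extensionalityI[OF D_extensional D_extensional])

lemma D_closed:
  "f \<in> carrier D \<Longrightarrow> g \<in> carrier D \<Longrightarrow> f \<oplus>\<^bsub>D\<^esub> g \<in> carrier D" "\<zero>\<^bsub>D\<^esub> \<in> carrier D"
  "b \<in> B \<Longrightarrow> f \<in> carrier D \<Longrightarrow> b \<odot>\<^bsub>D\<^esub> f \<in> carrier D"
  "a \<in> carrier A \<Longrightarrow> f \<in> carrier D \<Longrightarrow> f \<odot>\<^sub>r\<^bsub>D\<^esub> a \<in> carrier D"
  unfolding D_sel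
  by (rule D_memI; simp add: A.a_ac A.l_distr A.r_distr flip: A.m_assoc)+

lemma D_biaction: "biaction B' A D"
proof (rule biaction.intro)
  show "abelian_group D"
  proof (rule abelian_groupI)
    fix e assume e: "e \<in> carrier D"
    have "(\<lambda>x\<in>carrier A. \<ominus> e x) \<in> carrier D"
      using e by (intro D_memI) (simp_all add: A.minus_add A.l_minus)
    moreover have "(\<lambda>x\<in>carrier A. \<ominus> e x) \<oplus>\<^bsub>D\<^esub> e = \<zero>\<^bsub>D\<^esub>"
      using e by (auto simp: D_sel A.l_neg intro!: restrict_ext)
    ultimately show "\<exists>y\<in>carrier D. y \<oplus>\<^bsub>D\<^esub> e = \<zero>\<^bsub>D\<^esub>" by blast
  next
    fix x y z assume "x \<in> carrier D" "y \<in> carrier D" "z \<in> carrier D"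
    then show "x \<oplus>\<^bsub>D\<^esub> y \<oplus>\<^bsub>D\<^esub> z = x \<oplus>\<^bsub>D\<^esub> (y \<oplus>\<^bsub>D\<^esub> z)"
      by (intro D_ext D_closed) (auto simp: D_sel A.a_assoc)
  next
    fix x y assume "x \<in> carrier D" "y \<in> carrier D"
    then show "x \<oplus>\<^bsub>D\<^esub> y = y \<oplus>\<^bsub>D\<^esub> x"
      by (intro D_ext D_closed) (auto simp: D_sel A.a_comm)
  next
    fix x assume "x \<in> carrier D"
    then show "\<zero>\<^bsub>D\<^esub> \<oplus>\<^bsub>D\<^esub> x = x" by (intro D_ext D_closed) (auto simp: D_sel)
  qed (rule D_closed; assumption)+
  show "biaction_axioms B' A D"
  proof
    fix r x y assume r: "r \<in> carrier B'" and x: "x \<in> carrier D"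
    show "r \<odot>\<^bsub>D\<^esub> x \<in> carrier D" using r x by (simp add: D_closed)
    assume y: "y \<in> carrier D"
    show "r \<odot>\<^bsub>D\<^esub> (x \<oplus>\<^bsub>D\<^esub> y) = r \<odot>\<^bsub>D\<^esub> x \<oplus>\<^bsub>D\<^esub> r \<odot>\<^bsub>D\<^esub> y"
      using r x y by (intro D_ext D_closed) (auto simp: D_sel A.r_distr)
  next
    fix s x assume s: "s \<in> carrier A" and x: "x \<in> carrier D"
    show "x \<odot>\<^sub>r\<^bsub>D\<^esub> s \<in> carrier D" using s x by (simp add: D_closed)
    fix y assume y: "y \<in> carrier D"
    show "(x \<oplus>\<^bsub>D\<^esub> y) \<odot>\<^sub>r\<^bsub>D\<^esub> s = x \<odot>\<^sub>r\<^bsub>D\<^esub> s \<oplus>\<^bsub>D\<^esub> y \<odot>\<^sub>r\<^bsub>D\<^esub> s"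
      using s x y by (intro D_ext D_closed) (auto simp: D_sel)
  qed
qed

text \<open>The image of \<open>x \<otimes> \<phi>\<close> under \<open>A \<otimes>\<^sub>B D \<rightarrow> E\<close>.\<close>

definition dyad :: "'a \<Rightarrow> ('a \<Rightarrow> 'a) \<Rightarrow> 'a \<Rightarrow> 'a" where
  "dyad x \<phi> = (\<lambda>a\<in>carrier A. x \<otimes> \<phi> a)"

lemma dyad_closed [simp]: "x \<in> carrier A \<Longrightarrow> \<phi> \<in> carrier D \<Longrightarrow> dyad x \<phi> \<in> carrier E"
  unfolding dyad_def by (intro E_memI) (simp_all add: A.r_distr A.m_assoc)

lemma dyad_add_left: "x \<in> carrier A \<Longrightarrow> y \<in> carrier A \<Longrightarrow> \<phi> \<in> carrier D \<Longrightarrow>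
    dyad (x \<oplus> y) \<phi> = dyad x \<phi> \<oplus>\<^bsub>E\<^esub> dyad y \<phi>"
  by (auto simp: dyad_def E_sel A.l_distr intro!: restrict_ext)

lemma dyad_add_right: "x \<in> carrier A \<Longrightarrow> \<phi> \<in> carrier D \<Longrightarrow> \<psi> \<in> carrier D \<Longrightarrow>
    dyad x (\<phi> \<oplus>\<^bsub>D\<^esub> \<psi>) = dyad x \<phi> \<oplus>\<^bsub>E\<^esub> dyad x \<psi>"
  by (auto simp: dyad_def E_sel D_sel A.r_distr intro!: restrict_ext)

lemma dyad_balanced: "x \<in> carrier A \<Longrightarrow> b \<in> B \<Longrightarrow> \<phi> \<in> carrier D \<Longrightarrow>
    dyad (x \<otimes> b) \<phi> = dyad x (b \<odot>\<^bsub>D\<^esub> \<phi>)"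
  by (auto simp: dyad_def D_sel A.m_assoc intro!: restrict_ext)

lemma dyad_left: "a \<in> carrier A \<Longrightarrow> x \<in> carrier A \<Longrightarrow> \<phi> \<in> carrier D \<Longrightarrow>
    lm a \<otimes>\<^bsub>E\<^esub> dyad x \<phi> = dyad (a \<otimes> x) \<phi>"
  by (auto simp: dyad_def E_sel compose_def A.m_assoc intro!: restrict_ext)

lemma dyad_right: "a \<in> carrier A \<Longrightarrow> x \<in> carrier A \<Longrightarrow> \<phi> \<in> carrier D \<Longrightarrow>
    dyad x \<phi> \<otimes>\<^bsub>E\<^esub> lm a = dyad x (\<phi> \<odot>\<^sub>r\<^bsub>D\<^esub> a)"
  by (auto simp: dyad_def E_sel D_sel compose_def intro!: restrict_ext)

abbreviation Ar where "Ar \<equiv> as_right_module (regular_bimodule A)"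
abbreviation Br where "Br \<equiv> as_right_module (regular_bimodule B')"

lemma Ar_biaction: "biaction \<Z> B' Ar"
proof (rule biaction_as_right_module)
  show "biaction A B' (regular_bimodule A)"
    using A.regular_ring_bimodule[OF A.carrier_is_subring subring] by (simp add: ring_bimodule.axioms(3))
qed

lemma Br_biaction: "biaction \<Z> B' Br"
proof (rule biaction_as_right_module)
  interpret B': ring B' by (rule ring_B')
  show "biaction B' B' (regular_bimodule B')"
    using B'.regular_ring_bimodule[OF B'.carrier_is_subring B'.carrier_is_subring]
    by (simp add: ring_bimodule.axioms(3))
qed

lemma fg_projective_right_imp:
  assumes "fg_projective_right B' (regular_bimodule A)"
  shows "summand_of_power \<Z> B' Ar Br"
  using assms iso_to_direct_summand_imp_summand_of_power[OF Ar_biaction Br_biaction]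
  unfolding fg_projective_right_def by blast

text \<open>A dual basis \<open>id = \<Sum>\<^sub>i y\<^sub>i \<psi>\<^sub>i\<close> in inductive form: \<open>id\<close> is reached from \<open>0\<close> by adding dyads.  The
  maps \<open>A \<rightarrow> B\<close> that occur in a factorization of \<open>id\<close> are the \<open>\<psi>\<^sub>i\<close>, and the values at \<open>1\<close> of the maps
  \<open>B \<rightarrow> A\<close> are the \<open>y\<^sub>i\<close>.\<close>

lemma dual_basis_induct [consumes 1, case_names zero step]:
  assumes fg: "fg_projective_right B' (regular_bimodule A)"
    and zero: "P \<zero>\<^bsub>E\<^esub>"
    and step: "\<And>e y \<psi>. e \<in> carrier E \<Longrightarrow> y \<in> carrier A \<Longrightarrow> \<psi> \<in> carrier D \<Longrightarrow> P e \<Longrightarrow>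
      P (e \<oplus>\<^bsub>E\<^esub> dyad y \<psi>)"
  shows "P \<one>\<^bsub>E\<^esub>"
proof -
  have sel: "carrier Ar = carrier A" "ring.add Ar = ring.add A" "ring.zero Ar = ring.zero A"
    "rsmult Ar = monoid.mult A" "carrier Br = B" "ring.add Br = ring.add A"
    "rsmult Br = monoid.mult A"
    by (auto simp: as_right_module_def)
  have "e \<in> carrier E \<and> P e" if "e \<in> factor_sums \<Z> B' Ar Br" for e
    using that
  proof induction
    case zero
    have "(\<lambda>x\<in>carrier Ar. \<zero>\<^bsub>Ar\<^esub>) = \<zero>\<^bsub>E\<^esub>" by (simp add: sel E_sel)
    then show ?case using assms(2) E_closed(3) by simp
  next
    case (step e f g)
    note f = bihomD[OF step.hyps(2), unfolded sel] and g = bihomD[OF step.hyps(3), unfolded sel]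
    have fD: "f \<in> carrier D" using f by (simp add: D_carrier)
    have y: "g \<one> \<in> carrier A" using g(2) by simp
    have "g (f x) = g \<one> \<otimes> f x" if "x \<in> carrier A" for x
      using g(5)[of \<one> "f x"] f(2) that by simp
    then have "(\<lambda>x\<in>carrier Ar. e x \<oplus>\<^bsub>Ar\<^esub> g (f x)) = e \<oplus>\<^bsub>E\<^esub> dyad (g \<one>) f"
      by (auto simp: sel E_sel dyad_def intro!: restrict_ext)
    moreover have "e \<oplus>\<^bsub>E\<^esub> dyad (g \<one>) f \<in> carrier E" using step.IH y fD by (intro E_closed) simp_all
    ultimately show ?case using assms(3)[OF _ y fD] step.IH by simp
  qed
  moreover have "(\<lambda>x\<in>carrier Ar. x) \<in> factor_sums \<Z> B' Ar Br"
    using fg_projective_right_imp[OF fg] by (simp add: summand_of_power_def)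
  ultimately have "P (\<lambda>x\<in>carrier Ar. x)" by blast
  then show ?thesis by (simp add: sel E_sel)
qed

text \<open>Composing a dual basis with \<open>e\<close> gives \<open>e = \<Sum>\<^sub>i e(y\<^sub>i) \<psi>\<^sub>i\<close>.\<close>

lemma dyad_induct [consumes 2, case_names dyad add]:
  assumes fg: "fg_projective_right B' (regular_bimodule A)" and e: "e \<in> carrier E"
    and dyad: "\<And>x \<phi>. x \<in> carrier A \<Longrightarrow> \<phi> \<in> carrier D \<Longrightarrow> P (dyad x \<phi>)"
    and add: "\<And>e e'. e \<in> carrier E \<Longrightarrow> e' \<in> carrier E \<Longrightarrow> P e \<Longrightarrow> P e' \<Longrightarrow> P (e \<oplus>\<^bsub>E\<^esub> e')"
  shows "P e"
proof -
  interpret E: ring E by (rule ring_E)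
  have "P (e \<otimes>\<^bsub>E\<^esub> \<one>\<^bsub>E\<^esub>)"
    using fg
  proof (induction rule: dual_basis_induct)
    case zero
    have "dyad \<zero> \<zero>\<^bsub>D\<^esub> = \<zero>\<^bsub>E\<^esub>" by (auto simp: dyad_def D_sel E_sel intro!: restrict_ext)
    then show ?case using e dyad[of \<zero> "\<zero>\<^bsub>D\<^esub>"] D_closed(2) by simp
  next
    case (step e' y \<psi>)
    have "e \<otimes>\<^bsub>E\<^esub> dyad y \<psi> = dyad (e y) \<psi>"
      using step e by (auto simp: dyad_def E_sel compose_def intro!: restrict_ext)
    then show ?case using step e add[of "e \<otimes>\<^bsub>E\<^esub> e'" "dyad (e y) \<psi>"] dyad[of "e y" \<psi>]
      by (simp add: E.r_distr)
  qed
  then show ?thesis using e by simp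
qed

end


section \<open>Replacing the endomorphism ring by the overring\<close>

lemma (in ring_bimodule) zero_lact [simp]: "x \<in> carrier M \<Longrightarrow> \<zero>\<^bsub>R\<^esub> \<odot>\<^bsub>M\<^esub> x = \<zero>\<^bsub>M\<^esub>"
  by (rule additive_zero[OF R.abelian_group_axioms abelian_group_axioms, of "\<lambda>r. r \<odot>\<^bsub>M\<^esub> x"])
    (auto simp: add_lact)

lemma (in tensor_over) pr_zero_right [simp]: "x \<in> carrier R \<Longrightarrow> pr x \<zero>\<^bsub>U\<^esub> = \<zero>\<^bsub>W\<^esub>"
  by (rule additive_zero[OF U.abelian_group_axioms W.abelian_group_axioms, of "pr x"])
    (auto simp: pr_add_right pr_closed)

lemma (in tensor_over) pr_zero_left [simp]: "u \<in> carrier U \<Longrightarrow> pr \<zero>\<^bsub>R\<^esub> u = \<zero>\<^bsub>W\<^esub>"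
  by (rule additive_zero[OF R.abelian_group_axioms W.abelian_group_axioms, of "\<lambda>x. pr x u"])
    (auto simp: pr_add_left pr_closed)

context subring_pair
begin

lemma dyad_app: "a \<in> carrier A \<Longrightarrow> dyad x \<phi> a = x \<otimes> \<phi> a"
  by (simp add: dyad_def)

text \<open>Since \<open>E\<close> is \<open>A \<otimes>\<^sub>B D\<close>, a \<open>B\<close>-\<open>A\<close>-map \<open>g : D \<rightarrow> A\<close> induces \<open>E \<times> U \<rightarrow> A \<otimes>\<^sub>B U\<close>.  In terms of a dual
  basis it sends \<open>(e, s)\<close> to \<open>\<Sum>\<^sub>i e(y\<^sub>i) \<otimes> g(\<psi>\<^sub>i) s\<close>.\<close>

lemma evaluation_map:
  assumes fg: "fg_projective_right B' (regular_bimodule A)"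
    and Y: "tensor_over A A id B U W pr" and g: "g \<in> bihom B' A D (regular_bimodule A)"
  obtains \<beta> where "\<And>e s. e \<in> carrier E \<Longrightarrow> s \<in> carrier U \<Longrightarrow> \<beta> e s \<in> carrier W"
    "\<And>e e' s. e \<in> carrier E \<Longrightarrow> e' \<in> carrier E \<Longrightarrow> s \<in> carrier U \<Longrightarrow>
      \<beta> (e \<oplus>\<^bsub>E\<^esub> e') s = \<beta> e s \<oplus>\<^bsub>W\<^esub> \<beta> e' s"
    "\<And>e s t. e \<in> carrier E \<Longrightarrow> s \<in> carrier U \<Longrightarrow> t \<in> carrier U \<Longrightarrow>
      \<beta> e (s \<oplus>\<^bsub>U\<^esub> t) = \<beta> e s \<oplus>\<^bsub>W\<^esub> \<beta> e t"
    "\<And>x \<phi> s. x \<in> carrier A \<Longrightarrow> \<phi> \<in> carrier D \<Longrightarrow> s \<in> carrier U \<Longrightarrow>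
      \<beta> (dyad x \<phi>) s = pr x (g \<phi> \<odot>\<^bsub>U\<^esub> s)"
proof -
  interpret Y: tensor_over A A id B U W pr by fact
  interpret D: biaction B' A D by (rule D_biaction)
  note gd = bihomD[OF g, unfolded regular_sel]
  have comp: "compose (carrier A) \<phi> e \<in> carrier D" if "\<phi> \<in> carrier D" "e \<in> carrier E" for \<phi> e
    using that by (intro D_memI) (simp_all add: compose_def)
  \<comment> \<open>For the part \<open>h\<close> of the dual basis summed so far, \<open>\<phi>\<close> is replaced by \<open>\<phi> \<circ> h\<close>.\<close>
  let ?Q = "\<lambda>h \<beta>. (\<forall>e\<in>carrier E. \<forall>s\<in>carrier U. \<beta> e s \<in> carrier W) \<and>
    (\<forall>e\<in>carrier E. \<forall>e'\<in>carrier E. \<forall>s\<in>carrier U. \<beta> (e \<oplus>\<^bsub>E\<^esub> e') s = \<beta> e s \<oplus>\<^bsub>W\<^esub> \<beta> e' s) \<and>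
    (\<forall>e\<in>carrier E. \<forall>s\<in>carrier U. \<forall>t\<in>carrier U. \<beta> e (s \<oplus>\<^bsub>U\<^esub> t) = \<beta> e s \<oplus>\<^bsub>W\<^esub> \<beta> e t) \<and>
    (\<forall>x\<in>carrier A. \<forall>\<phi>\<in>carrier D. \<forall>s\<in>carrier U.
      \<beta> (dyad x \<phi>) s = pr x (g (compose (carrier A) \<phi> h) \<odot>\<^bsub>U\<^esub> s))"
  have "\<exists>\<beta>. ?Q \<one>\<^bsub>E\<^esub> \<beta>"
    using fg
  proof (induction rule: dual_basis_induct)
    case zero
    have "g (compose (carrier A) \<phi> \<zero>\<^bsub>E\<^esub>) = \<zero>" if "\<phi> \<in> carrier D" for \<phi>
    proof -
      have "\<phi> \<zero> = \<zero>"
        by (rule additive_zero[OF A.abelian_group_axioms A.abelian_group_axioms, of \<phi>]) (use that in auto)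
      then have "compose (carrier A) \<phi> \<zero>\<^bsub>E\<^esub> = \<zero>\<^bsub>D\<^esub>"
        by (auto simp: compose_def E_sel D_sel intro!: restrict_ext)
      then show ?thesis
        using bihom_zero[OF g D.abelian_group_axioms ring_bimodule.axioms(3)[OF AA, THEN biaction.axioms(1)]]
        by simp
    qed
    then have "?Q \<zero>\<^bsub>E\<^esub> (\<lambda>e s. \<zero>\<^bsub>W\<^esub>)" by simp
    then show ?case by (rule exI[of "?Q \<zero>\<^bsub>E\<^esub>"])
  next
    case (step h y \<psi>)
    then obtain \<beta> where \<beta>: "?Q h \<beta>" by blast
    define \<beta>' where "\<beta>' = (\<lambda>e s. \<beta> e s \<oplus>\<^bsub>W\<^esub> pr (e y) (g \<psi> \<odot>\<^bsub>U\<^esub> s))"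
    have gp: "g \<psi> \<in> carrier A" using gd(2) step by simp
    have c: "pr (e y) (g \<psi> \<odot>\<^bsub>U\<^esub> s) \<in> carrier W" if "e \<in> carrier E" "s \<in> carrier U" for e s
      using that step gp by (intro Y.pr_closed) simp_all
    have "\<forall>e\<in>carrier E. \<forall>s\<in>carrier U. \<beta>' e s \<in> carrier W"
      using \<beta> c by (simp add: \<beta>'_def)
    moreover have "\<beta>' (e \<oplus>\<^bsub>E\<^esub> e') s = \<beta>' e s \<oplus>\<^bsub>W\<^esub> \<beta>' e' s"
      if "e \<in> carrier E" "e' \<in> carrier E" "s \<in> carrier U" for e e' s
    proof -
      have "(e \<oplus>\<^bsub>E\<^esub> e') y = e y \<oplus> e' y" using step by (simp add: E_sel)
      then show ?thesis using that \<beta> c step gp by (simp add: \<beta>'_def Y.pr_add_left Y.W.a_ac)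
    qed
    moreover have "\<beta>' e (s \<oplus>\<^bsub>U\<^esub> t) = \<beta>' e s \<oplus>\<^bsub>W\<^esub> \<beta>' e t"
      if "e \<in> carrier E" "s \<in> carrier U" "t \<in> carrier U" for e s t
      using that \<beta> c step gp by (simp add: \<beta>'_def Y.U.lact_add Y.pr_add_right Y.W.a_ac)
    moreover have "\<beta>' (dyad x \<phi>) s =
        pr x (g (compose (carrier A) \<phi> (h \<oplus>\<^bsub>E\<^esub> dyad y \<psi>)) \<odot>\<^bsub>U\<^esub> s)"
      if x: "x \<in> carrier A" and \<phi>: "\<phi> \<in> carrier D" and s: "s \<in> carrier U" for x \<phi> s
    proof -
      let ?h = "compose (carrier A) \<phi> h"
      have hD: "?h \<in> carrier D" using comp[OF \<phi>] step by simp
      have pD: "\<phi> y \<odot>\<^bsub>D\<^esub> \<psi> \<in> carrier D" using \<phi> step by (intro D_closed) simp_all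
      have "compose (carrier A) \<phi> (h \<oplus>\<^bsub>E\<^esub> dyad y \<psi>) = ?h \<oplus>\<^bsub>D\<^esub> \<phi> y \<odot>\<^bsub>D\<^esub> \<psi>"
        using \<phi> step by (auto simp: compose_def E_sel D_sel dyad_def intro!: restrict_ext)
      then have "g (compose (carrier A) \<phi> (h \<oplus>\<^bsub>E\<^esub> dyad y \<psi>)) = g ?h \<oplus> \<phi> y \<otimes> g \<psi>"
        using gd(3)[OF hD pD] gd(4)[of "\<phi> y" \<psi>] \<phi> step by simp
      moreover have "\<beta>' (dyad x \<phi>) s = pr x (g ?h \<odot>\<^bsub>U\<^esub> s) \<oplus>\<^bsub>W\<^esub> pr (x \<otimes> \<phi> y) (g \<psi> \<odot>\<^bsub>U\<^esub> s)"
        using \<beta> x \<phi> s step by (simp add: \<beta>'_def dyad_app)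
      moreover have "pr (x \<otimes> \<phi> y) (g \<psi> \<odot>\<^bsub>U\<^esub> s) = pr x ((\<phi> y \<otimes> g \<psi>) \<odot>\<^bsub>U\<^esub> s)"
        using Y.pr_balanced[of x "\<phi> y" "g \<psi> \<odot>\<^bsub>U\<^esub> s"] x \<phi> s step gp by (simp add: Y.U.mult_lact)
      ultimately show ?thesis
        using x \<phi> s step gp gd(2)[OF hD] by (simp add: Y.U.add_lact Y.pr_add_right)
    qed
    ultimately have "?Q (h \<oplus>\<^bsub>E\<^esub> dyad y \<psi>) \<beta>'" by blast
    then show ?case by (rule exI[of "?Q (h \<oplus>\<^bsub>E\<^esub> dyad y \<psi>)"])
  qed
  then obtain \<beta> where \<beta>: "?Q \<one>\<^bsub>E\<^esub> \<beta>" by blast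
  have "compose (carrier A) \<phi> \<one>\<^bsub>E\<^esub> = \<phi>" if "\<phi> \<in> carrier D" for \<phi>
    using that comp[OF that E_closed(4)] by (intro D_ext) (auto simp: compose_def E_sel)
  moreover have "pr x (g (compose (carrier A) \<phi> \<one>\<^bsub>E\<^esub>) \<odot>\<^bsub>U\<^esub> s) = \<beta> (dyad x \<phi>) s"
    if "x \<in> carrier A" "\<phi> \<in> carrier D" "s \<in> carrier U" for x \<phi> s
    using \<beta> that by simp
  ultimately have app: "\<beta> (dyad x \<phi>) s = pr x (g \<phi> \<odot>\<^bsub>U\<^esub> s)"
    if "x \<in> carrier A" "\<phi> \<in> carrier D" "s \<in> carrier U" for x \<phi> s
    using that by simp
  show ?thesis
    by (rule that[of \<beta>]; (rule app)?; use \<beta> in blast)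
qed

end

text \<open>Here \<open>W = E \<otimes>\<^sub>A U\<close> and \<open>W' = A \<otimes>\<^sub>B U'\<close>, and each of them has the universal property for maps into
  the other.\<close>

locale endomorphism_step = subring_pair A B
    + X: tensor_over A "End_right (A\<lparr>carrier := B\<rparr>) (regular_bimodule A)" "left_multiplication A" "carrier A" U W pr
    + Y: tensor_over A A id B U' W' pr'
  for A :: "('a, 'x) ring_scheme" (structure) and B
    and U :: "('a, 'a, 'u) bimodule" and W :: "('a, 'a, 'w) bimodule" and pr
    and U' :: "('a, 'a, 'v) bimodule" and W' :: "('a, 'a, 'z) bimodule" and pr' +
  assumes fg: "fg_projective_right (A\<lparr>carrier := B\<rparr>) (regular_bimodule A)"
    and facX: "factors_middle_linear (End_right (A\<lparr>carrier := B\<rparr>) (regular_bimodule A))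
      (left_multiplication A) (carrier A) U W pr W'"
    and facY: "factors_middle_linear A id B U' W' pr' W"
begin

text \<open>In terms of \<open>E = A \<otimes>\<^sub>B D\<close> this is \<open>x \<otimes> \<phi> \<otimes> t \<mapsto> x \<otimes> g(\<phi>) F(t)\<close>.\<close>

lemma forward_map:
  assumes g: "g \<in> bihom B' A D (regular_bimodule A)" and F: "F \<in> bihom A A U U'"
  obtains \<Phi> where "\<Phi> \<in> bihom A A W W'"
    "\<And>x \<phi> t. x \<in> carrier A \<Longrightarrow> \<phi> \<in> carrier D \<Longrightarrow> t \<in> carrier U \<Longrightarrow>
      \<Phi> (pr (dyad x \<phi>) t) = pr' x (g \<phi> \<odot>\<^bsub>U'\<^esub> F t)"
proof -
  note gd = bihomD[OF g, unfolded regular_sel] and Fd = bihomD[OF F]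
  obtain \<beta> where \<beta>: "\<And>e s. e \<in> carrier E \<Longrightarrow> s \<in> carrier U' \<Longrightarrow> \<beta> e s \<in> carrier W'"
    "\<And>e e' s. e \<in> carrier E \<Longrightarrow> e' \<in> carrier E \<Longrightarrow> s \<in> carrier U' \<Longrightarrow>
      \<beta> (e \<oplus>\<^bsub>E\<^esub> e') s = \<beta> e s \<oplus>\<^bsub>W'\<^esub> \<beta> e' s"
    "\<And>e s t. e \<in> carrier E \<Longrightarrow> s \<in> carrier U' \<Longrightarrow> t \<in> carrier U' \<Longrightarrow>
      \<beta> e (s \<oplus>\<^bsub>U'\<^esub> t) = \<beta> e s \<oplus>\<^bsub>W'\<^esub> \<beta> e t"
    "\<And>x \<phi> s. x \<in> carrier A \<Longrightarrow> \<phi> \<in> carrier D \<Longrightarrow> s \<in> carrier U' \<Longrightarrow>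
      \<beta> (dyad x \<phi>) s = pr' x (g \<phi> \<odot>\<^bsub>U'\<^esub> s)"
    by (rule evaluation_map[OF fg Y.tensor_over_axioms g]) (rule that; assumption)
  have bal: "\<beta> (e \<otimes>\<^bsub>E\<^esub> lm a) s = \<beta> e (a \<odot>\<^bsub>U'\<^esub> s)"
    if e: "e \<in> carrier E" and a: "a \<in> carrier A" and s: "s \<in> carrier U'" for e a s
    using fg e
  proof (induction rule: dyad_induct)
    case (dyad x \<phi>)
    have "g (\<phi> \<odot>\<^sub>r\<^bsub>D\<^esub> a) \<odot>\<^bsub>U'\<^esub> s = g \<phi> \<odot>\<^bsub>U'\<^esub> (a \<odot>\<^bsub>U'\<^esub> s)"
      using dyad a s gd(2)[of \<phi>] gd(5)[of \<phi> a] by (simp add: Y.U.mult_lact)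
    then show ?case using dyad a s D_closed(4)[of a \<phi>] by (simp add: dyad_right \<beta>(4))
  next
    case (add e e')
    then show ?case using a s by (simp add: X.R.l_distr \<beta>(2))
  qed
  have left: "\<beta> (lm a \<otimes>\<^bsub>E\<^esub> e) s = a \<odot>\<^bsub>W'\<^esub> \<beta> e s"
    if e: "e \<in> carrier E" and a: "a \<in> carrier A" and s: "s \<in> carrier U'" for e a s
    using fg e
  proof (induction rule: dyad_induct)
    case (dyad x \<phi>)
    then show ?case using a s gd(2)[of \<phi>] Y.pr_lact[of a x "g \<phi> \<odot>\<^bsub>U'\<^esub> s"]
      by (simp add: dyad_left \<beta>(4))
  next
    case (add e e')
    then show ?case using a s by (simp add: X.R.r_distr \<beta> Y.W.lact_add)
  qed
  have right: "\<beta> e (s \<odot>\<^sub>r\<^bsub>U'\<^esub> a) = \<beta> e s \<odot>\<^sub>r\<^bsub>W'\<^esub> a"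
    if e: "e \<in> carrier E" and a: "a \<in> carrier A" and s: "s \<in> carrier U'" for e a s
    using fg e
  proof (induction rule: dyad_induct)
    case (dyad x \<phi>)
    then show ?case using a s gd(2)[of \<phi>] by (simp add: \<beta>(4) Y.pr_ract Y.U.lact_ract)
  next
    case (add e e')
    then show ?case using a s by (simp add: \<beta> Y.W.ract_add)
  qed
  obtain \<Phi> where \<Phi>: "\<Phi> \<in> bihom A A W W'"
    "\<And>e t. e \<in> carrier E \<Longrightarrow> t \<in> carrier U \<Longrightarrow> \<Phi> (pr e t) = \<beta> e (F t)"
  proof (rule X.tensor_map[OF facX Y.W.biaction_axioms, of "\<lambda>e t. \<beta> e (F t)"])
    show "middle_linear E lm (carrier A) U W' (\<lambda>e t. \<beta> e (F t))"
      unfolding middle_linear_def using \<beta> Fd bal by simp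
    show "\<beta> (lm a \<otimes>\<^bsub>E\<^esub> x) (F u) = a \<odot>\<^bsub>W'\<^esub> \<beta> x (F u)"
      if "a \<in> carrier A" "x \<in> carrier E" "u \<in> carrier U" for a x u
      using that left Fd(2) by simp
    show "\<beta> x (F (u \<odot>\<^sub>r\<^bsub>U\<^esub> a)) = \<beta> x (F u) \<odot>\<^sub>r\<^bsub>W'\<^esub> a"
      if "a \<in> carrier A" "x \<in> carrier E" "u \<in> carrier U" for a x u
      using that right Fd(2,5) by simp
  qed blast
  show ?thesis by (rule that[OF \<Phi>(1)]) (simp add: \<Phi>(2) \<beta>(4) Fd(2))
qed

lemma dyad_of_one:
  assumes f: "f \<in> bihom B' A (regular_bimodule A) D" and x: "x \<in> carrier A" and a: "a \<in> carrier A"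
  shows "dyad x (f \<one>) \<otimes>\<^bsub>E\<^esub> lm a = dyad x (f a)"
proof -
  have "f \<one> \<in> carrier D" "f \<one> \<odot>\<^sub>r\<^bsub>D\<^esub> a = f a"
    using bihomD(2)[OF f, of \<one>] bihomD(5)[OF f, of \<one> a] a by simp_all
  then show ?thesis using dyad_right[OF a x, of "f \<one>"] by simp
qed

text \<open>This is \<open>x \<otimes> s \<mapsto> x \<otimes> f(1) \<otimes> G(s)\<close>.  It is balanced over \<open>B\<close> because \<open>b f(1) = f(b) = f(1) b\<close>.\<close>

lemma backward_map:
  assumes f: "f \<in> bihom B' A (regular_bimodule A) D" and G: "G \<in> bihom A A U' U"
  obtains \<Psi> where "\<Psi> \<in> bihom A A W' W"
    "\<And>x s. x \<in> carrier A \<Longrightarrow> s \<in> carrier U' \<Longrightarrow> \<Psi> (pr' x s) = pr (dyad x (f \<one>)) (G s)"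
proof -
  note fd = bihomD[OF f, unfolded regular_sel] and Gd = bihomD[OF G]
  have f1: "f \<one> \<in> carrier D" using fd(2) by simp
  have bal: "pr (dyad (x \<otimes> b) (f \<one>)) (G s) = pr (dyad x (f \<one>)) (G (b \<odot>\<^bsub>U'\<^esub> s))"
    if "x \<in> carrier A" "b \<in> B" "s \<in> carrier U'" for x b s
  proof -
    have "b \<odot>\<^bsub>D\<^esub> f \<one> = f b" using fd(4)[of b \<one>] that by simp
    then have "dyad (x \<otimes> b) (f \<one>) = dyad x (f \<one>) \<otimes>\<^bsub>E\<^esub> lm b"
      using that f1 dyad_of_one[OF f, of x b] by (simp add: dyad_balanced)
    then show ?thesis using that f1 Gd X.pr_balanced[of "dyad x (f \<one>)" b "G s"] by simp
  qed
  obtain \<Psi> where \<Psi>: "\<Psi> \<in> bihom A A W' W"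
    "\<And>x s. x \<in> carrier A \<Longrightarrow> s \<in> carrier U' \<Longrightarrow> \<Psi> (pr' x s) = pr (dyad x (f \<one>)) (G s)"
  proof (rule Y.tensor_map[OF facY X.W.biaction_axioms, of "\<lambda>x s. pr (dyad x (f \<one>)) (G s)"])
    show "middle_linear A id B U' W (\<lambda>x s. pr (dyad x (f \<one>)) (G s))"
      unfolding middle_linear_def
      using f1 Gd bal by (simp add: X.pr_closed dyad_add_left X.pr_add_left X.pr_add_right)
    show "pr (dyad (id a \<otimes> x) (f \<one>)) (G s) = a \<odot>\<^bsub>W\<^esub> pr (dyad x (f \<one>)) (G s)"
      if "a \<in> carrier A" "x \<in> carrier A" "s \<in> carrier U'" for a x s
      using that f1 Gd X.pr_lact[of a "dyad x (f \<one>)" "G s"] by (simp add: dyad_left)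
    show "pr (dyad x (f \<one>)) (G (s \<odot>\<^sub>r\<^bsub>U'\<^esub> a)) = pr (dyad x (f \<one>)) (G s) \<odot>\<^sub>r\<^bsub>W\<^esub> a"
      if "a \<in> carrier A" "x \<in> carrier A" "s \<in> carrier U'" for a x s
      using that f1 Gd by (simp add: X.pr_ract)
  qed blast
  then show ?thesis by (rule that)
qed

text \<open>The composite of the forward and the backward map sends \<open>x \<otimes> \<phi> \<otimes> t\<close> to
  \<open>x \<otimes> f(1) \<otimes> g(\<phi>) G(F(t)) = x \<otimes> f(g(\<phi>)) \<otimes> G(F(t))\<close>, because \<open>f(1) g(\<phi>) = f(g(\<phi>))\<close>.  The sum
  over the pairs \<open>(F, G)\<close> that make up \<open>k\<close> is taken here, the one over the pairs \<open>(g, f)\<close> in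
  \<open>summand_forward\<close>.\<close>

lemma round_trip_W:
  assumes f: "f \<in> bihom B' A (regular_bimodule A) D" and g: "g \<in> bihom B' A D (regular_bimodule A)"
    and k: "k \<in> factor_sums A A U U'"
  shows "\<exists>H\<in>factor_sums A A W W'. \<forall>x\<in>carrier A. \<forall>\<phi>\<in>carrier D. \<forall>t\<in>carrier U.
    H (pr (dyad x \<phi>) t) = pr (dyad x (f (g \<phi>))) (k t)"
  using k
proof induction
  case zero
  have "f (g \<phi>) \<in> carrier D" if "\<phi> \<in> carrier D" for \<phi>
    using bihomD(2)[OF f] bihomD(2)[OF g that] by simp
  then show ?case
    by (intro bexI[OF _ factor_sums.zero]) (simp add: X.pr_closed)
next
  case (step k F G)
  note fd = bihomD[OF f, unfolded regular_sel] and gd = bihomD[OF g, unfolded regular_sel]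
    and Fd = bihomD[OF step.hyps(2)] and Gd = bihomD[OF step.hyps(3)]
  obtain H where H: "H \<in> factor_sums A A W W'" "\<forall>x\<in>carrier A. \<forall>\<phi>\<in>carrier D. \<forall>t\<in>carrier U.
    H (pr (dyad x \<phi>) t) = pr (dyad x (f (g \<phi>))) (k t)" using step.IH by blast
  obtain \<Phi> where \<Phi>: "\<Phi> \<in> bihom A A W W'"
    "\<And>x \<phi> t. x \<in> carrier A \<Longrightarrow> \<phi> \<in> carrier D \<Longrightarrow> t \<in> carrier U \<Longrightarrow>
      \<Phi> (pr (dyad x \<phi>) t) = pr' x (g \<phi> \<odot>\<^bsub>U'\<^esub> F t)"
    by (rule forward_map[OF g step.hyps(2)]) (rule that; assumption)
  obtain \<Psi> where \<Psi>: "\<Psi> \<in> bihom A A W' W"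
    "\<And>x s. x \<in> carrier A \<Longrightarrow> s \<in> carrier U' \<Longrightarrow> \<Psi> (pr' x s) = pr (dyad x (f \<one>)) (G s)"
    by (rule backward_map[OF f step.hyps(3)]) (rule that; assumption)
  have "H (pr (dyad x \<phi>) t) \<oplus>\<^bsub>W\<^esub> \<Psi> (\<Phi> (pr (dyad x \<phi>) t)) =
      pr (dyad x (f (g \<phi>))) (k t \<oplus>\<^bsub>U\<^esub> G (F t))"
    if x: "x \<in> carrier A" and \<phi>: "\<phi> \<in> carrier D" and t: "t \<in> carrier U" for x \<phi> t
  proof -
    have c: "g \<phi> \<in> carrier A" "f \<one> \<in> carrier D" "f (g \<phi>) \<in> carrier D" "F t \<in> carrier U'" "G (F t) \<in> carrier U"
      using fd(2) gd(2) Fd(2) Gd(2) \<phi> t by simp_all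
    have "\<Psi> (\<Phi> (pr (dyad x \<phi>) t)) = pr (dyad x (f \<one>)) (g \<phi> \<odot>\<^bsub>U\<^esub> G (F t))"
      using \<Phi>(2)[OF x \<phi> t] \<Psi>(2)[OF x] c Gd(4) by simp
    also have "\<dots> = pr (dyad x (f \<one>) \<otimes>\<^bsub>E\<^esub> lm (g \<phi>)) (G (F t))"
      using x c by (simp add: X.pr_balanced)
    also have "\<dots> = pr (dyad x (f (g \<phi>))) (G (F t))" using dyad_of_one[OF f x c(1)] by simp
    finally have "\<Psi> (\<Phi> (pr (dyad x \<phi>) t)) = pr (dyad x (f (g \<phi>))) (G (F t))" .
    then show ?thesis
      using H(2) x \<phi> t c factor_sums_closed[OF X.U.biaction_axioms step.hyps(1) t]
      by (simp add: X.pr_add_right)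
  qed
  then show ?case
    by (intro bexI[OF _ factor_sums.step[OF H(1) \<Phi>(1) \<Psi>(1)]]) (simp add: X.pr_closed)
qed

lemma summand_forward:
  assumes DA: "summand_of_power B' A D (regular_bimodule A)" and UU: "summand_of_power A A U U'"
  shows "summand_of_power A A W W'"
proof -
  have "\<exists>H\<in>factor_sums A A W W'. \<forall>x\<in>carrier A. \<forall>\<phi>\<in>carrier D. \<forall>t\<in>carrier U.
    H (pr (dyad x \<phi>) t) = pr (dyad x (h \<phi>)) t"
    if "h \<in> factor_sums B' A D (regular_bimodule A)" for h
    using that
  proof induction
    case zero
    have "dyad x \<zero>\<^bsub>D\<^esub> = \<zero>\<^bsub>E\<^esub>" if "x \<in> carrier A" for x
      using that by (auto simp: dyad_def D_sel E_sel intro!: restrict_ext)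
    then show ?case
      by (intro bexI[OF _ factor_sums.zero]) (simp add: X.pr_closed)
  next
    case (step h g f)
    obtain H where H: "H \<in> factor_sums A A W W'" "\<forall>x\<in>carrier A. \<forall>\<phi>\<in>carrier D. \<forall>t\<in>carrier U.
      H (pr (dyad x \<phi>) t) = pr (dyad x (h \<phi>)) t" using step.IH by blast
    obtain H' where H': "H' \<in> factor_sums A A W W'" "\<forall>x\<in>carrier A. \<forall>\<phi>\<in>carrier D. \<forall>t\<in>carrier U.
      H' (pr (dyad x \<phi>) t) = pr (dyad x (f (g \<phi>))) t"
      using round_trip_W[OF step.hyps(3,2) UU[unfolded summand_of_power_def]] by auto
    have c: "h \<phi> \<in> carrier D" "f (g \<phi>) \<in> carrier D" if "\<phi> \<in> carrier D" for \<phi>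
      using factor_sums_closed[OF D_biaction step.hyps(1) that] bihomD(2)[OF step.hyps(2) that]
        bihomD(2)[OF step.hyps(3)] by simp_all
    show ?case
      by (intro bexI[OF _ factor_sums_add[OF X.W.biaction_axioms H(1) H'(1)]])
        (use H(2) H'(2) c in \<open>simp add: X.pr_closed dyad_add_right X.pr_add_left\<close>)
  qed
  from this[OF DA[unfolded summand_of_power_def]]
  obtain H where H: "H \<in> factor_sums A A W W'" "\<forall>x\<in>carrier A. \<forall>\<phi>\<in>carrier D. \<forall>t\<in>carrier U.
    H (pr (dyad x \<phi>) t) = pr (dyad x \<phi>) t" by auto
  note Hd = bihomD[OF factor_sums_bihom[OF X.W.biaction_axioms Y.W.biaction_axioms H(1)]]
  have "H w = w" if "w \<in> carrier W" for w
    using that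
  proof (induction rule: X.pr_induct)
    case (pr e t)
    show ?case using fg pr(1)
    proof (induction rule: dyad_induct)
      case (dyad x \<phi>)
      then show ?case using H(2) pr(2) by simp
    next
      case (add e e')
      then show ?case using pr(2) Hd(3) by (simp add: X.pr_add_left X.pr_closed)
    qed
  next
    case (add w w')
    then show ?case using Hd(3) by simp
  qed
  then have "H = (\<lambda>w\<in>carrier W. w)"
    using Hd(1) by (intro extensionalityI[of _ "carrier W"]) (auto simp: PiE_iff)
  then show ?thesis using H(1) by (simp add: summand_of_power_def)
qed

text \<open>The other composite sends \<open>x \<otimes> s\<close> to \<open>x \<otimes> g(f(1)) F(G(s))\<close>; if the \<open>g \<circ> f\<close> sum to the identity
  of \<open>A\<close>, then the \<open>g(f(1))\<close> sum to \<open>1\<close>.\<close>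

lemma round_trip_W':
  assumes f: "f \<in> bihom B' A (regular_bimodule A) D" and g: "g \<in> bihom B' A D (regular_bimodule A)"
    and k: "k \<in> factor_sums A A U' U"
  shows "\<exists>H\<in>factor_sums A A W' W. \<forall>x\<in>carrier A. \<forall>s\<in>carrier U'.
    H (pr' x s) = pr' x (g (f \<one>) \<odot>\<^bsub>U'\<^esub> k s)"
  using k
proof induction
  case zero
  have "g (f \<one>) \<in> carrier A" using bihomD(2)[OF f] bihomD(2)[OF g] by simp
  then show ?case
    by (intro bexI[OF _ factor_sums.zero]) (simp add: Y.pr_closed)
next
  case (step k G F)
  note fd = bihomD[OF f, unfolded regular_sel] and gd = bihomD[OF g, unfolded regular_sel]
    and Fd = bihomD[OF step.hyps(3)] and Gd = bihomD[OF step.hyps(2)]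
  obtain H where H: "H \<in> factor_sums A A W' W" "\<forall>x\<in>carrier A. \<forall>s\<in>carrier U'.
    H (pr' x s) = pr' x (g (f \<one>) \<odot>\<^bsub>U'\<^esub> k s)" using step.IH by blast
  obtain \<Phi> where \<Phi>: "\<Phi> \<in> bihom A A W W'"
    "\<And>x \<phi> t. x \<in> carrier A \<Longrightarrow> \<phi> \<in> carrier D \<Longrightarrow> t \<in> carrier U \<Longrightarrow>
      \<Phi> (pr (dyad x \<phi>) t) = pr' x (g \<phi> \<odot>\<^bsub>U'\<^esub> F t)"
    by (rule forward_map[OF g step.hyps(3)]) (rule that; assumption)
  obtain \<Psi> where \<Psi>: "\<Psi> \<in> bihom A A W' W"
    "\<And>x s. x \<in> carrier A \<Longrightarrow> s \<in> carrier U' \<Longrightarrow> \<Psi> (pr' x s) = pr (dyad x (f \<one>)) (G s)"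
    by (rule backward_map[OF f step.hyps(2)]) (rule that; assumption)
  have c: "f \<one> \<in> carrier D" "g (f \<one>) \<in> carrier A" using fd(2) gd(2) by simp_all
  have "H (pr' x s) \<oplus>\<^bsub>W'\<^esub> \<Phi> (\<Psi> (pr' x s)) = pr' x (g (f \<one>) \<odot>\<^bsub>U'\<^esub> (k s \<oplus>\<^bsub>U'\<^esub> F (G s)))"
    if x: "x \<in> carrier A" and s: "s \<in> carrier U'" for x s
    using H(2) x s c Fd(2) Gd(2) \<Phi>(2) \<Psi>(2) factor_sums_closed[OF Y.U.biaction_axioms step.hyps(1) s]
    by (simp add: Y.pr_add_right Y.U.lact_add)
  then show ?case
    by (intro bexI[OF _ factor_sums.step[OF H(1) \<Psi>(1) \<Phi>(1)]]) (simp add: Y.pr_closed)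
qed

lemma summand_backward:
  assumes AD: "summand_of_power B' A (regular_bimodule A) D" and UU: "summand_of_power A A U' U"
  shows "summand_of_power A A W' W"
proof -
  have "\<exists>H\<in>factor_sums A A W' W. \<forall>x\<in>carrier A. \<forall>s\<in>carrier U'.
    H (pr' x s) = pr' x (h \<one> \<odot>\<^bsub>U'\<^esub> s)"
    if "h \<in> factor_sums B' A (regular_bimodule A) D" for h
    using that
  proof induction
    case zero
    then show ?case
      by (intro bexI[OF _ factor_sums.zero]) (simp add: Y.pr_closed)
  next
    case (step h f g)
    obtain H where H: "H \<in> factor_sums A A W' W" "\<forall>x\<in>carrier A. \<forall>s\<in>carrier U'.
      H (pr' x s) = pr' x (h \<one> \<odot>\<^bsub>U'\<^esub> s)" using step.IH by blast
    obtain H' where H': "H' \<in> factor_sums A A W' W" "\<forall>x\<in>carrier A. \<forall>s\<in>carrier U'.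
      H' (pr' x s) = pr' x (g (f \<one>) \<odot>\<^bsub>U'\<^esub> s)"
      using round_trip_W'[OF step.hyps(2,3) UU[unfolded summand_of_power_def]] by auto
    have c: "h \<one> \<in> carrier A" "g (f \<one>) \<in> carrier A"
      using factor_sums_closed[OF ring_bimodule.axioms(3)[OF BA] step.hyps(1), of \<one>]
        bihomD(2)[OF step.hyps(2)] bihomD(2)[OF step.hyps(3)] by simp_all
    show ?case
      by (intro bexI[OF _ factor_sums_add[OF Y.W.biaction_axioms H(1) H'(1)]])
        (use H(2) H'(2) c in \<open>simp add: Y.pr_closed Y.pr_add_right Y.U.add_lact\<close>)
  qed
  from this[OF AD[unfolded summand_of_power_def]]
  obtain H where H: "H \<in> factor_sums A A W' W" "\<forall>x\<in>carrier A. \<forall>s\<in>carrier U'.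
    H (pr' x s) = pr' x s" by (auto simp: Y.U.one_lact)
  note Hd = bihomD[OF factor_sums_bihom[OF Y.W.biaction_axioms X.W.biaction_axioms H(1)]]
  have "H w = w" if "w \<in> carrier W'" for w
    using that
  proof (induction rule: Y.pr_induct)
    case (pr x s)
    then show ?case using H(2) by simp
  next
    case (add w w')
    then show ?case using Hd(3) by simp
  qed
  then have "H = (\<lambda>w\<in>carrier W'. w)"
    using Hd(1) by (intro extensionalityI[of _ "carrier W'"]) (auto simp: PiE_iff)
  then show ?thesis using H(1) by (simp add: summand_of_power_def)
qed

end


section \<open>H-separable extensions are separable\<close>

primrec (in ring) combinations :: "'a set \<Rightarrow> 'a list \<Rightarrow> 'a set" where
  "combinations J [] = {\<zero>}"
| "combinations J (d # ds) = {c \<otimes> d \<oplus> w | c w. c \<in> J \<and> w \<in> combinations J ds}"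

lemma (in ring) combinations_mono: "J \<subseteq> J' \<Longrightarrow> combinations J ds \<subseteq> combinations J' ds"
  by (induction ds) auto

text \<open>Nakayama's lemma without determinants.  Think of \<open>Z\<close> as a central subring, of \<open>I\<close> as an ideal
  of \<open>Z\<close>, and of \<open>V\<close> as an algebra over \<open>Z\<close>.  If \<open>1 = \<Sum> c\<^sub>g g\<close> with \<open>c\<^sub>g \<in> I\<close>, then
  \<open>v = \<Sum> c\<^sub>g (v g)\<close> for every \<open>v \<in> V\<close>, so \<open>V = I V\<close>.  Hence the entries of \<open>ds\<close>, whose span contains
  \<open>z V\<close>, can be eliminated one at a time, each time changing \<open>z\<close> within \<open>1 + I\<close>.  Once none is left,
  \<open>z = z 1 = 0\<close> and so \<open>1 \<in> I\<close>.\<close>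

lemma (in ring) eliminate_generators:
  assumes Z: "Z \<subseteq> carrier R" "\<And>z a. z \<in> Z \<Longrightarrow> a \<in> carrier R \<Longrightarrow> z \<otimes> a = a \<otimes> z"
      "\<And>z z'. z \<in> Z \<Longrightarrow> z' \<in> Z \<Longrightarrow> z \<otimes> z' \<in> Z"
      "\<And>z z'. z \<in> Z \<Longrightarrow> z' \<in> Z \<Longrightarrow> z \<oplus> z' \<in> Z" "\<And>z. z \<in> Z \<Longrightarrow> \<ominus> z \<in> Z"
    and I: "I \<subseteq> Z" "\<And>i j. i \<in> I \<Longrightarrow> j \<in> I \<Longrightarrow> i \<oplus> j \<in> I" "\<And>i z. i \<in> I \<Longrightarrow> z \<in> Z \<Longrightarrow> i \<otimes> z \<in> I"
      "\<zero> \<in> I"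
    and V: "V \<subseteq> carrier R" "\<And>v w. v \<in> V \<Longrightarrow> w \<in> V \<Longrightarrow> v \<otimes> w \<in> V" "\<one> \<in> V"
    and gs: "set gs \<subseteq> V" "\<one> \<in> combinations I gs"
  shows "set ds \<subseteq> V \<Longrightarrow> z \<in> Z \<Longrightarrow> \<one> \<ominus> z \<in> I \<Longrightarrow> (\<And>v. v \<in> V \<Longrightarrow> z \<otimes> v \<in> combinations Z ds) \<Longrightarrow> \<one> \<in> I"
proof (induction ds arbitrary: z)
  case Nil
  then have "z = \<zero>" using V(3) Z(1) by (metis combinations.simps(1) r_one singletonD subsetD)
  then show ?case using Nil.prems(3) by (simp add: a_minus_def)
next
  case (Cons d ds)
  have IR: "I \<subseteq> carrier R" using I(1) Z(1) by blast
  have z: "z \<in> carrier R" and d: "d \<in> V" "d \<in> carrier R" using Cons.prems V(1) Z(1) by auto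
  have comb_closed: "combinations J xs \<subseteq> carrier R" if "J \<subseteq> carrier R" "set xs \<subseteq> carrier R" for J xs
    using that(2) by (induction xs) (use that(1) in auto)
  have comb_scale: "c \<otimes> w \<in> combinations J' xs"
    if c: "c \<in> Z" and J: "J \<subseteq> Z" "\<And>j. j \<in> J \<Longrightarrow> c \<otimes> j \<in> J'" and xs: "set xs \<subseteq> carrier R"
      and w: "w \<in> combinations J xs" for c w J J' xs
    using xs w
  proof (induction xs arbitrary: w)
    case Nil
    then show ?case using c Z(1) by auto
  next
    case (Cons x xs)
    then obtain j u where ju: "w = j \<otimes> x \<oplus> u" "j \<in> J" "u \<in> combinations J xs" by auto
    have "u \<in> carrier R" "j \<in> carrier R" "c \<in> carrier R" "x \<in> carrier R"
      using comb_closed[of J xs] Cons.prems ju J(1) c Z(1) by auto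
    then have "c \<otimes> w = (c \<otimes> j) \<otimes> x \<oplus> c \<otimes> u" unfolding ju(1) by (simp add: r_distr m_assoc)
    then show ?case using J(2)[OF ju(2)] Cons.IH[OF _ ju(3)] Cons.prems by auto
  qed
  have comb_add: "w \<oplus> w' \<in> combinations J xs"
    if J: "J \<subseteq> carrier R" "\<And>i j. i \<in> J \<Longrightarrow> j \<in> J \<Longrightarrow> i \<oplus> j \<in> J" and xs: "set xs \<subseteq> carrier R"
      and w: "w \<in> combinations J xs" "w' \<in> combinations J xs" for J xs w w'
    using xs w
  proof (induction xs arbitrary: w w')
    case Nil
    then show ?case by simp
  next
    case (Cons x xs)
    then obtain j u j' u' where ju: "w = j \<otimes> x \<oplus> u" "j \<in> J" "u \<in> combinations J xs"
      "w' = j' \<otimes> x \<oplus> u'" "j' \<in> J" "u' \<in> combinations J xs" by auto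
    have "u \<in> carrier R" "j \<in> carrier R" "u' \<in> carrier R" "j' \<in> carrier R" "x \<in> carrier R"
      using comb_closed[of J xs] Cons.prems ju J(1) by auto
    then have "w \<oplus> w' = (j \<oplus> j') \<otimes> x \<oplus> (u \<oplus> u')" unfolding ju by (simp add: l_distr a_ac)
    then show ?case using J(2) ju Cons.IH[OF _ ju(3,6)] Cons.prems by auto
  qed
  have dds: "set (d # ds) \<subseteq> carrier R" using Cons.prems(1) V(1) by auto
  have "z \<otimes> (d \<otimes> w) \<in> combinations I (d # ds)"
    if "set xs \<subseteq> V" "w \<in> combinations I xs" for xs w
    using that
  proof (induction xs arbitrary: w)
    case Nil
    have "\<zero> \<in> combinations I xs" if "set xs \<subseteq> carrier R" for xs
      using that
    proof (induction xs)
      case (Cons x xs)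
      then have "\<zero> \<otimes> x \<oplus> \<zero> \<in> combinations I (x # xs)"
        using I(4) unfolding combinations.simps by (intro CollectI exI[of _ "\<zero>"] conjI refl) simp_all
      then show ?case using Cons.prems by (simp del: combinations.simps(2))
    qed simp
    then show ?case using Nil z d dds by (simp del: combinations.simps(2))
  next
    case (Cons x xs)
    then obtain c u where cu: "w = c \<otimes> x \<oplus> u" "c \<in> I" "u \<in> combinations I xs" by auto
    have x: "x \<in> V" "x \<in> carrier R" using Cons.prems V(1) by auto
    have u: "u \<in> carrier R" using comb_closed[OF IR, of xs] Cons.prems V(1) cu by auto
    have c: "c \<in> carrier R" "c \<in> Z" using cu I(1) IR by auto
    have "z \<otimes> (d \<otimes> x) \<in> combinations Z (d # ds)" using \<open>\<And>v. v \<in> V \<Longrightarrow> z \<otimes> v \<in> combinations Z (d # ds)\<close> V(2)[OF d(1) x(1)] by blast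
    then have "c \<otimes> (z \<otimes> (d \<otimes> x)) \<in> combinations I (d # ds)"
      using comb_scale[OF c(2) order_refl _ dds, of I] I(3)[OF cu(2)] by blast
    moreover have "z \<otimes> (d \<otimes> u) \<in> combinations I (d # ds)" using Cons.IH[OF _ cu(3)] Cons.prems by simp
    moreover have "z \<otimes> (d \<otimes> w) = c \<otimes> (z \<otimes> (d \<otimes> x)) \<oplus> z \<otimes> (d \<otimes> u)"
    proof -
      have "z \<otimes> (d \<otimes> (c \<otimes> x)) = c \<otimes> (z \<otimes> (d \<otimes> x))"
        using Z(2)[OF c(2), of "z \<otimes> d"] z d x c by (simp add: m_assoc[symmetric])
      then show ?thesis unfolding cu(1) using z d x c u by (simp add: r_distr)
    qed
    ultimately show ?case using comb_add[OF IR I(2) dds] by simp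
  qed
  from this[OF gs] have "z \<otimes> d \<in> combinations I (d # ds)" using d by simp
  then obtain i w where iw: "z \<otimes> d = i \<otimes> d \<oplus> w" "i \<in> I" "w \<in> combinations I ds" by auto
  have iR: "i \<in> carrier R" and iZ: "i \<in> Z" using iw IR I(1) by auto
  have wR: "w \<in> carrier R" using comb_closed[OF IR, of ds] iw dds by auto
  \<comment> \<open>Moving \<open>i d\<close> to the left gives \<open>(z - i) d \<in> Z ds\<close>, so \<open>(z - i) z V\<close> lies in the span of \<open>ds\<close>.\<close>
  define y where "y = z \<ominus> i"
  have yZ: "y \<in> Z" using Cons.prems(2) iZ Z(4,5) by (simp add: y_def a_minus_def)
  have yR: "y \<in> carrier R" using yZ Z(1) by blast
  have "y \<otimes> d = z \<otimes> d \<ominus> i \<otimes> d" using z iR d by (simp add: y_def a_minus_def l_distr l_minus)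
  also have "\<dots> = w" unfolding iw(1) using iR d wR by (simp add: a_minus_def a_ac r_neg r_neg1)
  finally have yd: "y \<otimes> d = w" .
  have wZ: "w \<in> combinations Z ds" using iw(3) combinations_mono[OF I(1)] by blast
  have "(y \<otimes> z) \<otimes> v \<in> combinations Z ds" if v: "v \<in> V" for v
  proof -
    obtain c u where cu: "z \<otimes> v = c \<otimes> d \<oplus> u" "c \<in> Z" "u \<in> combinations Z ds"
      using Cons.prems(4)[OF v] by auto
    have c: "c \<in> carrier R" using cu Z(1) by blast
    have u: "u \<in> carrier R" using comb_closed[OF Z(1), of ds] dds cu by auto
    have "(y \<otimes> z) \<otimes> v = y \<otimes> (z \<otimes> v)" using yR z v V(1) by (auto simp: m_assoc)
    also have "\<dots> = c \<otimes> (y \<otimes> d) \<oplus> y \<otimes> u"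
      unfolding cu(1) using Z(2)[OF cu(2) yR] yR c d u by (simp add: r_distr m_assoc[symmetric])
    finally have "(y \<otimes> z) \<otimes> v = c \<otimes> w \<oplus> y \<otimes> u" unfolding yd .
    moreover have "c \<otimes> w \<in> combinations Z ds" "y \<otimes> u \<in> combinations Z ds"
      using comb_scale[OF cu(2) order_refl _ _ wZ, of Z] comb_scale[OF yZ order_refl _ _ cu(3), of Z]
        Z(3) cu(2) yZ dds by auto
    ultimately show ?thesis using comb_add[OF Z(1) Z(4)] dds by simp
  qed
  moreover have "\<one> \<ominus> y \<otimes> z \<in> I"
  proof -
    have "\<one> \<ominus> y \<otimes> z = (\<one> \<ominus> z) \<oplus> (\<one> \<ominus> z) \<otimes> z \<oplus> i \<otimes> z"
    proof -
      have "(\<one> \<ominus> z) \<otimes> z = z \<ominus> z \<otimes> z" using z by (simp add: a_minus_def l_distr l_minus)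
      moreover have "\<one> \<ominus> y \<otimes> z = \<one> \<ominus> z \<otimes> z \<oplus> i \<otimes> z"
        using z iR by (simp add: y_def a_minus_def l_distr l_minus minus_add a_ac)
      moreover have "(\<one> \<ominus> z) \<oplus> (z \<ominus> z \<otimes> z) = \<one> \<ominus> z \<otimes> z"
        using z by (simp add: a_minus_def a_assoc r_neg1 l_neg)
      ultimately show ?thesis by simp
    qed
    moreover have "(\<one> \<ominus> z) \<otimes> z \<in> I" "i \<otimes> z \<in> I" using I(3) Cons.prems(2,3) iw(2) by auto
    ultimately show ?thesis using I(2) Cons.prems(3) by simp
  qed
  ultimately show ?case using Cons.IH[of "y \<otimes> z"] Cons.prems(1) Z(3)[OF yZ Cons.prems(2)] by simp
qed

context ring_extension
begin

lemma sandwich_map: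
  assumes v: "v \<in> carrier R" and comm: "\<And>s. s \<in> carrier S \<Longrightarrow> h s \<otimes> v = v \<otimes> h s"
  obtains f where "f \<in> bihom R R (T (Suc (Suc 0))) (regular_bimodule R)"
    "\<And>x y. x \<in> carrier R \<Longrightarrow> y \<in> carrier R \<Longrightarrow> f (elt [x, y]) = x \<otimes> v \<otimes> y"
proof -
  interpret M: ring_bimodule R R "regular_bimodule R" by (rule regular_bimodule_RR)
  have tup: "xs \<in> tuples R (Suc (Suc 0)) \<longleftrightarrow> (\<exists>x\<in>carrier R. \<exists>y\<in>carrier R. xs = [x, y])" for xs
    by (auto simp: tuples_def length_Suc_conv)
  define \<phi> where "\<phi> = (\<lambda>xs. hd xs \<otimes> v \<otimes> hd (tl xs))"
  have \<phi>: "\<phi> [x, y] = x \<otimes> v \<otimes> y" for x y by (simp add: \<phi>_def)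
  obtain f where f: "f \<in> bihom R R (T (Suc (Suc 0))) (regular_bimodule R)"
    "\<And>xs. xs \<in> tuples R (Suc (Suc 0)) \<Longrightarrow> f (elt xs) = \<phi> xs"
  proof (rule tensor_bihom[OF M.biaction_axioms, of "Suc 0" \<phi>], unfold regular_sel)
    show "\<phi> xs \<in> carrier R" if "xs \<in> tuples R (Suc (Suc 0))" for xs
      using that v by (auto simp: tup \<phi>)
  next
    fix us x y vs assume *: "us @ x # vs \<in> tuples R (Suc (Suc 0))" "us @ y # vs \<in> tuples R (Suc (Suc 0))"
    show "\<phi> (us @ (x \<oplus> y) # vs) = \<phi> (us @ x # vs) \<oplus> \<phi> (us @ y # vs)"
      using * v by (cases us; cases "tl us") (auto simp: tup \<phi> R.l_distr R.r_distr)
  next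
    fix us x s y vs assume *: "us @ x # y # vs \<in> tuples R (Suc (Suc 0))" "s \<in> carrier S"
    have "x \<otimes> h s \<otimes> v \<otimes> y = x \<otimes> v \<otimes> (h s \<otimes> y)" if "x \<in> carrier R" "y \<in> carrier R"
    proof -
      have "x \<otimes> h s \<otimes> v \<otimes> y = x \<otimes> (h s \<otimes> v) \<otimes> y" using that v *(2) by (simp add: R.m_assoc)
      also have "\<dots> = x \<otimes> v \<otimes> (h s \<otimes> y)"
        unfolding comm[OF *(2)] using that v *(2) by (simp add: R.m_assoc)
      finally show ?thesis .
    qed
    then show "\<phi> (us @ (x \<otimes> h s) # y # vs) = \<phi> (us @ x # (h s \<otimes> y) # vs)"
      using * by (cases us; cases "tl us") (auto simp: tup \<phi>)
  next
    fix r x xs assume "r \<in> carrier R" "x \<in> carrier R" "xs \<in> tuples R (Suc 0)"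
    then show "\<phi> ((r \<otimes> x) # xs) = r \<otimes> \<phi> (x # xs)" "\<phi> (xs @ [x \<otimes> r]) = \<phi> (xs @ [x]) \<otimes> r"
      using v by (auto simp: tuples_1 \<phi> R.m_assoc)
  qed blast
  show ?thesis by (rule that[OF f(1)]) (simp add: f(2) tup \<phi>)
qed

text \<open>The bimodule maps \<open>R \<otimes> R \<rightarrow> R\<close> are \<open>x \<otimes> y \<mapsto> x d y\<close> with \<open>d\<close> in the centralizer \<open>V\<close> of \<open>S\<close>, and the
  maps \<open>R \<rightarrow> R \<otimes> R\<close> are \<open>a \<mapsto> a e\<close> with \<open>e\<close> a Casimir element.  The hypothesis writes \<open>1 \<otimes> 1\<close>
  as \<open>\<Sum>\<^sub>i d\<^sub>i e\<^sub>i\<close>; applying \<open>x \<otimes> y \<mapsto> x v y\<close> shows that the \<open>d\<^sub>i\<close> generate \<open>V\<close> over the center \<open>Z\<close>, and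
  \<open>v = 1\<close> shows \<open>1 \<in> I V\<close> for the ideal \<open>I\<close> of \<open>Z\<close> of all products \<open>\<mu>(e)\<close> of Casimir elements.  By
  Nakayama \<open>1 = \<mu>(e)\<close> for some \<open>e\<close>, and this \<open>e\<close> splits \<open>\<mu>\<close>.\<close>

lemma H_separable_imp_separable:
  assumes H: "summand_of_power R R (T (Suc (Suc 0))) (regular_bimodule R)"
  shows "summand_of_power R R (regular_bimodule R) (T (Suc (Suc 0)))"
proof -
  let ?T = "T (Suc (Suc 0))" and ?M = "regular_bimodule R"
  interpret T2: ring_bimodule R R ?T by (rule T_ring_bimodule)
  interpret M: ring_bimodule R R ?M by (rule regular_bimodule_RR)
  define u where "u = elt [\<one>, \<one>]"
  define V where "V = {v \<in> carrier R. \<forall>s\<in>carrier S. h s \<otimes> v = v \<otimes> h s}"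
  define Z where "Z = {z \<in> carrier R. \<forall>a\<in>carrier R. z \<otimes> a = a \<otimes> z}"
  define Cas where "Cas = {e \<in> carrier ?T. \<forall>a\<in>carrier R. a \<odot>\<^bsub>?T\<^esub> e = e \<odot>\<^sub>r\<^bsub>?T\<^esub> a}"
  have u: "u \<in> carrier ?T" unfolding u_def by (rule elt_closed) (simp add: tuples_def)
  have VR: "V \<subseteq> carrier R" and ZR: "Z \<subseteq> carrier R" by (auto simp: V_def Z_def)
  have V1: "\<one> \<in> V" by (simp add: V_def)
  have "\<exists>f. f \<in> bihom R R ?T ?M \<and>
      (\<forall>x\<in>carrier R. \<forall>y\<in>carrier R. f (elt [x, y]) = x \<otimes> v \<otimes> y)" if v: "v \<in> V" for v
    by (rule sandwich_map[of v]) (use v in \<open>auto simp: V_def\<close>)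
  then obtain m where m: "\<And>v. v \<in> V \<Longrightarrow> m v \<in> bihom R R ?T ?M"
    "\<And>v x y. v \<in> V \<Longrightarrow> x \<in> carrier R \<Longrightarrow> y \<in> carrier R \<Longrightarrow> m v (elt [x, y]) = x \<otimes> v \<otimes> y"
    by metis
  note md = bihomD[OF m(1), unfolded regular_sel]
  have mu: "m v u = v" if "v \<in> V" for v using m(2)[OF that] VR that unfolding u_def by auto
  define I where "I = m \<one> ` Cas"
  have mZ: "m v e \<in> Z" if "v \<in> V" "e \<in> Cas" for v e
    using that md(2)[OF that(1), of e] md(4)[OF that(1), of _ e] md(5)[OF that(1), of e]
    by (auto simp: Z_def Cas_def)
  have IZ: "I \<subseteq> Z" using mZ[OF V1] by (auto simp: I_def)
  have Iadd: "i \<oplus> j \<in> I" if ij: "i \<in> I" "j \<in> I" for i j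
  proof -
    obtain e e' where e: "e \<in> Cas" "e' \<in> Cas" "i = m \<one> e" "j = m \<one> e'" using ij by (auto simp: I_def)
    then have "i \<oplus> j = m \<one> (e \<oplus>\<^bsub>?T\<^esub> e')" using md(3)[OF V1, of e e'] by (simp add: Cas_def)
    moreover have "e \<oplus>\<^bsub>?T\<^esub> e' \<in> Cas" using e by (simp add: Cas_def T2.lact_add T2.ract_add)
    ultimately show ?thesis by (simp add: I_def)
  qed
  have Imult: "i \<otimes> z \<in> I" if iz: "i \<in> I" "z \<in> Z" for i z
  proof -
    obtain e where e: "e \<in> Cas" "i = m \<one> e" using iz by (auto simp: I_def)
    have z: "z \<in> carrier R" and eT: "e \<in> carrier ?T" using iz ZR e by (auto simp: Cas_def)
    have "i \<otimes> z = m \<one> (e \<odot>\<^sub>r\<^bsub>?T\<^esub> z)" using md(5)[OF V1 eT z] e by simp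
    moreover have "e \<odot>\<^sub>r\<^bsub>?T\<^esub> z \<in> Cas"
    proof -
      have "a \<odot>\<^bsub>?T\<^esub> (e \<odot>\<^sub>r\<^bsub>?T\<^esub> z) = (e \<odot>\<^sub>r\<^bsub>?T\<^esub> z) \<odot>\<^sub>r\<^bsub>?T\<^esub> a" if a: "a \<in> carrier R" for a
      proof -
        have "a \<odot>\<^bsub>?T\<^esub> (e \<odot>\<^sub>r\<^bsub>?T\<^esub> z) = (e \<odot>\<^sub>r\<^bsub>?T\<^esub> a) \<odot>\<^sub>r\<^bsub>?T\<^esub> z"
          using T2.lact_ract[OF a z eT] e a by (simp add: Cas_def)
        also have "\<dots> = e \<odot>\<^sub>r\<^bsub>?T\<^esub> (z \<otimes> a)"
          using T2.mult_ract[OF a z eT] iz(2) a by (simp add: Z_def)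
        finally show ?thesis using T2.mult_ract[OF z a eT] by simp
      qed
      then show ?thesis using eT z by (simp add: Cas_def)
    qed
    ultimately show ?thesis by (simp add: I_def)
  qed
  have I0: "\<zero> \<in> I"
  proof -
    have "\<zero>\<^bsub>?T\<^esub> \<in> Cas" by (simp add: Cas_def)
    moreover have "m \<one> \<zero>\<^bsub>?T\<^esub> = \<zero>"
      using bihom_zero[OF m(1)[OF V1] T2.abelian_group_axioms M.abelian_group_axioms] by simp
    ultimately show ?thesis unfolding I_def by (metis imageI)
  qed
  have uc: "h s \<odot>\<^bsub>?T\<^esub> u = u \<odot>\<^sub>r\<^bsub>?T\<^esub> h s" if "s \<in> carrier S" for s
    unfolding u_def using that lact_elt[of "h s" "\<one>" "[\<one>]" "Suc 0"]
      ract_elt[of "h s" "\<one>" "[\<one>]" "Suc 0"] elt_balanced[of "[]" "\<one>" "\<one>" "[]" "Suc (Suc 0)" s]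
    by (simp add: tuples_def)
  have gens: "\<exists>ds. set ds \<subseteq> V \<and> (\<forall>v\<in>V. m v (k u) \<in> R.combinations Z ds) \<and>
      m \<one> (k u) \<in> R.combinations I ds" if "k \<in> factor_sums R R ?T ?M" for k
    using that
  proof induction
    case zero
    have "m v \<zero>\<^bsub>?T\<^esub> = \<zero>" if "v \<in> V" for v
      using bihom_zero[OF m(1)[OF that] T2.abelian_group_axioms M.abelian_group_axioms] by simp
    then show ?case using u V1 by (intro exI[of _ "[]"]) simp
  next
    case (step k f g)
    note fd = bihomD[OF step.hyps(2), unfolded regular_sel] and gd = bihomD[OF step.hyps(3), unfolded regular_sel]
    obtain ds where ds: "set ds \<subseteq> V" "\<forall>v\<in>V. m v (k u) \<in> R.combinations Z ds"
      "m \<one> (k u) \<in> R.combinations I ds" using step.IH by blast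
    define d where "d = f u"
    define e where "e = g \<one>"
    have dR: "d \<in> carrier R" using fd(2)[OF u] by (simp add: d_def)
    have d: "d \<in> V"
      using fd(4)[of _ u] fd(5)[of u] uc u dR by (auto simp: V_def d_def) (metis h_closed)
    have eT: "e \<in> carrier ?T" using gd(2) by (simp add: e_def)
    have ge: "g a = a \<odot>\<^bsub>?T\<^esub> e" "g a = e \<odot>\<^sub>r\<^bsub>?T\<^esub> a" if "a \<in> carrier R" for a
      using gd(4)[of a "\<one>"] gd(5)[of "\<one>" a] that by (simp_all add: e_def)
    have e: "e \<in> Cas" using eT ge by (simp add: Cas_def)
    have ku: "k u \<in> carrier ?T" by (rule factor_sums_closed[OF T2.biaction_axioms step.hyps(1) u])
    have app: "m v ((\<lambda>x\<in>carrier ?T. k x \<oplus>\<^bsub>?T\<^esub> g (f x)) u) = m v e \<otimes> d \<oplus> m v (k u)"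
      if v: "v \<in> V" for v
    proof -
      have "m v (g d) = m v e \<otimes> d" using ge(2)[OF dR] md(5)[OF v eT dR] by simp
      then show ?thesis
        using u ku md(2)[OF v ku] md(3)[OF v ku, of "g d"] gd(2)[OF dR] dR md(2)[OF v eT]
        by (simp add: d_def[symmetric] R.a_comm)
    qed
    have "\<forall>v\<in>V. m v ((\<lambda>x\<in>carrier ?T. k x \<oplus>\<^bsub>?T\<^esub> g (f x)) u) \<in> R.combinations Z (d # ds)"
    proof
      fix v assume v: "v \<in> V"
      show "m v ((\<lambda>x\<in>carrier ?T. k x \<oplus>\<^bsub>?T\<^esub> g (f x)) u) \<in> R.combinations Z (d # ds)"
        unfolding app[OF v] R.combinations.simps using mZ[OF v e] ds(2) v by blast
    qed
    moreover have "m \<one> ((\<lambda>x\<in>carrier ?T. k x \<oplus>\<^bsub>?T\<^esub> g (f x)) u) \<in> R.combinations I (d # ds)"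
      unfolding app[OF V1] R.combinations.simps I_def using ds(3)[unfolded I_def] e by blast
    moreover have "set (d # ds) \<subseteq> V" using d ds(1) by simp
    ultimately show ?case by blast
  qed
  obtain ds where ds: "set ds \<subseteq> V" "\<forall>v\<in>V. v \<in> R.combinations Z ds" "\<one> \<in> R.combinations I ds"
  proof -
    have "(\<lambda>x\<in>carrier ?T. x) u = u" using u by simp
    then obtain ds where ds: "set ds \<subseteq> V" "\<forall>v\<in>V. m v u \<in> R.combinations Z ds"
      "m \<one> u \<in> R.combinations I ds"
      using gens[OF H[unfolded summand_of_power_def]] by metis
    show ?thesis
      by (rule that[of ds]) (use ds mu V1 in simp_all)
  qed
  have commute_mult: "v \<otimes> w \<otimes> a = a \<otimes> (v \<otimes> w)"
    if "v \<in> carrier R" "w \<in> carrier R" "a \<in> carrier R" "v \<otimes> a = a \<otimes> v" "w \<otimes> a = a \<otimes> w" for v w a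
  proof -
    have "v \<otimes> w \<otimes> a = v \<otimes> (a \<otimes> w)" using that(1-3) by (simp add: R.m_assoc that(5))
    also have "\<dots> = (v \<otimes> a) \<otimes> w" using that(1-3) by (simp add: R.m_assoc)
    also have "\<dots> = a \<otimes> (v \<otimes> w)" using that(1-3) by (simp add: R.m_assoc that(4))
    finally show ?thesis .
  qed
  have "\<one> \<in> I"
  proof (rule R.eliminate_generators[of Z I V ds ds "\<one>"])
    show "z \<otimes> z' \<in> Z" if z: "z \<in> Z" "z' \<in> Z" for z z'
    proof -
      have "z \<otimes> z' \<otimes> a = a \<otimes> (z \<otimes> z')" if a: "a \<in> carrier R" for a
        by (rule commute_mult) (use z a in \<open>auto simp: Z_def\<close>)
      moreover have "z \<otimes> z' \<in> carrier R" using z ZR by auto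
      ultimately show ?thesis unfolding Z_def by blast
    qed
    show "v \<otimes> w \<in> V" if v: "v \<in> V" "w \<in> V" for v w
    proof -
      have "h s \<otimes> (v \<otimes> w) = v \<otimes> w \<otimes> h s" if s: "s \<in> carrier S" for s
        by (rule commute_mult[symmetric]) (use v s in \<open>auto simp: V_def\<close>)
      moreover have "v \<otimes> w \<in> carrier R" using v VR by auto
      ultimately show ?thesis unfolding V_def by blast
    qed
    show "\<one> \<ominus> \<one> \<in> I" using I0 by (simp add: a_minus_def R.r_neg)
    show "\<one> \<otimes> v \<in> R.combinations Z ds" if "v \<in> V" for v using that ds(2) VR by auto
    show "z \<oplus> z' \<in> Z" if "z \<in> Z" "z' \<in> Z" for z z'
      using that by (simp add: Z_def R.l_distr R.r_distr)
    show "\<ominus> z \<in> Z" if "z \<in> Z" for z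
      using that by (simp add: Z_def R.l_minus R.r_minus)
    show "z \<otimes> a = a \<otimes> z" if "z \<in> Z" "a \<in> carrier R" for z a
      using that unfolding Z_def by blast
    show "\<one> \<in> Z" by (simp add: Z_def)
  qed (fact ZR IZ Iadd Imult I0 VR V1 ds)+
  then obtain e where e: "e \<in> Cas" "m \<one> e = \<one>" by (auto simp: I_def)
  have eT: "e \<in> carrier ?T" using e by (simp add: Cas_def)
  have i: "(\<lambda>a\<in>carrier R. a \<odot>\<^bsub>?T\<^esub> e) \<in> bihom R R ?M ?T"
  proof (rule bihomI, unfold regular_sel)
    fix a b assume ab: "a \<in> carrier R" "b \<in> carrier R"
    have "(a \<otimes> b) \<odot>\<^bsub>?T\<^esub> e = a \<odot>\<^bsub>?T\<^esub> (e \<odot>\<^sub>r\<^bsub>?T\<^esub> b)"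
      using T2.mult_lact[OF ab eT] e ab by (simp add: Cas_def)
    then show "(\<lambda>a\<in>carrier R. a \<odot>\<^bsub>?T\<^esub> e) (a \<otimes> b) = (\<lambda>a\<in>carrier R. a \<odot>\<^bsub>?T\<^esub> e) a \<odot>\<^sub>r\<^bsub>?T\<^esub> b"
      using T2.lact_ract[OF ab eT] ab by simp
  qed (use eT in \<open>auto simp: T2.add_lact T2.mult_lact\<close>)
  show ?thesis
  proof (rule summand_of_powerI_retract[OF M.biaction_axioms i m(1)[OF V1]])
    fix a assume "a \<in> carrier ?M"
    then show "m \<one> ((\<lambda>a\<in>carrier R. a \<odot>\<^bsub>?T\<^esub> e) a) = a"
      using md(4)[OF V1, of a e] eT e(2) by simp
  qed
qed

end


section \<open>The tower of endomorphism rings\<close>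

context subring_pair
begin

lemma extension_A: "ring_extension A B' id"
  by (intro ring_extension.intro A.ring_axioms ring_B' ring_extension_axioms.intro ring_hom_memI) simp_all

lemma extension_E: "ring_extension E A lm"
  by (intro ring_extension.intro A.ring_axioms ring_E ring_extension_axioms.intro lm_hom)

abbreviation TA where "TA m \<equiv> tensor_power A B' id m"
abbreviation TE where "TE m \<equiv> restrict_scalars lm lm (tensor_power E A lm m)"

lemma TA_biaction: "biaction A A (TA (Suc m))"
  using ring_extension.T_biaction[OF extension_A] .

lemma TE_biaction: "biaction A A (TE (Suc m))"
  by (rule ring_bimodule.axioms(3)[OF restrict_scalars_bimodule[OF
        ring_extension.T_ring_bimodule[OF extension_E] A.ring_axioms A.ring_axioms lm_hom lm_hom]])

text \<open>The case \<open>k = 0\<close> is the step from \<open>A \<sim> C\<^sub>1(A,B)\<close>, with \<open>E \<otimes>\<^sub>A A = C\<^sub>1(E,A)\<close>.\<close>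

lemma endomorphism_tower:
  assumes fg: "fg_projective_right B' (regular_bimodule A)"
    and AD: "summand_of_power B' A (regular_bimodule A) D"
    and DA: "summand_of_power B' A D (regular_bimodule A)"
  shows "summand_of_power A A (TE (Suc k)) (TA (Suc (Suc k))) \<and>
    summand_of_power A A (TA (Suc (Suc k))) (TE (Suc k))"
proof -
  interpret EA: ring_extension E A lm by (rule extension_E)
  interpret AB: ring_extension_over A B' id A id B
    by (intro ring_extension_over.intro extension_A A.ring_axioms ring_extension_over_axioms.intro
        ring_hom_memI) (simp_all add: B_sub)
  interpret EE: ring_extension_over E A lm A lm "carrier A"
    by (intro ring_extension_over.intro extension_E A.ring_axioms ring_extension_over_axioms.intro
        lm_hom) simp_all
  show ?thesis
  proof (induction k)
    case 0
    interpret endomorphism_step A B "regular_bimodule A" "TE (Suc 0)"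
      "\<lambda>x a. EA.elt [x \<otimes>\<^bsub>E\<^esub> lm a]" "TA (Suc 0)" "TA (Suc (Suc 0))" "AB.tcons (Suc 0)"
      by (intro endomorphism_step.intro endomorphism_step_axioms.intro subring_pair_axioms fg
          EA.tensor_over_base EA.factors_base biaction.axioms(1)[OF TA_biaction]
          AB.tensor_over_step[of 0, unfolded restrict_scalars_id]
          AB.factors_step[of _ 0, unfolded restrict_scalars_id] biaction.axioms(1)[OF TE_biaction])
    show ?case
      using summand_forward[OF DA] summand_backward[OF AD] AB.T_1_regular by blast
  next
    case (Suc k)
    interpret endomorphism_step A B "TE (Suc k)" "TE (Suc (Suc k))"
      "EA.tcons (Suc k)" "TA (Suc (Suc k))" "TA (Suc (Suc (Suc k)))" "AB.tcons (Suc (Suc k))"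
      by (intro endomorphism_step.intro endomorphism_step_axioms.intro subring_pair_axioms fg
          EE.tensor_over_step EE.factors_step biaction.axioms(1)[OF TA_biaction]
          AB.tensor_over_step[of "Suc k", unfolded restrict_scalars_id]
          AB.factors_step[of _ "Suc k", unfolded restrict_scalars_id] biaction.axioms(1)[OF TE_biaction])
    show ?case
      using summand_forward[OF DA] summand_backward[OF AD] Suc.IH by blast
  qed
qed

lemma H_depth_iff:
  assumes "n \<ge> 1"
  shows "has_H_depth A B' id (2 * n - 1) \<longleftrightarrow> summand_of_power A A (TA (Suc n)) (TA n)"
proof -
  obtain k where k: "n = Suc k" using assms by (cases n) auto
  have "m = n" if "m \<ge> 1" "2 * n - 1 = 2 * m - (1::nat)" for m using that assms by linarith
  then have "has_H_depth A B' id (2 * n - 1) \<longleftrightarrow>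
    (\<exists>q>0. iso_to_direct_summand A A (TA (Suc n)) (bimodule_power (TA n) q))"
    using assms unfolding has_H_depth_def Suc_eq_plus1 by metis
  then show ?thesis
    using summand_of_power_iff[OF TA_biaction TA_biaction, of "Suc k" k] k by simp
qed

lemma depth_iff:
  "has_depth E A lm (2 * Suc m - 1) \<longleftrightarrow>
    (if m = 0 then summand_of_power A A (TE 1) (regular_bimodule A) \<and>
        summand_of_power A A (regular_bimodule A) (TE 1)
      else summand_of_power A A (TE (Suc m)) (TE m) \<and> summand_of_power A A (TE m) (TE (Suc m)))"
proof -
  have "has_depth E A lm (2 * Suc m - 1) \<longleftrightarrow>
    (if m = 0 then H_equivalent A A (TE 1) (regular_bimodule A)
      else H_equivalent A A (TE (Suc m)) (TE m))"
    unfolding has_depth_def by auto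
  moreover have "H_equivalent A A (TE 1) (regular_bimodule A) \<longleftrightarrow>
      summand_of_power A A (regular_bimodule A) (TE 1) \<and> summand_of_power A A (TE 1) (regular_bimodule A)"
    using H_equivalent_iff[OF ring_bimodule.axioms(3)[OF AA] TE_biaction[of 0]] by simp
  moreover have "H_equivalent A A (TE (Suc m)) (TE m) \<longleftrightarrow>
      summand_of_power A A (TE m) (TE (Suc m)) \<and> summand_of_power A A (TE (Suc m)) (TE m)"
    if m: "m \<noteq> 0"
  proof -
    obtain k where "m = Suc k" using m by (cases m) auto
    then show ?thesis using H_equivalent_iff[OF TE_biaction TE_biaction] by simp
  qed
  ultimately show ?thesis by auto
qed

lemma H_depth_iff_depth:
  assumes fg: "fg_projective_right B' (regular_bimodule A)"
    and AD: "summand_of_power B' A (regular_bimodule A) D"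
    and DA: "summand_of_power B' A D (regular_bimodule A)"
    and n: "n \<ge> 1"
  shows "has_H_depth A B' id (2 * n - 1) \<longleftrightarrow> has_depth E A lm (2 * n - 1)"
proof -
  interpret AB: ring_extension A B' id by (rule extension_A)
  note A_bi = ring_bimodule.axioms(3)[OF AA]
  note tower = endomorphism_tower[OF fg AD DA]
  note EtoA = tower[THEN conjunct1] and AtoE = tower[THEN conjunct2]
  note T1 = AB.T_1_regular
  obtain m where m: "n = Suc m" using n by (cases n) auto
  show ?thesis
  proof (cases m)
    case 0
    have "summand_of_power A A (TA (Suc (Suc 0))) (TA (Suc 0)) \<longleftrightarrow>
      summand_of_power A A (TA (Suc (Suc 0))) (regular_bimodule A)"
      using summand_of_power_trans[OF TA_biaction TA_biaction A_bi _ T1(1)]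
        summand_of_power_trans[OF TA_biaction A_bi TA_biaction _ T1(2)] by blast
    also have "\<dots> \<longleftrightarrow> summand_of_power A A (TA (Suc (Suc 0))) (regular_bimodule A) \<and>
        summand_of_power A A (regular_bimodule A) (TA (Suc (Suc 0)))"
      using AB.H_separable_imp_separable by blast
    also have "\<dots> \<longleftrightarrow> summand_of_power A A (TE (Suc 0)) (regular_bimodule A) \<and>
        summand_of_power A A (regular_bimodule A) (TE (Suc 0))"
      using summand_of_power_trans[OF TE_biaction TA_biaction A_bi EtoA]
        summand_of_power_trans[OF TA_biaction TE_biaction A_bi AtoE]
        summand_of_power_trans[OF A_bi TE_biaction TA_biaction _ EtoA]
        summand_of_power_trans[OF A_bi TA_biaction TE_biaction _ AtoE] by blast
    finally show ?thesis using H_depth_iff[OF n] depth_iff[of m] 0 m by simp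
  next
    case (Suc k)
    have "summand_of_power A A (TA (Suc (Suc (Suc k)))) (TA (Suc (Suc k))) \<longleftrightarrow>
        summand_of_power A A (TA (Suc (Suc (Suc k)))) (TA (Suc (Suc k))) \<and>
        summand_of_power A A (TA (Suc (Suc k))) (TA (Suc (Suc (Suc k))))"
      using AB.T_summand_T_Suc by blast
    also have "\<dots> \<longleftrightarrow> summand_of_power A A (TE (Suc (Suc k))) (TE (Suc k)) \<and>
        summand_of_power A A (TE (Suc k)) (TE (Suc (Suc k)))"
    proof -
      have "summand_of_power A A (TA (Suc (Suc i))) (TA (Suc (Suc j))) \<longleftrightarrow>
        summand_of_power A A (TE (Suc i)) (TE (Suc j))" for i j
        using summand_of_power_trans[OF TE_biaction TA_biaction TE_biaction
            summand_of_power_trans[OF TE_biaction TA_biaction TA_biaction EtoA] AtoE]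
          summand_of_power_trans[OF TA_biaction TE_biaction TA_biaction
            summand_of_power_trans[OF TA_biaction TE_biaction TE_biaction AtoE] EtoA] by blast
      then show ?thesis by blast
    qed
    finally show ?thesis using H_depth_iff[OF n] depth_iff[of m] Suc m by simp
  qed
qed

end

lemma bimodule_iso_imp_summand_of_power:
  assumes N: "biaction R S N" and M: "biaction R S M" and iso: "bimodule_iso R S N M"
  shows "summand_of_power R S N M" "summand_of_power R S M N"
proof -
  interpret N: biaction R S N by fact
  interpret M: biaction R S M by fact
  obtain f where f: "f \<in> bihom R S N M" and b: "bij_betw f (carrier N) (carrier M)"
    using iso by (auto simp: bimodule_iso_def bihom_def)
  note fd = bihomD[OF f]
  define g where "g = restrict (inv_into (carrier N) f) (carrier M)"
  have gf: "g (f x) = x" if "x \<in> carrier N" for x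
    using that b fd(2) by (simp add: g_def bij_betw_def)
  have sur: "\<exists>x. x \<in> carrier N \<and> y = f x" if "y \<in> carrier M" for y
    using that b by (auto simp: bij_betw_def)
  have g: "g \<in> bihom R S M N"
  proof (rule bihomI)
    show "g \<in> carrier M \<rightarrow>\<^sub>E carrier N" using sur gf by (fastforce simp: g_def)
  next
    fix y y' assume "y \<in> carrier M" "y' \<in> carrier M"
    then obtain x x' where "x \<in> carrier N" "x' \<in> carrier N" "y = f x" "y' = f x'" using sur by metis
    then show "g (y \<oplus>\<^bsub>M\<^esub> y') = g y \<oplus>\<^bsub>N\<^esub> g y'" using fd(3)[of x x', symmetric] gf by simp
  next
    fix r y assume r: "r \<in> carrier R" and "y \<in> carrier M"
    then obtain x where "x \<in> carrier N" "y = f x" using sur by metis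
    then show "g (r \<odot>\<^bsub>M\<^esub> y) = r \<odot>\<^bsub>N\<^esub> g y" using fd(4)[OF r, of x, symmetric] gf r by simp
  next
    fix r y assume "y \<in> carrier M" and r: "r \<in> carrier S"
    then obtain x where "x \<in> carrier N" "y = f x" using sur by metis
    then show "g (y \<odot>\<^sub>r\<^bsub>M\<^esub> r) = g y \<odot>\<^sub>r\<^bsub>N\<^esub> r" using fd(5)[OF _ r, of x, symmetric] gf r by simp
  qed
  show "summand_of_power R S N M"
    by (rule summand_of_powerI_retract[OF N f g gf])
  show "summand_of_power R S M N"
    by (rule summand_of_powerI_retract[OF M g f]) (use sur gf in metis)
qed

theorem theorem4p2:
  fixes A :: "('a, 'x) ring_scheme" and B :: "'a set" and n :: nat
  assumes "ring A" and "subring B A"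
    and "Frobenius_extension A B \<or> QF_extension A B"
    and "n \<ge> 1"
  shows "has_H_depth A (A\<lparr>carrier := B\<rparr>) id (2 * n - 1) \<longleftrightarrow>
    has_depth (End_right (A\<lparr>carrier := B\<rparr>) (regular_bimodule A)) A (left_multiplication A) (2 * n - 1)"
proof -
  interpret subring_pair A B
    by (intro subring_pair.intro subring_pair_axioms.intro assms(1,2))
  note A_bi = ring_bimodule.axioms(3)[OF BA]
  have "fg_projective_right B' (regular_bimodule A) \<and>
      summand_of_power B' A (regular_bimodule A) D \<and> summand_of_power B' A D (regular_bimodule A)"
    using assms(3)
  proof
    assume "Frobenius_extension A B"
    then show ?thesis
      using bimodule_iso_imp_summand_of_power[OF A_bi D_biaction]
      by (simp add: Frobenius_extension_def Let_def)
  next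
    assume "QF_extension A B"
    then show ?thesis
      using H_equivalent_iff[OF D_biaction A_bi] by (simp add: QF_extension_def Let_def)
  qed
  then show ?thesis using H_depth_iff_depth assms(4) by blast
qed

end
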